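(* The de Vries dual equivalence $\mathsf{Clust}:\mathbf{deV}^{\rm op}\to\mathbf{KHaus}$ may be presented as the comparison functor into the Eilenberg-Moore category of the monad on $\mathbf{Set}$ induced by the adjunction $\mathbf{Set}(-,\mathsf 2)\dashv\mathbf{deV}(-,\mathsf 2):\mathbf{deV}^{\rm op}\to\mathbf{Set}$. That is, this monad is isomorphic to the ultrafilter monad, so that its Eilenberg-Moore category is identified with $\mathbf{KHaus}$, and under this identification the comparison functor $\mathbf{deV}^{\rm op}\to\mathbf{KHaus}$, a lifting of $\mathbf{deV}(-,\mathsf 2):\mathbf{deV}^{\rm op}\to\mathbf{Set}$, is naturally isomorphic to the dual equivalence $\mathsf{Clust}$.
   Context: A contact algebra is a Boolean algebra $A$ (operations $\vee,\wedge$, complement $^*$, constants $0,1$) with a relation $\frown$ such that for all $a,b,c$: $a\frown a$ whenever $a>0$; $a\frown b$ implies $a>0$ and $b>0$; $a\frown b$ implies $b\frown a$; $a\frown(b\vee c)$ iff $a\frown b$ or $a\frown c$. It is normal if also: $a\not\frown b$ implies $a\not\frown c$ and $b\not\frown c^*$ for some $c$; and if $a<1$ then there is $b>0$ with $b\not\frown a$. Put $a\ll b\iff a\not\frown b^*$. A de Vries algebra is a complete normal contact algebra. Every complete Boolean algebra is a (discrete) de Vries algebra with $a\frown b\iff a\wedge b\neq0$, so that $\ll$ is the order $\le$. $\mathbf{deV}$: objects are de Vries algebras; morphisms are maps $\varphi:A\to B$ with, for all $a,b\in A$: $\varphi(0)=0$; $\varphi(a\wedge b)=\varphi(a)\wedge\varphi(b)$;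 $a^*\ll b$ implies $\varphi(a)^*\ll\varphi(b)$; $\varphi(a)=\bigvee\{\varphi(b)\mid b\ll a\}$. Composition is $(\psi\diamond\varphi)(a)=\bigvee\{\psi(\varphi(b))\mid b\ll a\}$. A cluster in a de Vries algebra $A$ is a subset $\mathfrak c\neq\emptyset$ such that: $a,b\in\mathfrak c$ implies $a\frown b$; $a\vee b\in\mathfrak c$ implies $a\in\mathfrak c$ or $b\in\mathfrak c$; if $a\frown b$ for all $b\in\mathfrak c$ then $a\in\mathfrak c$. $\mathsf{Clust}(A)$ is the set of clusters of $A$ with the topology having the sets $\tau_A(a)=\{\mathfrak c\mid a\in\mathfrak c\}$, $a\in A$, as basic closed sets. For a de Vries morphism $\varphi:A\to B$, $\mathsf{Clust}(\varphi):\mathsf{Clust}(B)\to\mathsf{Clust}(A)$ sends $\mathfrak d$ to $\{a\in A\mid\forall b\in A\,(b\ll a^*\Rightarrow\varphi(b)^*\in\mathfrak d)\}$. By de Vries' theorem, $\mathsf{Clust}:\mathbf{deV}^{\rm op}\to\mathbf{KHaus}$ is an equivalence, where $\mathbf{KHaus}$ is the category of compact Hausdorff spaces and continuous maps. $\mathsf 2$ is the two-element Boolean algebra as a discrete de Vries algebra (or the two-element set). $\mathbf{Set}(X,\mathsf 2)\cong$ power set of $X$ is regarded as a discrete de Vries algebra, and $\mathbf{Set}(-,\mathsf 2)$ acts on maps by inverse images; $\mathbf{deV}(\alpha,\mathsf 2)$ is $\varphi\mapsto\varphi\diamond\alpha$. The adjunction is given by the bijective correspondence between de Vries morphisms $\varphi:A\to\mathbf{Set}(X,\mathsf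 2)$ and maps $f:X\to\mathbf{deV}(A,\mathsf 2)$ with $f(x)(a)=\varphi(a)(x)$. The ultrafilter monad on $\mathbf{Set}$ has endofunctor $X\mapsto$ set of ultrafilters on $X$; its Eilenberg-Moore category is isomorphic over $\mathbf{Set}$ to $\mathbf{KHaus}$ (Manes). *)

theory Defs
  imports "HOL-Analysis.Analysis" "HOL-Algebra.Complete_Lattice"
begin

section \<open>De Vries algebras\<close>

record 'a contact_alg = "'a gorder" +
  contact :: "'a \<Rightarrow> 'a \<Rightarrow> bool" (infix \<open>\<frown>\<index>\<close> 50)

definition complement :: "('a, 'm) gorder_scheme \<Rightarrow> 'a \<Rightarrow> 'a" where
  "complement L a = (THE b. b \<in> carrier L \<and> a \<sqinter>\<^bsub>L\<^esub> b = \<bottom>\<^bsub>L\<^esub> \<and> a \<squnion>\<^bsub>L\<^esub> b = \<top>\<^bsub>L\<^esub>)"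

definition well_inside :: "('a, 'm) contact_alg_scheme \<Rightarrow> 'a \<Rightarrow> 'a \<Rightarrow> bool" where
  "well_inside A a b \<longleftrightarrow> \<not> a \<frown>\<^bsub>A\<^esub> complement A b"

text \<open>Boolean algebras are complemented distributive bounded lattices; the one-element
  algebra (with bottom equal to top) is not excluded.\<close>

locale boolean_lattice = bounded_lattice +
  assumes inf_sup_distrib:
    "\<lbrakk>a \<in> carrier L; b \<in> carrier L; c \<in> carrier L\<rbrakk>
      \<Longrightarrow> a \<sqinter> (b \<squnion> c) = (a \<sqinter> b) \<squnion> (a \<sqinter> c)"
    and complement_exists:
    "a \<in> carrier L \<Longrightarrow> \<exists>b \<in> carrier L. a \<sqinter> b = \<bottom> \<and> a \<squnion> b = \<top>"

locale contact_algebra = boolean_lattice A for A (structure) +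
  assumes contact_refl: "\<lbrakk>a \<in> carrier A; a \<noteq> \<bottom>\<rbrakk> \<Longrightarrow> a \<frown> a"
    and contact_nonzero:
      "\<lbrakk>a \<in> carrier A; b \<in> carrier A; a \<frown> b\<rbrakk> \<Longrightarrow> a \<noteq> \<bottom> \<and> b \<noteq> \<bottom>"
    and contact_sym: "\<lbrakk>a \<in> carrier A; b \<in> carrier A; a \<frown> b\<rbrakk> \<Longrightarrow> b \<frown> a"
    and contact_sup:
      "\<lbrakk>a \<in> carrier A; b \<in> carrier A; c \<in> carrier A\<rbrakk>
        \<Longrightarrow> a \<frown> (b \<squnion> c) \<longleftrightarrow> a \<frown> b \<or> a \<frown> c"

locale normal_contact_algebra = contact_algebra +
  assumes contact_interpolate:
    "\<lbrakk>a \<in> carrier A; b \<in> carrier A; \<not> a \<frown> b\<rbrakk>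
      \<Longrightarrow> \<exists>c \<in> carrier A. \<not> a \<frown> c \<and> \<not> b \<frown> complement A c"
    and contact_dense:
    "\<lbrakk>a \<in> carrier A; a \<noteq> \<top>\<rbrakk>
      \<Longrightarrow> \<exists>b \<in> carrier A. b \<noteq> \<bottom> \<and> \<not> b \<frown> a"

locale de_vries_algebra = normal_contact_algebra A + complete_lattice A for A (structure)

definition discrete :: "'a gorder \<Rightarrow> 'a contact_alg" where
  "discrete L = \<lparr>carrier = carrier L, eq = eq L, le = le L,
     contact = (\<lambda>a b. a \<sqinter>\<^bsub>L\<^esub> b \<noteq> \<bottom>\<^bsub>L\<^esub>)\<rparr>"

definition two_dv :: "bool contact_alg" where
  "two_dv = discrete \<lparr>carrier = UNIV, eq = (=), le = (\<le>)\<rparr>"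

text \<open>The algebra of two-valued functions on a set, presented as its powerset.\<close>

definition pow_dv :: "'x set \<Rightarrow> 'x set contact_alg" where
  "pow_dv X = discrete \<lparr>carrier = Pow X, eq = (=), le = (\<subseteq>)\<rparr>"

section \<open>The category of de Vries algebras\<close>

text \<open>Maps between carriers are taken to be extensional (\<open>undefined\<close> off the domain), so that
  equality of morphisms is HOL equality. The same convention is used for maps of sets and
  continuous maps.\<close>

definition dv_hom ::
  "('a, 'm) contact_alg_scheme \<Rightarrow> ('b, 'n) contact_alg_scheme \<Rightarrow> ('a \<Rightarrow> 'b) set" where
  "dv_hom A B = {\<phi> \<in> carrier A \<rightarrow>\<^sub>E carrier B.
     \<phi> \<bottom>\<^bsub>A\<^esub> = \<bottom>\<^bsub>B\<^esub> \<and>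
     (\<forall>a \<in> carrier A. \<forall>b \<in> carrier A. \<phi> (a \<sqinter>\<^bsub>A\<^esub> b) = \<phi> a \<sqinter>\<^bsub>B\<^esub> \<phi> b) \<and>
     (\<forall>a \<in> carrier A. \<forall>b \<in> carrier A.
        well_inside A (complement A a) b \<longrightarrow> well_inside B (complement B (\<phi> a)) (\<phi> b)) \<and>
     (\<forall>a \<in> carrier A. \<phi> a = \<Squnion>\<^bsub>B\<^esub> {\<phi> b | b. b \<in> carrier A \<and> well_inside A b a})}"

text \<open>Composition is not pointwise; \<open>dv_comp A C \<psi> \<phi>\<close> is the composite of
  \<open>\<phi> : A \<rightarrow> B\<close> and \<open>\<psi> : B \<rightarrow> C\<close>.\<close>

definition dv_comp ::
  "('a, 'm) contact_alg_scheme \<Rightarrow> ('c, 'n) contact_alg_scheme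
    \<Rightarrow> ('b \<Rightarrow> 'c) \<Rightarrow> ('a \<Rightarrow> 'b) \<Rightarrow> 'a \<Rightarrow> 'c" where
  "dv_comp A C \<psi> \<phi> =
     (\<lambda>a \<in> carrier A. \<Squnion>\<^bsub>C\<^esub> {\<psi> (\<phi> b) | b. b \<in> carrier A \<and> well_inside A b a})"

definition dv_id :: "('a, 'm) contact_alg_scheme \<Rightarrow> 'a \<Rightarrow> 'a" where
  "dv_id A = (\<lambda>a \<in> carrier A. a)"

section \<open>Clusters\<close>

definition clusters :: "('a, 'm) contact_alg_scheme \<Rightarrow> 'a set set" where
  "clusters A = {\<cc>. \<cc> \<subseteq> carrier A \<and> \<cc> \<noteq> {} \<and>
     (\<forall>a \<in> \<cc>. \<forall>b \<in> \<cc>. a \<frown>\<^bsub>A\<^esub> b) \<and>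
     (\<forall>a \<in> carrier A. \<forall>b \<in> carrier A. a \<squnion>\<^bsub>A\<^esub> b \<in> \<cc> \<longrightarrow> a \<in> \<cc> \<or> b \<in> \<cc>) \<and>
     (\<forall>a \<in> carrier A. (\<forall>b \<in> \<cc>. a \<frown>\<^bsub>A\<^esub> b) \<longrightarrow> a \<in> \<cc>)}"

definition clusters_at :: "('a, 'm) contact_alg_scheme \<Rightarrow> 'a \<Rightarrow> 'a set set" where
  "clusters_at A a = {\<cc> \<in> clusters A. a \<in> \<cc>}"

definition Clust :: "('a, 'm) contact_alg_scheme \<Rightarrow> 'a set topology" where
  "Clust A = topology (arbitrary union_of
     (\<lambda>U. \<exists>a \<in> carrier A. U = clusters A - clusters_at A a))"

definition Clust_map ::
  "('a, 'm) contact_alg_scheme \<Rightarrow> ('b, 'n) contact_alg_scheme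
    \<Rightarrow> ('a \<Rightarrow> 'b) \<Rightarrow> 'b set \<Rightarrow> 'a set" where
  "Clust_map A B \<phi> = (\<lambda>\<dd> \<in> clusters B. {a \<in> carrier A. \<forall>b \<in> carrier A.
     well_inside A b (complement A a) \<longrightarrow> complement B (\<phi> b) \<in> \<dd>})"

definition khaus :: "'x topology \<Rightarrow> bool" where
  "khaus T \<longleftrightarrow> compact_space T \<and> Hausdorff_space T"

definition khaus_hom :: "'x topology \<Rightarrow> 'y topology \<Rightarrow> ('x \<Rightarrow> 'y) set" where
  "khaus_hom S T = {f \<in> topspace S \<rightarrow>\<^sub>E topspace T. continuous_map S T f}"

section \<open>The dual adjunction with sets and its monad\<close>

text \<open>The action of \<open>Set(-,2)\<close> on a map \<open>f : X \<rightarrow> Y\<close>, and of \<open>deV(-,2)\<close> on a morphism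
  \<open>\<alpha> : A \<rightarrow> B\<close>.\<close>

definition set_two_map :: "'x set \<Rightarrow> 'y set \<Rightarrow> ('x \<Rightarrow> 'y) \<Rightarrow> 'y set \<Rightarrow> 'x set" where
  "set_two_map X Y f = (\<lambda>V \<in> Pow Y. {x \<in> X. f x \<in> V})"

definition dv_two_map ::
  "('a, 'm) contact_alg_scheme \<Rightarrow> ('b, 'n) contact_alg_scheme
    \<Rightarrow> ('a \<Rightarrow> 'b) \<Rightarrow> ('b \<Rightarrow> bool) \<Rightarrow> 'a \<Rightarrow> bool" where
  "dv_two_map A B \<alpha> = (\<lambda>\<phi> \<in> dv_hom B two_dv. dv_comp A two_dv \<phi> \<alpha>)"

definition transpose_dv ::
  "('a, 'm) contact_alg_scheme \<Rightarrow> 'x set \<Rightarrow> ('a \<Rightarrow> 'x set) \<Rightarrow> 'x \<Rightarrow> 'a \<Rightarrow> bool" where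
  "transpose_dv A X \<phi> = (\<lambda>x \<in> X. \<lambda>a \<in> carrier A. x \<in> \<phi> a)"

definition transpose_set ::
  "('a, 'm) contact_alg_scheme \<Rightarrow> 'x set \<Rightarrow> ('x \<Rightarrow> 'a \<Rightarrow> bool) \<Rightarrow> 'a \<Rightarrow> 'x set" where
  "transpose_set A X f = (\<lambda>a \<in> carrier A. {x \<in> X. f x a})"

text \<open>Unit and counit are the transposes of identities. The counit at \<open>A\<close> is a morphism from
  \<open>A\<close> to \<open>Set(deV(A,2),2)\<close> in \<open>deV\<close>.\<close>

definition dv_counit :: "('a, 'm) contact_alg_scheme \<Rightarrow> 'a \<Rightarrow> ('a \<Rightarrow> bool) set" where
  "dv_counit A = transpose_set A (dv_hom A two_dv) (\<lambda>\<phi> \<in> dv_hom A two_dv. \<phi>)"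

definition dvm :: "'x set \<Rightarrow> ('x set \<Rightarrow> bool) set" where
  "dvm X = dv_hom (pow_dv X) two_dv"

definition dvm_map ::
  "'x set \<Rightarrow> 'y set \<Rightarrow> ('x \<Rightarrow> 'y) \<Rightarrow> ('x set \<Rightarrow> bool) \<Rightarrow> 'y set \<Rightarrow> bool" where
  "dvm_map X Y f = dv_two_map (pow_dv Y) (pow_dv X) (set_two_map X Y f)"

definition dvm_unit :: "'x set \<Rightarrow> 'x \<Rightarrow> 'x set \<Rightarrow> bool" where
  "dvm_unit X = transpose_dv (pow_dv X) X (dv_id (pow_dv X))"

definition dvm_mult :: "'x set \<Rightarrow> (('x set \<Rightarrow> bool) set \<Rightarrow> bool) \<Rightarrow> 'x set \<Rightarrow> bool" where
  "dvm_mult X = dv_two_map (pow_dv X) (pow_dv (dvm X)) (dv_counit (pow_dv X))"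

text \<open>Objects (carrier and structure map) and morphisms of the Eilenberg-Moore category.\<close>

definition dvm_algs :: "('x set \<times> (('x set \<Rightarrow> bool) \<Rightarrow> 'x)) set" where
  "dvm_algs = {(X, \<xi>). \<xi> \<in> dvm X \<rightarrow>\<^sub>E X \<and>
     (\<forall>x \<in> X. \<xi> (dvm_unit X x) = x) \<and>
     (\<forall>\<Phi> \<in> dvm (dvm X). \<xi> (dvm_mult X \<Phi>) = \<xi> (dvm_map (dvm X) X \<xi> \<Phi>))}"

definition dvm_hom ::
  "'x set \<times> (('x set \<Rightarrow> bool) \<Rightarrow> 'x) \<Rightarrow> 'y set \<times> (('y set \<Rightarrow> bool) \<Rightarrow> 'y) \<Rightarrow> ('x \<Rightarrow> 'y) set" where
  "dvm_hom P Q = {f \<in> fst P \<rightarrow>\<^sub>E fst Q.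
     \<forall>\<phi> \<in> dvm (fst P). f (snd P \<phi>) = snd Q (dvm_map (fst P) (fst Q) f \<phi>)}"

definition comparison ::
  "('a, 'm) contact_alg_scheme \<Rightarrow> ('a \<Rightarrow> bool) set \<times> ((('a \<Rightarrow> bool) set \<Rightarrow> bool) \<Rightarrow> 'a \<Rightarrow> bool)"
  where
  "comparison A =
     (dv_hom A two_dv, dv_two_map A (pow_dv (dv_hom A two_dv)) (dv_counit A))"

section \<open>The ultrafilter monad\<close>

text \<open>Ultrafilters on a set \<open>X\<close> are represented by the library's filters on the ambient type
  which contain \<open>X\<close>.\<close>

definition ultrafilters :: "'x set \<Rightarrow> 'x filter set" where
  "ultrafilters X = {F. F \<noteq> bot \<and> F \<le> principal X \<and>
     (\<forall>P. eventually P F \<or> eventually (\<lambda>x. \<not> P x) F)}"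

definition ultra_map :: "'x set \<Rightarrow> ('x \<Rightarrow> 'y) \<Rightarrow> 'x filter \<Rightarrow> 'y filter" where
  "ultra_map X f = (\<lambda>F \<in> ultrafilters X. filtermap f F)"

definition ultra_unit :: "'x set \<Rightarrow> 'x \<Rightarrow> 'x filter" where
  "ultra_unit X = (\<lambda>x \<in> X. principal {x})"

definition filter_join :: "'x filter filter \<Rightarrow> 'x filter" where
  "filter_join \<F> = Abs_filter (\<lambda>P. eventually (\<lambda>F. eventually P F) \<F>)"

lemma eventually_filter_join:
  "eventually P (filter_join \<F>) \<longleftrightarrow> eventually (\<lambda>F. eventually P F) \<F>"
  unfolding filter_join_def
proof (rule eventually_Abs_filter, rule is_filter.intro)
  show "eventually (\<lambda>F. eventually (\<lambda>x. True) F) \<F>"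
    by (rule always_eventually) simp
next
  fix P Q :: "'a \<Rightarrow> bool"
  assume "eventually (\<lambda>F. eventually P F) \<F>" "eventually (\<lambda>F. eventually Q F) \<F>"
  then show "eventually (\<lambda>F. eventually (\<lambda>x. P x \<and> Q x) F) \<F>"
    by (rule eventually_elim2) (rule eventually_conj)
next
  fix P Q :: "'a \<Rightarrow> bool"
  assume PQ: "\<forall>x. P x \<longrightarrow> Q x" and P: "eventually (\<lambda>F. eventually P F) \<F>"
  show "eventually (\<lambda>F. eventually Q F) \<F>"
    using P by (rule eventually_mono) (use PQ in \<open>auto elim: eventually_mono\<close>)
qed

definition ultra_mult :: "'x set \<Rightarrow> 'x filter filter \<Rightarrow> 'x filter" where
  "ultra_mult X = (\<lambda>\<F> \<in> ultrafilters (ultrafilters X). filter_join \<F>)"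

definition ultra_algs :: "('x set \<times> ('x filter \<Rightarrow> 'x)) set" where
  "ultra_algs = {(X, \<xi>). \<xi> \<in> ultrafilters X \<rightarrow>\<^sub>E X \<and>
     (\<forall>x \<in> X. \<xi> (ultra_unit X x) = x) \<and>
     (\<forall>\<F> \<in> ultrafilters (ultrafilters X).
        \<xi> (ultra_mult X \<F>) = \<xi> (ultra_map (ultrafilters X) \<xi> \<F>))}"

definition ultra_hom ::
  "'x set \<times> ('x filter \<Rightarrow> 'x) \<Rightarrow> 'y set \<times> ('y filter \<Rightarrow> 'y) \<Rightarrow> ('x \<Rightarrow> 'y) set" where
  "ultra_hom P Q = {f \<in> fst P \<rightarrow>\<^sub>E fst Q.
     \<forall>F \<in> ultrafilters (fst P). f (snd P F) = snd Q (ultra_map (fst P) f F)}"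

text \<open>Manes' isomorphism: \<open>U\<close> is open iff every ultrafilter which the structure map sends
  into \<open>U\<close> contains \<open>U\<close>.\<close>

definition manes_space :: "'x set \<times> ('x filter \<Rightarrow> 'x) \<Rightarrow> 'x topology" where
  "manes_space P = topology (\<lambda>U. U \<subseteq> fst P \<and>
     (\<forall>F \<in> ultrafilters (fst P). snd P F \<in> U \<longrightarrow> eventually (\<lambda>x. x \<in> U) F))"

lemma openin_manes_space:
  "openin (manes_space P) U \<longleftrightarrow> U \<subseteq> fst P \<and>
     (\<forall>F \<in> ultrafilters (fst P). snd P F \<in> U \<longrightarrow> eventually (\<lambda>x. x \<in> U) F)"
proof -
  have "istopology (\<lambda>U. U \<subseteq> fst P \<and>
     (\<forall>F \<in> ultrafilters (fst P). snd P F \<in> U \<longrightarrow> eventually (\<lambda>x. x \<in> U) F))"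
    (is "istopology ?L")
    unfolding istopology_def
  proof (intro conjI allI impI)
    fix S T assume "?L S" "?L T"
    then show "S \<inter> T \<subseteq> fst P" "\<forall>F \<in> ultrafilters (fst P). snd P F \<in> S \<inter> T \<longrightarrow>
      eventually (\<lambda>x. x \<in> S \<inter> T) F"
      by (auto simp: eventually_conj_iff)
  next
    fix \<K> assume K: "\<forall>K \<in> \<K>. ?L K"
    then show "\<Union>\<K> \<subseteq> fst P"
      by blast
    show "\<forall>F \<in> ultrafilters (fst P). snd P F \<in> \<Union>\<K> \<longrightarrow> eventually (\<lambda>x. x \<in> \<Union>\<K>) F"
    proof (intro ballI impI)
      fix F assume F: "F \<in> ultrafilters (fst P)" "snd P F \<in> \<Union>\<K>"
      then obtain K where "K \<in> \<K>" "snd P F \<in> K"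
        by blast
      then have "eventually (\<lambda>x. x \<in> K) F"
        using K F(1) by blast
      then show "eventually (\<lambda>x. x \<in> \<Union>\<K>) F"
        by (rule eventually_mono) (use \<open>K \<in> \<K>\<close> in blast)
    qed
  qed
  then show ?thesis
    by (simp add: manes_space_def)
qed

section \<open>The comparison isomorphisms\<close>

text \<open>A morphism \<open>\<phi> : Set(X,2) \<rightarrow> 2\<close> corresponds to the filter generated by the sets sent
  to 1.\<close>

definition dvm_ultra :: "'x set \<Rightarrow> ('x set \<Rightarrow> bool) \<Rightarrow> 'x filter" where
  "dvm_ultra X = (\<lambda>\<phi> \<in> dvm X. INF U \<in> {U \<in> Pow X. \<phi> U}. principal U)"

definition alg_transfer ::
  "'x set \<times> (('x set \<Rightarrow> bool) \<Rightarrow> 'x) \<Rightarrow> 'x set \<times> ('x filter \<Rightarrow> 'x)" where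
  "alg_transfer P = (fst P,
     \<lambda>F \<in> ultrafilters (fst P). snd P (the_inv_into (dvm (fst P)) (dvm_ultra (fst P)) F))"

definition comparison_space :: "('a, 'm) contact_alg_scheme \<Rightarrow> ('a \<Rightarrow> bool) topology" where
  "comparison_space A = manes_space (alg_transfer (comparison A))"

definition point_cluster :: "('a, 'm) contact_alg_scheme \<Rightarrow> ('a \<Rightarrow> bool) \<Rightarrow> 'a set" where
  "point_cluster A = (\<lambda>\<phi> \<in> dv_hom A two_dv. {a \<in> carrier A. \<not> \<phi> (complement A a)})"

end

theory Submission
  imports Defs
begin

text \<open>A morphism \<open>A \<rightarrow> 2\<close> is a two-valued function on \<open>A\<close>, and a morphism from \<open>A\<close> into a powerset
is a family of such functions, because the operations and joins of a powerset are computed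
pointwise. This gives the adjunction (\<open>dv_hom_pow_iff\<close>, \<open>transpose_bij\<close>). When \<open>A\<close> is itself a
powerset, strong inclusion is inclusion, and a morphism \<open>Set(X,2) \<rightarrow> 2\<close> is the characteristic
function of an ultrafilter (\<open>dvm_iff\<close>); unit and multiplication of the induced monad
turn out to be principal ultrafilters and the usual join of an ultrafilter of ultrafilters
(\<open>dvm_ultra_unit\<close>, \<open>dvm_ultra_mult\<close>).

Manes' theorem is proved by ultrafilter convergence. The heart is \<open>ultra_alg_transport\<close>: given an
ultrafilter \<open>H\<close> and a filter \<open>F\<close> such that each member of \<open>F\<close> and each member of \<open>H\<close> are
related by some ultrafilter \<open>G\<close>, which contains the former and has its limit in the latter, a
single \<open>G\<close> below \<open>F\<close> has the same limit as \<open>H\<close>. With \<open>F\<close> principal this makes the closure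
operator given by limits idempotent; with \<open>H\<close> principal it makes limits unique. So an algebra
structure is exactly convergence in a compact Hausdorff topology.

Composition in \<open>deV\<close> is not pointwise: the pointwise composite satisfies all conditions of a
morphism except possibly approximation from below, and the composite of \<open>deV\<close> is its lower
regularization (\<open>regularize_hom\<close>). Associativity (\<open>dv_comp_assoc\<close>) and naturality of the counit
(\<open>dv_counit_natural\<close>) then yield both the multiplication law of the comparison algebras and the
fact that \<open>deV(\<alpha>,2)\<close> is an algebra map: the former is the latter for \<open>\<alpha>\<close> the counit
(\<open>comparison_natural\<close>).

Finally, \<open>\<phi> \<mapsto> {a. \<not> \<phi> (a\<^sup>*)}\<close> is a natural bijection from the morphisms \<open>A \<rightarrow> 2\<close> to the clusters
of \<open>A\<close>. It is continuous because the sets \<open>{\<phi>. \<phi> a}\<close> are open in the comparison space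
(\<open>openin_comparison_space\<close>), and clusters are separated by interpolation
(\<open>clusters_separated\<close>). A continuous bijection from a compact space to a Hausdorff space is a
homeomorphism, and compactness of \<open>Clust(A)\<close> and continuity of \<open>Clust(\<alpha>)\<close> are inherited from
the comparison spaces.\<close>

section \<open>Ultrafilters\<close>

text \<open>The ultrafilter lemma. In the order of the filter type the proper filters below \<open>F\<close> have
  minimal elements by Zorn, since a chain of proper filters has a proper infimum; a minimal proper
  filter \<open>m\<close> decides each predicate \<open>P\<close>, because \<open>m\<close> restricted to \<open>P\<close> is either improper or \<open>m\<close>
  again.\<close>

lemma ultrafilter_below:
  assumes "F \<noteq> bot" "F \<le> principal X"
  obtains G where "G \<in> ultrafilters X" "G \<le> F"
proof -
  let ?A = "{G. G \<noteq> bot \<and> G \<le> F}"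
  let ?P = "\<lambda>G H :: 'a filter. H \<le> G"
  have "\<exists>m \<in> ?A. \<forall>G \<in> ?A. ?P m G \<longrightarrow> G = m"
  proof (rule predicate_Zorn)
    show "partial_order_on ?A (relation_of ?P ?A)"
      by (rule partial_order_on_relation_ofI) auto
  next
    fix C assume C: "C \<in> Chains (relation_of ?P ?A)"
    show "\<exists>u \<in> ?A. \<forall>a \<in> C. ?P a u"
    proof (cases "C = {}")
      case True
      then show ?thesis
        using assms(1) by blast
    next
      case False
      have CA: "C \<subseteq> ?A" and lin: "\<And>G H. G \<in> C \<Longrightarrow> H \<in> C \<Longrightarrow> G \<le> H \<or> H \<le> G"
        using C by (auto simp: Chains_def relation_of_def)
      have "eventually Q (Inf C) \<longleftrightarrow> (\<exists>G \<in> C. eventually Q G)" for Q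
        by (rule eventually_Inf_base[OF False]) (metis lin inf.absorb1 inf.absorb2 order_refl)
      then have "Inf C \<noteq> bot"
        using CA by (auto simp: trivial_limit_def)
      moreover have "Inf C \<le> F"
        using False CA by (blast intro: Inf_lower2)
      ultimately show ?thesis
        by (blast intro: Inf_lower)
    qed
  qed
  then obtain m where m: "m \<noteq> bot" "m \<le> F" and min: "\<And>G. G \<noteq> bot \<Longrightarrow> G \<le> m \<Longrightarrow> G = m"
    by (auto dest: order_trans)
  have "eventually P m \<or> eventually (\<lambda>x. \<not> P x) m" for P
  proof (cases "inf m (principal {x. P x}) = bot")
    case True
    then show ?thesis
      by (auto simp: trivial_limit_def eventually_inf_principal)
  next
    case False
    then have "inf m (principal {x. P x}) = m"
      by (rule min) simp
    moreover have "eventually P (inf m (principal {x. P x}))"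
      by (simp add: eventually_inf_principal)
    ultimately show ?thesis
      by simp
  qed
  then have "m \<in> ultrafilters X"
    using m assms(2) by (auto simp: ultrafilters_def)
  then show thesis
    using m(2) that by blast
qed

lemma ultrafilterD:
  assumes "F \<in> ultrafilters X"
  shows "F \<noteq> bot" "F \<le> principal X" "eventually (\<lambda>x. x \<in> X) F"
  using assms by (auto simp: ultrafilters_def le_principal)

lemma ultrafilter_not:
  assumes "F \<in> ultrafilters X"
  shows "eventually (\<lambda>x. \<not> P x) F \<longleftrightarrow> \<not> eventually P F"
proof
  assume n: "eventually (\<lambda>x. \<not> P x) F"
  show "\<not> eventually P F"
  proof
    assume "eventually P F"
    with n have "eventually (\<lambda>x. False) F"
      by eventually_elim simp
    then show False
      using ultrafilterD(1)[OF assms] by (simp add: trivial_limit_def)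
  qed
qed (use assms in \<open>auto simp: ultrafilters_def\<close>)

lemma ultrafilter_minimal:
  assumes "F \<in> ultrafilters X" "G \<noteq> bot" "G \<le> F"
  shows "G = F"
proof (rule antisym[OF assms(3)], rule filter_leI)
  fix P assume P: "eventually P G"
  show "eventually P F"
  proof (rule ccontr)
    assume "\<not> eventually P F"
    then have "eventually (\<lambda>x. \<not> P x) G"
      using assms(1,3) by (simp add: ultrafilter_not[symmetric] filter_leD)
    with P have "eventually (\<lambda>x. False) G"
      by eventually_elim simp
    then show False
      using assms(2) by (simp add: trivial_limit_def)
  qed
qed

lemma ultrafilter_principal:
  "x \<in> X \<Longrightarrow> principal {x} \<in> ultrafilters X"
  by (auto simp: ultrafilters_def eventually_principal principal_eq_bot_iff)

lemma ultrafilter_filtermap: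
  assumes "F \<in> ultrafilters X" "f \<in> X \<rightarrow> Y"
  shows "filtermap f F \<in> ultrafilters Y"
proof -
  have "eventually (\<lambda>x. f x \<in> Y) F"
    using ultrafilterD(3)[OF assms(1)] by eventually_elim (use assms(2) in auto)
  then show ?thesis
    using assms(1) by (auto simp: ultrafilters_def filtermap_bot_iff eventually_filtermap le_principal)
qed

text \<open>Negation can be pulled out of both layers of eventual truth, as \<open>\<F>\<close> itself and \<open>\<F>\<close>-almost
  all of its members are ultrafilters.\<close>

lemma ultrafilter_join:
  assumes "\<F> \<in> ultrafilters (ultrafilters X)"
  shows "filter_join \<F> \<in> ultrafilters X"
proof -
  note ev = ultrafilterD(3)[OF assms]
  have neg: "eventually (\<lambda>F. eventually (\<lambda>x. \<not> P x) F) \<F> \<longleftrightarrow> \<not> eventually (\<lambda>F. eventually P F) \<F>" for P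
    unfolding ultrafilter_not[OF assms, symmetric]
    by (rule eventually_cong[OF ev]) (rule ultrafilter_not)
  show ?thesis
    unfolding ultrafilters_def mem_Collect_eq le_principal eventually_filter_join trivial_limit_def
  proof (intro conjI allI)
    show "\<not> eventually (\<lambda>F. eventually (\<lambda>x. False) F) \<F>"
      using neg[of "\<lambda>x. True"] by simp
    show "eventually (\<lambda>F. eventually (\<lambda>x. x \<in> X) F) \<F>"
      using ev by eventually_elim (rule ultrafilterD)
    show "eventually (eventually P) \<F> \<or> eventually (eventually (\<lambda>x. \<not> P x)) \<F>" for P
      using neg by blast
  qed
qed

lemma filtermap_cong_ultrafilter:
  assumes "F \<in> ultrafilters X" "\<And>x. x \<in> X \<Longrightarrow> f x = g x"
  shows "filtermap f F = filtermap g F"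
  unfolding filter_eq_iff eventually_filtermap
  by (intro allI eventually_cong[OF ultrafilterD(3)[OF assms(1)]]) (simp add: assms(2))

section \<open>Ultrafilters and topology\<close>

lemma limitin_nhdsin:
  "limitin T (\<lambda>y. y) x F \<longleftrightarrow> x \<in> topspace T \<and> F \<le> nhdsin T x"
proof
  assume lim: "limitin T (\<lambda>y. y) x F"
  have "eventually P F" if ev: "eventually P (nhdsin T x)" for P
  proof -
    obtain S where S: "openin T S" "x \<in> S" "\<forall>y \<in> S. P y"
      using ev lim by (auto simp: eventually_nhdsin limitin_def)
    have "eventually (\<lambda>y. y \<in> S) F"
      using lim S(1,2) by (auto simp: limitin_def)
    then show ?thesis
      by (rule eventually_mono) (use S(3) in blast)
  qed
  then show "x \<in> topspace T \<and> F \<le> nhdsin T x"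
    using lim by (auto simp: limitin_def intro: filter_leI)
next
  assume x: "x \<in> topspace T \<and> F \<le> nhdsin T x"
  show "limitin T (\<lambda>y. y) x F"
    unfolding limitin_def
  proof (intro conjI allI impI)
    fix U assume "openin T U \<and> x \<in> U"
    then have "eventually (\<lambda>y. y \<in> U) (nhdsin T x)"
      by (auto simp: eventually_nhdsin)
    then show "eventually (\<lambda>y. y \<in> U) F"
      using x by (blast intro: filter_leD)
  qed (use x in simp)
qed

text \<open>Tests of openness and of separation need ultrafilters with a prescribed limit; they are
  found below the neighbourhood filter.\<close>

lemma nhdsin_meets_ultrafilter:
  assumes "x \<in> topspace T" "inf (nhdsin T x) F \<noteq> bot"
  obtains G where "G \<in> ultrafilters (topspace T)" "limitin T (\<lambda>y. y) x G" "G \<le> F"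
proof -
  have "nhdsin T x \<le> principal (topspace T)"
    using assms(1) by (auto simp: le_principal eventually_nhdsin intro: exI[of _ "topspace T"])
  then have "inf (nhdsin T x) F \<le> principal (topspace T)"
    by (rule le_infI1)
  with assms obtain G where "G \<in> ultrafilters (topspace T)" "G \<le> inf (nhdsin T x) F"
    by (blast elim: ultrafilter_below)
  then show thesis
    using that assms(1) by (simp add: limitin_nhdsin)
qed

text \<open>A topology is determined by its convergent ultrafilters: if no neighbourhood of
  \<open>x \<in> U\<close> lies inside \<open>U\<close>, then some ultrafilter avoids \<open>U\<close> and converges to \<open>x\<close>.\<close>

lemma openin_iff_ultrafilters:
  "openin T U \<longleftrightarrow> U \<subseteq> topspace T \<and>
    (\<forall>F \<in> ultrafilters (topspace T). \<forall>x \<in> U. limitin T (\<lambda>y. y) x F \<longrightarrow> eventually (\<lambda>y. y \<in> U) F)"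
  (is "_ \<longleftrightarrow> ?R")
proof
  assume "openin T U" then show ?R
    by (auto simp: limitin_def openin_subset)
next
  assume R: ?R
  have "\<exists>S. openin T S \<and> x \<in> S \<and> S \<subseteq> U" if x: "x \<in> U" for x
  proof (rule ccontr)
    assume no: "\<nexists>S. openin T S \<and> x \<in> S \<and> S \<subseteq> U"
    have xT: "x \<in> topspace T"
      using x R by blast
    have "inf (nhdsin T x) (principal (- U)) \<noteq> bot"
      using no xT by (auto simp: trivial_limit_def eventually_inf_principal eventually_nhdsin)
    then obtain G where G: "G \<in> ultrafilters (topspace T)" "limitin T (\<lambda>y. y) x G" "G \<le> principal (- U)"
      using xT by (blast elim: nhdsin_meets_ultrafilter)
    then have "eventually (\<lambda>y. y \<in> U) G"
      using R x by blast
    moreover have "eventually (\<lambda>y. \<not> y \<in> U) G"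
      using G(3) by (simp add: le_principal)
    ultimately show False
      using ultrafilter_not[OF G(1)] by blast
  qed
  then show "openin T U"
    by (subst openin_subopen) blast
qed

text \<open>If \<open>F\<close> has no limit, the open sets outside \<open>F\<close> cover the space, but finitely many sets
  outside an ultrafilter cannot. Conversely a family of closed sets with the finite intersection
  property generates a proper filter, and a limit of an ultrafilter below it lies in all of them.\<close>

lemma compact_space_ultrafilters:
  "compact_space T \<longleftrightarrow> (\<forall>F \<in> ultrafilters (topspace T). \<exists>x. limitin T (\<lambda>y. y) x F)"
proof
  assume T: "compact_space T"
  show "\<forall>F \<in> ultrafilters (topspace T). \<exists>x. limitin T (\<lambda>y. y) x F"
  proof (intro ballI, rule ccontr)
    fix F assume F: "F \<in> ultrafilters (topspace T)" and no: "\<nexists>x. limitin T (\<lambda>y. y) x F"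
    let ?U = "{U. openin T U \<and> \<not> eventually (\<lambda>y. y \<in> U) F}"
    have "topspace T \<subseteq> \<Union>?U"
      using no by (auto simp: limitin_def)
    moreover have "\<forall>U \<in> ?U. openin T U"
      by simp
    ultimately obtain \<V> where V: "finite \<V>" "\<V> \<subseteq> ?U" "topspace T \<subseteq> \<Union>\<V>"
      using T by (meson compact_space_alt)
    have "eventually (\<lambda>y. \<forall>U \<in> \<V>. \<not> y \<in> U) F"
      using V(2) by (intro eventually_ball_finite[OF V(1)]) (auto simp: ultrafilter_not[OF F])
    then have "eventually (\<lambda>y. False) F"
      using ultrafilterD(3)[OF F] by eventually_elim (use V(3) in blast)
    then show False
      using ultrafilterD(1)[OF F] by (simp add: trivial_limit_def)
  qed
next
  assume conv: "\<forall>F \<in> ultrafilters (topspace T). \<exists>x. limitin T (\<lambda>y. y) x F"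
  show "compact_space T"
    unfolding compact_space_fip
  proof (intro allI impI)
    fix \<C> assume C: "(\<forall>C \<in> \<C>. closedin T C) \<and> (\<forall>\<F>. finite \<F> \<and> \<F> \<subseteq> \<C> \<longrightarrow> \<Inter>\<F> \<noteq> {})"
    show "\<Inter>\<C> \<noteq> {}"
    proof (cases "\<C> = {}")
      case False
      let ?F = "INF C \<in> \<C>. principal C"
      have nb: "?F \<noteq> bot"
      proof (rule INF_filter_not_bot)
        fix \<D> assume "\<D> \<subseteq> \<C>" "finite \<D>"
        then show "(INF C \<in> \<D>. principal C) \<noteq> bot"
          using C by (simp add: INF_principal_finite principal_eq_bot_iff)
      qed
      have "?F \<le> principal (topspace T)"
        using False C by (meson INF_lower2 all_not_in_conv closedin_subset principal_le_iff)
      with nb obtain G where G: "G \<in> ultrafilters (topspace T)" "G \<le> ?F"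
        by (rule ultrafilter_below)
      obtain x where x: "limitin T (\<lambda>y. y) x G"
        using conv G(1) by blast
      have "x \<in> C" if "C \<in> \<C>" for C
      proof (rule ccontr)
        assume "x \<notin> C"
        then have "openin T (topspace T - C)" "x \<in> topspace T - C"
          using C that x by (auto simp: limitin_def)
        then have "eventually (\<lambda>y. y \<in> topspace T - C) G"
          using x by (auto simp: limitin_def)
        then have "eventually (\<lambda>y. \<not> y \<in> C) G"
          by (rule eventually_mono) simp
        moreover have "eventually (\<lambda>y. y \<in> C) G"
          using G(2) that by (auto simp: le_INF_iff le_principal)
        ultimately show False
          using ultrafilter_not[OF G(1)] by blast
      qed
      then show ?thesis by blast
    qed simp
  qed
qed

text \<open>Two points without disjoint neighbourhoods are limits of a common ultrafilter.\<close>

lemma Hausdorff_space_ultrafilters: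
  assumes "\<And>F x y. F \<in> ultrafilters (topspace T) \<Longrightarrow> limitin T (\<lambda>y. y) x F \<Longrightarrow>
    limitin T (\<lambda>y. y) y F \<Longrightarrow> x = y"
  shows "Hausdorff_space T"
  unfolding Hausdorff_space_def
proof (intro allI impI, rule ccontr)
  fix x y assume xy: "x \<in> topspace T \<and> y \<in> topspace T \<and> x \<noteq> y"
    and no: "\<nexists>U V. openin T U \<and> openin T V \<and> x \<in> U \<and> y \<in> V \<and> disjnt U V"
  have "inf (nhdsin T x) (nhdsin T y) \<noteq> bot"
  proof
    assume "inf (nhdsin T x) (nhdsin T y) = bot"
    then obtain P Q where "eventually P (nhdsin T x)" "eventually Q (nhdsin T y)"
      and PQ: "\<forall>z. P z \<and> Q z \<longrightarrow> False"
      unfolding trivial_limit_def eventually_inf by blast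
    then obtain U V where UV: "openin T U" "x \<in> U" "openin T V" "y \<in> V"
      and "\<forall>z \<in> U. P z" "\<forall>z \<in> V. Q z"
      using xy unfolding eventually_nhdsin by blast
    with PQ have "disjnt U V"
      by (auto simp: disjnt_iff)
    with UV no show False
      by blast
  qed
  then obtain G where "G \<in> ultrafilters (topspace T)" "limitin T (\<lambda>y. y) x G" "G \<le> nhdsin T y"
    using xy by (blast elim: nhdsin_meets_ultrafilter)
  then show False
    using assms[of G x y] xy by (simp add: limitin_nhdsin)
qed

section \<open>Algebras of the ultrafilter monad are compact Hausdorff spaces\<close>

text \<open>The algebra axioms with the restrictions to the carriers removed: unit and multiplication
  are principal filters and joins, and the functorial action is the image filter.\<close>

lemma ultra_algs_iff:
  "(X, \<xi>) \<in> ultra_algs \<longleftrightarrow> \<xi> \<in> ultrafilters X \<rightarrow>\<^sub>E X \<and> (\<forall>x \<in> X. \<xi> (principal {x}) = x) \<and>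
    (\<forall>\<F> \<in> ultrafilters (ultrafilters X). \<xi> (filter_join \<F>) = \<xi> (filtermap \<xi> \<F>))"
  by (auto simp: ultra_algs_def ultra_unit_def ultra_mult_def ultra_map_def)

text \<open>This is where the associativity law of an algebra enters. The sets of
  ultrafilters \<open>G\<close> in the hypothesis form a filter base; an ultrafilter \<open>\<G>\<close> of ultrafilters
  refining it has join below \<open>F\<close> and image \<open>H\<close> under \<open>\<xi>\<close>, so the limit of its join is the limit
  of \<open>H\<close>.\<close>

lemma ultra_alg_transport:
  assumes P: "(X, \<xi>) \<in> ultra_algs" and H: "H \<in> ultrafilters X"
    and FH: "\<And>A B. eventually A F \<Longrightarrow> eventually B H \<Longrightarrow>
      \<exists>G \<in> ultrafilters X. eventually A G \<and> B (\<xi> G)"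
  obtains G where "G \<in> ultrafilters X" "G \<le> F" "\<xi> G = \<xi> H"
proof -
  have \<xi>: "\<xi> \<in> ultrafilters X \<rightarrow> X"
    and mult: "\<And>\<F>. \<F> \<in> ultrafilters (ultrafilters X) \<Longrightarrow> \<xi> (filter_join \<F>) = \<xi> (filtermap \<xi> \<F>)"
    using P by (auto simp: ultra_algs_iff)
  let ?I = "{(A, B). eventually A F \<and> eventually B H}"
  let ?S = "\<lambda>(A, B). {G \<in> ultrafilters X. eventually A G \<and> B (\<xi> G)}"
  let ?\<G> = "INF i \<in> ?I. principal (?S i)"
  have ev: "eventually Q ?\<G> \<longleftrightarrow> (\<exists>i \<in> ?I. eventually Q (principal (?S i)))" for Q
  proof (rule eventually_INF_base)
    show "?I \<noteq> {}"
      using eventually_True by blast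
    fix i j assume "i \<in> ?I" "j \<in> ?I"
    then obtain A B C D where ij: "i = (A, B)" "j = (C, D)"
      and "eventually A F" "eventually B H" "eventually C F" "eventually D H"
      by blast
    then have "(\<lambda>x. A x \<and> C x, \<lambda>x. B x \<and> D x) \<in> ?I"
      by (simp add: eventually_conj)
    then show "\<exists>k \<in> ?I. principal (?S k) \<le> inf (principal (?S i)) (principal (?S j))"
      by (rule rev_bexI) (auto simp: ij eventually_conj_iff)
  qed
  have "?\<G> \<noteq> bot"
    unfolding trivial_limit_def ev using FH by (auto simp: eventually_principal)
  moreover have "?\<G> \<le> principal (ultrafilters X)"
    unfolding le_principal ev
    by (rule bexI[of _ "(\<lambda>x. True, \<lambda>x. True)"]) (auto simp: eventually_principal)
  ultimately obtain \<G> where \<G>: "\<G> \<in> ultrafilters (ultrafilters X)" "\<G> \<le> ?\<G>"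
    by (rule ultrafilter_below)
  have evG: "eventually Q \<G>" if "eventually A F" "eventually B H"
    "\<And>G. G \<in> ultrafilters X \<Longrightarrow> eventually A G \<Longrightarrow> B (\<xi> G) \<Longrightarrow> Q G" for A B Q
    by (rule filter_leD[OF \<G>(2)], unfold ev, rule bexI[of _ "(A, B)"])
      (use that in \<open>auto simp: eventually_principal\<close>)
  have "filter_join \<G> \<le> F"
    by (rule filter_leI, unfold eventually_filter_join, rule evG[of _ "\<lambda>x. True"]) simp_all
  moreover have "filtermap \<xi> \<G> \<le> H"
    by (rule filter_leI, unfold eventually_filtermap, rule evG[of "\<lambda>x. True"]) simp_all
  then have "filtermap \<xi> \<G> = H"
    using ultrafilter_minimal[OF H] ultrafilterD(1)[OF \<G>(1)] by (simp add: filtermap_bot_iff)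
  then have "\<xi> (filter_join \<G>) = \<xi> H"
    using mult[OF \<G>(1)] by simp
  ultimately show thesis
    using that ultrafilter_join[OF \<G>(1)] by blast
qed

lemma topspace_manes_space:
  assumes "P \<in> ultra_algs" shows "topspace (manes_space P) = fst P"
proof
  show "topspace (manes_space P) \<subseteq> fst P"
    using openin_manes_space[of P "topspace (manes_space P)"] by simp
  have "openin (manes_space P) (fst P)"
    by (auto simp: openin_manes_space ultrafilterD(3))
  then show "fst P \<subseteq> topspace (manes_space P)"
    by (rule openin_subset)
qed

text \<open>That \<open>F\<close> converges to \<open>\<xi> F\<close> holds by definition of the topology. For uniqueness let \<open>F\<close>
  converge to \<open>x\<close>. The limits of the ultrafilters that contain a fixed set \<open>A\<close> form a closed set,
  so if \<open>A\<close> belongs to \<open>F\<close> then \<open>x\<close> is such a limit. Hence the transport lemma applies to \<open>F\<close> and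
  the principal ultrafilter at \<open>x\<close>, and gives an ultrafilter below \<open>F\<close>, which can only be \<open>F\<close>,
  with limit \<open>x\<close>.\<close>

lemma limitin_manes_space:
  assumes P: "P \<in> ultra_algs" and F: "F \<in> ultrafilters (fst P)"
  shows "limitin (manes_space P) (\<lambda>y. y) x F \<longleftrightarrow> x = snd P F"
proof -
  obtain X \<xi> where XP: "P = (X, \<xi>)"
    by (cases P)
  have Px: "(X, \<xi>) \<in> ultra_algs" and Fx: "F \<in> ultrafilters X"
    using P F by (auto simp: XP)
  have \<xi>: "\<xi> \<in> ultrafilters X \<rightarrow> X" and unit: "\<And>x. x \<in> X \<Longrightarrow> \<xi> (principal {x}) = x"
    using Px by (auto simp: ultra_algs_iff)
  note top = topspace_manes_space[OF P, unfolded XP fst_conv]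
  have "x = \<xi> F" if lim: "limitin (manes_space (X, \<xi>)) (\<lambda>y. y) x F"
  proof -
    have x: "x \<in> X"
      using lim by (auto simp: limitin_def top)
    have cl: "\<exists>G \<in> ultrafilters X. eventually A G \<and> \<xi> G = x" if A: "eventually A F" for A
    proof (rule ccontr)
      assume no: "\<not> (\<exists>G \<in> ultrafilters X. eventually A G \<and> \<xi> G = x)"
      \<comment> \<open>The closure of \<open>A\<close>; the transport lemma with \<open>F\<close> principal shows that it is closed.\<close>
      let ?C = "{y. \<exists>G \<in> ultrafilters X. eventually A G \<and> \<xi> G = y}"
      have "openin (manes_space (X, \<xi>)) (X - ?C)"
        unfolding openin_manes_space fst_conv snd_conv
      proof (intro conjI ballI impI, blast)
        fix H assume H: "H \<in> ultrafilters X" and HC: "\<xi> H \<in> X - ?C"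
        show "eventually (\<lambda>x. x \<in> X - ?C) H"
        proof (rule ccontr)
          assume "\<not> eventually (\<lambda>x. x \<in> X - ?C) H"
          then have "eventually (\<lambda>x. \<not> x \<in> X - ?C) H"
            by (rule ultrafilter_not[OF H, THEN iffD2])
          then have HC': "eventually (\<lambda>x. x \<in> ?C) H"
            using ultrafilterD(3)[OF H] by eventually_elim blast
          obtain G where G: "G \<in> ultrafilters X" "G \<le> principal {x. A x}" "\<xi> G = \<xi> H"
          proof (rule ultra_alg_transport[OF Px H])
            fix A' B assume A': "eventually A' (principal {x. A x})" and B: "eventually B H"
            have "eventually (\<lambda>x. x \<in> ?C \<and> B x) H"
              using HC' B by (rule eventually_conj)
            then obtain y where "y \<in> ?C" "B y"
              using ultrafilterD(1)[OF H] eventually_happens by blast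
            then obtain G where "G \<in> ultrafilters X" "eventually A G" "B (\<xi> G)"
              by blast
            moreover have "eventually A' G"
              using \<open>eventually A G\<close> by (rule eventually_mono) (use A' in \<open>simp add: eventually_principal\<close>)
            ultimately show "\<exists>G \<in> ultrafilters X. eventually A' G \<and> B (\<xi> G)"
              by blast
          qed
          then show False
            using HC by (auto simp: le_principal)
        qed
      qed
      then have "eventually (\<lambda>y. y \<in> X - ?C) F"
        using lim no x by (auto simp: limitin_def)
      then have "eventually (\<lambda>y. \<not> A y) F"
      proof (rule eventually_mono)
        fix y assume y: "y \<in> X - ?C"
        then show "\<not> A y"
          using unit[of y] ultrafilter_principal[of y X] by (auto simp: eventually_principal)
      qed
      then show False
        using A ultrafilter_not[OF Fx] by blast
    qed
    obtain G where G: "G \<in> ultrafilters X" "G \<le> F" "\<xi> G = \<xi> (principal {x})"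
    proof (rule ultra_alg_transport[OF Px ultrafilter_principal[OF x]])
      fix A B assume A: "eventually A F" and B: "eventually B (principal {x})"
      obtain G where "G \<in> ultrafilters X" "eventually A G" "\<xi> G = x"
        using cl[OF A] by blast
      then show "\<exists>G \<in> ultrafilters X. eventually A G \<and> B (\<xi> G)"
        using B by (auto simp: eventually_principal)
    qed
    then have "G = F"
      using ultrafilter_minimal[OF Fx] ultrafilterD(1) by blast
    then show ?thesis
      using G(3) unit[OF x] by simp
  qed
  moreover have "limitin (manes_space (X, \<xi>)) (\<lambda>y. y) (\<xi> F) F"
    using \<xi> Fx by (auto simp: limitin_def top openin_manes_space)
  ultimately show ?thesis
    by (auto simp: XP)
qed

lemma khaus_manes_space:
  assumes P: "P \<in> ultra_algs" shows "khaus (manes_space P)"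
  unfolding khaus_def
proof
  show "compact_space (manes_space P)"
    unfolding compact_space_ultrafilters using P
    by (auto simp: topspace_manes_space limitin_manes_space)
  show "Hausdorff_space (manes_space P)"
    by (rule Hausdorff_space_ultrafilters) (simp add: P topspace_manes_space limitin_manes_space)
qed

text \<open>The inverse of Manes' construction: the structure map of a compact Hausdorff space sends an
  ultrafilter to its limit.\<close>

definition ultra_limit :: "'x topology \<Rightarrow> 'x filter \<Rightarrow> 'x" where
  "ultra_limit T = (\<lambda>F \<in> ultrafilters (topspace T). THE x. limitin T (\<lambda>y. y) x F)"

lemma ultra_limit_eq:
  assumes "khaus T" "F \<in> ultrafilters (topspace T)"
  shows "limitin T (\<lambda>y. y) x F \<longleftrightarrow> x = ultra_limit T F"
proof -
  obtain z where z: "limitin T (\<lambda>y. y) z F"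
    using assms by (auto simp: khaus_def compact_space_ultrafilters)
  have un: "y = z" if "limitin T (\<lambda>y. y) y F" for y
    using limitin_Hausdorff_unique[OF that z] ultrafilterD(1)[OF assms(2)] assms(1)
    by (auto simp: khaus_def)
  have "ultra_limit T F = z"
    unfolding ultra_limit_def restrict_apply if_P[OF assms(2)]
    by (rule the_equality) (fact z, fact un)
  then show ?thesis
    using z un by blast
qed

text \<open>For associativity let \<open>y\<close> be the limit of the image of \<open>\<F>\<close>. An open \<open>U\<close> around \<open>y\<close>
  contains the limit of \<open>\<F>\<close>-almost every \<open>G\<close>, hence is a member of \<open>\<F>\<close>-almost every \<open>G\<close>; so
  the join of \<open>\<F>\<close> converges to \<open>y\<close> too.\<close>

lemma ultra_limit_alg:
  assumes T: "khaus T"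
  shows "(topspace T, ultra_limit T) \<in> ultra_algs"
  unfolding ultra_algs_iff
proof (intro conjI ballI)
  let ?X = "topspace T"
  have lim: "limitin T (\<lambda>y. y) (ultra_limit T F) F" if "F \<in> ultrafilters ?X" for F
    using ultra_limit_eq[OF T that] by blast
  then show fs: "ultra_limit T \<in> ultrafilters ?X \<rightarrow>\<^sub>E ?X"
    by (auto simp: limitin_def) (simp add: ultra_limit_def)
  show "ultra_limit T (principal {x}) = x" if "x \<in> ?X" for x
    using ultra_limit_eq[OF T ultrafilter_principal[OF that], of x] that
    by (auto simp: limitin_def eventually_principal)
  fix \<F> assume F: "\<F> \<in> ultrafilters (ultrafilters ?X)"
  then have mF: "filtermap (ultra_limit T) \<F> \<in> ultrafilters ?X"
    using fs by (intro ultrafilter_filtermap) auto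
  let ?y = "ultra_limit T (filtermap (ultra_limit T) \<F>)"
  have "limitin T (\<lambda>y. y) ?y (filter_join \<F>)"
    unfolding limitin_def eventually_filter_join
  proof (intro conjI allI impI)
    show "?y \<in> ?X"
      using fs mF by auto
    fix U assume U: "openin T U \<and> ?y \<in> U"
    then have "eventually (\<lambda>G. ultra_limit T G \<in> U) \<F>"
      using lim[OF mF] by (auto simp: limitin_def eventually_filtermap)
    then show "eventually (\<lambda>G. eventually (\<lambda>x. x \<in> U) G) \<F>"
      using ultrafilterD(3)[OF F]
      by eventually_elim (use lim U in \<open>auto simp: limitin_def\<close>)
  qed
  then show "ultra_limit T (filter_join \<F>) = ?y"
    using ultra_limit_eq[OF T ultrafilter_join[OF F]] by simp
qed

lemma manes_space_ultra_limit:
  assumes T: "khaus T"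
  shows "manes_space (topspace T, ultra_limit T) = T"
  unfolding topology_eq
proof
  fix S
  have "(\<forall>x \<in> S. limitin T (\<lambda>y. y) x F \<longrightarrow> eventually (\<lambda>y. y \<in> S) F) \<longleftrightarrow>
      (ultra_limit T F \<in> S \<longrightarrow> eventually (\<lambda>y. y \<in> S) F)"
    if "F \<in> ultrafilters (topspace T)" for F
    unfolding ultra_limit_eq[OF T that] by blast
  then show "openin (manes_space (topspace T, ultra_limit T)) S = openin T S"
    unfolding openin_manes_space fst_conv snd_conv openin_iff_ultrafilters[of T S] by blast
qed

lemma bij_betw_manes_space:
  "bij_betw manes_space (ultra_algs :: ('x set \<times> _) set) {T. khaus T}"
proof (rule bij_betw_byWitness[where f' = "\<lambda>T. (topspace T, ultra_limit T)"])
  show "\<forall>P \<in> (ultra_algs :: ('x set \<times> _) set). (topspace (manes_space P), ultra_limit (manes_space P)) = P"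
  proof
    fix P :: "'x set \<times> ('x filter \<Rightarrow> 'x)" assume P: "P \<in> ultra_algs"
    obtain X \<xi> where XP: "P = (X, \<xi>)"
      by (cases P)
    have "ultra_limit (manes_space P) F = \<xi> F" for F
    proof (cases "F \<in> ultrafilters X")
      case True
      then show ?thesis
        using ultra_limit_eq[OF khaus_manes_space[OF P], of F] limitin_manes_space[OF P, of F]
        using topspace_manes_space[OF P] by (simp add: XP)
    next
      case False
      then show ?thesis
        using P topspace_manes_space[OF P]
        by (auto simp: ultra_limit_def XP ultra_algs_iff PiE_iff extensional_def)
    qed
    then show "(topspace (manes_space P), ultra_limit (manes_space P)) = P"
      using topspace_manes_space[OF P] by (auto simp: XP)
  qed
qed (auto simp: khaus_manes_space ultra_limit_alg manes_space_ultra_limit)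

text \<open>Both kinds of morphism preserve limits of ultrafilters; preimages of open sets are open
  because openness is tested on the ultrafilters themselves.\<close>

lemma khaus_hom_manes_space:
  assumes P: "P \<in> ultra_algs" and Q: "Q \<in> ultra_algs"
  shows "khaus_hom (manes_space P) (manes_space Q) = ultra_hom P Q"
proof -
  note top = topspace_manes_space[OF P] topspace_manes_space[OF Q]
  have "continuous_map (manes_space P) (manes_space Q) f \<longleftrightarrow>
      (\<forall>F \<in> ultrafilters (fst P). f (snd P F) = snd Q (ultra_map (fst P) f F))"
    (is "?C \<longleftrightarrow> ?H") if f: "f \<in> fst P \<rightarrow>\<^sub>E fst Q" for f
  proof
    assume C: ?C
    show ?H
    proof
      fix F assume F: "F \<in> ultrafilters (fst P)"
      have "limitin (manes_space P) (\<lambda>y. y) (snd P F) F"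
        using limitin_manes_space[OF P F] by simp
      then have "limitin (manes_space Q) (f \<circ> (\<lambda>y. y)) (f (snd P F)) F"
        by (rule continuous_map_limit[OF C])
      then have "limitin (manes_space Q) (\<lambda>y. y) (f (snd P F)) (filtermap f F)"
        by (simp add: limitin_def eventually_filtermap)
      moreover have "filtermap f F \<in> ultrafilters (fst Q)"
        using f F by (intro ultrafilter_filtermap) auto
      ultimately show "f (snd P F) = snd Q (ultra_map (fst P) f F)"
        using limitin_manes_space[OF Q] F by (simp add: ultra_map_def)
    qed
  next
    assume H: ?H
    show ?C
      unfolding continuous_map top
    proof (intro conjI allI impI)
      show "f ` fst P \<subseteq> fst Q"
        using f by auto
      fix U assume U: "openin (manes_space Q) U"
      show "openin (manes_space P) {x \<in> fst P. f x \<in> U}"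
        unfolding openin_manes_space
      proof (intro conjI ballI impI)
        fix F assume F: "F \<in> ultrafilters (fst P)" and "snd P F \<in> {x \<in> fst P. f x \<in> U}"
        then have "snd Q (filtermap f F) \<in> U"
          using H F by (auto simp: ultra_map_def)
        moreover have "filtermap f F \<in> ultrafilters (fst Q)"
          using f F by (intro ultrafilter_filtermap) auto
        ultimately have "eventually (\<lambda>x. f x \<in> U) F"
          using U by (auto simp: openin_manes_space eventually_filtermap)
        with ultrafilterD(3)[OF F] show "eventually (\<lambda>x. x \<in> {x \<in> fst P. f x \<in> U}) F"
          by eventually_elim simp
      qed blast
    qed
  qed
  then show ?thesis
    by (auto simp: khaus_hom_def ultra_hom_def top)
qed

section \<open>Boolean algebras\<close>

context boolean_lattice
begin

text \<open>The complement is given by a definite description, so uniqueness is needed before any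
  other property of it.\<close>

lemma complement_unique:
  assumes [simp]: "a \<in> carrier L" "b \<in> carrier L" "c \<in> carrier L"
    and ab: "a \<sqinter> b = \<bottom>" "a \<squnion> b = \<top>" and ac: "a \<sqinter> c = \<bottom>" "a \<squnion> c = \<top>"
  shows "b = c"
proof -
  have *: "x \<sqsubseteq> y" if [simp]: "x \<in> carrier L" "y \<in> carrier L" and "a \<sqinter> x = \<bottom>" "a \<squnion> y = \<top>" for x y
  proof -
    have "x \<sqsubseteq> x \<sqinter> (a \<squnion> y)"
      using that by (intro meet_le) auto
    also have "x \<sqinter> (a \<squnion> y) = (x \<sqinter> a) \<squnion> (x \<sqinter> y)"
      by (rule inf_sup_distrib) auto
    also have "x \<sqinter> a = \<bottom>"
      using that by (simp add: meet_comm[of L x])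
    also have "\<bottom> \<squnion> (x \<sqinter> y) \<sqsubseteq> y"
      by (rule join_le) (auto simp: meet_right)
    finally show ?thesis
      by simp
  qed
  show ?thesis
    by (rule le_antisym) (use * ab ac in auto)
qed

lemma complement_props:
  assumes "a \<in> carrier L"
  shows complement_closed [simp, intro]: "complement L a \<in> carrier L"
    and meet_complement: "a \<sqinter> complement L a = \<bottom>"
    and join_complement: "a \<squnion> complement L a = \<top>"
proof -
  obtain b where b: "b \<in> carrier L" "a \<sqinter> b = \<bottom>" "a \<squnion> b = \<top>"
    using complement_exists[OF assms] by blast
  then have "complement L a = b"
    unfolding complement_def
    by (intro the_equality) (auto intro: complement_unique[OF assms])
  then show "complement L a \<in> carrier L" "a \<sqinter> complement L a = \<bottom>" "a \<squnion> complement L a = \<top>"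
    using b by auto
qed

lemma complement_eqI:
  assumes "a \<in> carrier L" "b \<in> carrier L" "a \<sqinter> b = \<bottom>" "a \<squnion> b = \<top>"
  shows "complement L a = b"
  using complement_unique[OF assms(1) complement_closed assms(2) meet_complement join_complement] assms
  by simp

lemma complement_complement [simp]:
  assumes "a \<in> carrier L" shows "complement L (complement L a) = a"
  using assms complement_props[OF assms]
  by (intro complement_eqI) (auto simp: meet_comm[of L _ a] join_comm[of L _ a])

lemma le_bottom_iff:
  assumes "a \<in> carrier L" shows "a \<sqsubseteq> \<bottom> \<longleftrightarrow> a = \<bottom>"
  using assms by (auto intro: le_antisym)

text \<open>Disjointness as an inequality with the complement; the remaining Boolean laws, De Morgan
  and residuation, follow from it by order reasoning.\<close>

lemma meet_eq_bottom_iff: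
  assumes [simp]: "a \<in> carrier L" "b \<in> carrier L"
  shows "a \<sqinter> b = \<bottom> \<longleftrightarrow> a \<sqsubseteq> complement L b"
proof
  assume ab: "a \<sqinter> b = \<bottom>"
  have "a \<sqsubseteq> a \<sqinter> (b \<squnion> complement L b)"
    by (intro meet_le) (auto simp: join_complement)
  also have "\<dots> = (a \<sqinter> b) \<squnion> (a \<sqinter> complement L b)"
    by (rule inf_sup_distrib) auto
  also have "\<dots> \<sqsubseteq> complement L b"
    by (intro join_le) (auto simp: ab meet_right)
  finally show "a \<sqsubseteq> complement L b"
    by simp
next
  assume "a \<sqsubseteq> complement L b"
  then have "a \<sqinter> b \<sqsubseteq> b \<sqinter> complement L b"
    by (intro meet_le) (auto simp: meet_right intro: le_trans[OF meet_left])
  then show "a \<sqinter> b = \<bottom>"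
    by (simp add: meet_complement le_bottom_iff)
qed

lemma complement_le_iff:
  assumes [simp]: "a \<in> carrier L" "b \<in> carrier L"
  shows "complement L a \<sqsubseteq> complement L b \<longleftrightarrow> b \<sqsubseteq> a"
  using meet_eq_bottom_iff[of "complement L a" b] meet_eq_bottom_iff[of b "complement L a"]
  by (simp add: meet_comm[of L b])

lemma le_iff_meet_complement:
  assumes "a \<in> carrier L" "b \<in> carrier L"
  shows "a \<sqsubseteq> b \<longleftrightarrow> a \<sqinter> complement L b = \<bottom>"
  using assms by (simp add: meet_eq_bottom_iff)

lemma complement_bottom [simp]: "complement L \<bottom> = \<top>"
  by (rule complement_eqI) (auto intro!: le_antisym meet_le simp: meet_left join_right)

lemma complement_top [simp]: "complement L \<top> = \<bottom>"
  using complement_complement[of \<bottom>] by simp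

lemma complement_meet:
  assumes [simp]: "a \<in> carrier L" "b \<in> carrier L"
  shows "complement L (a \<sqinter> b) = complement L a \<squnion> complement L b"
proof (rule le_antisym)
  let ?c = "complement L (complement L a \<squnion> complement L b)"
  have "?c \<sqsubseteq> complement L (complement L a)"
    by (subst complement_le_iff) (auto simp: join_left)
  moreover have "?c \<sqsubseteq> complement L (complement L b)"
    by (subst complement_le_iff) (auto simp: join_right)
  ultimately have "?c \<sqsubseteq> a \<sqinter> b"
    by (intro meet_le) auto
  then have "complement L (a \<sqinter> b) \<sqsubseteq> complement L ?c"
    by (subst complement_le_iff) auto
  then show "complement L (a \<sqinter> b) \<sqsubseteq> complement L a \<squnion> complement L b"
    by simp
  show "complement L a \<squnion> complement L b \<sqsubseteq> complement L (a \<sqinter> b)"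
    by (intro join_le) (auto simp: complement_le_iff meet_left meet_right)
qed auto

lemma complement_join:
  assumes [simp]: "a \<in> carrier L" "b \<in> carrier L"
  shows "complement L (a \<squnion> b) = complement L a \<sqinter> complement L b"
  using complement_complement[of "complement L a \<sqinter> complement L b"]
  by (simp add: complement_meet)

text \<open>Residuation. It replaces the infinite distributive law: a meet with a join of a family
  is bounded by moving the other factor to the right.\<close>

lemma meet_le_iff_le_join:
  assumes [simp]: "a \<in> carrier L" "b \<in> carrier L" "c \<in> carrier L"
  shows "a \<sqinter> b \<sqsubseteq> c \<longleftrightarrow> a \<sqsubseteq> complement L b \<squnion> c"
  by (simp add: le_iff_meet_complement meet_assoc complement_join)

end

section \<open>The strong inclusion of a contact algebra\<close>

context contact_algebra
begin

abbreviation inside (infix "\<lless>" 50) where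
  "a \<lless> b \<equiv> well_inside A a b"

lemma contact_mono:
  assumes [simp]: "a \<in> carrier A" "b \<in> carrier A" "c \<in> carrier A" "d \<in> carrier A"
    and "a \<frown> b" "a \<sqsubseteq> c" "b \<sqsubseteq> d"
  shows "c \<frown> d"
proof -
  have "b \<squnion> d = d" "a \<squnion> c = c"
    using assms by (simp_all add: le_iff_meet[symmetric])
  then have "a \<frown> d" "d \<frown> a \<Longrightarrow> d \<frown> c"
    using contact_sup[of a b d] contact_sup[of d a c] assms(5) by auto
  then show ?thesis
    using contact_sym[of a d] contact_sym[of d c] by simp
qed

lemma meet_contact:
  assumes [simp]: "a \<in> carrier A" "b \<in> carrier A" and "a \<sqinter> b \<noteq> \<bottom>"
  shows "a \<frown> b"
  using assms by (intro contact_mono[OF _ _ _ _ contact_refl]) (auto simp: meet_left meet_right)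

lemma inside_le:
  assumes "a \<in> carrier A" "b \<in> carrier A" "a \<lless> b" shows "a \<sqsubseteq> b"
  using assms meet_contact[of a "complement A b"] by (auto simp: well_inside_def le_iff_meet_complement)

lemma inside_mono:
  assumes "a \<in> carrier A" "b \<in> carrier A" "c \<in> carrier A" "d \<in> carrier A"
    and "a \<sqsubseteq> b" "b \<lless> c" "c \<sqsubseteq> d"
  shows "a \<lless> d"
  using assms contact_mono[of a "complement A d" b "complement A c"]
  by (auto simp: well_inside_def complement_le_iff)

lemma inside_meet:
  assumes "a \<in> carrier A" "b \<in> carrier A" "c \<in> carrier A" "a \<lless> b" "a \<lless> c"
  shows "a \<lless> b \<sqinter> c"
  using assms by (auto simp: well_inside_def complement_meet contact_sup)

text \<open>The form of compatibility with meets that makes lower regularization preserve meets.\<close>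

lemma inside_meet_mono:
  assumes "a \<in> carrier A" "b \<in> carrier A" "c \<in> carrier A" "d \<in> carrier A" "a \<lless> b" "c \<lless> d"
  shows "a \<sqinter> c \<lless> b \<sqinter> d"
  by (rule inside_meet)
    (use assms in \<open>auto intro: inside_mono[of _ a b b] inside_mono[of _ c d d] simp: meet_left meet_right\<close>)

lemma inside_complement:
  assumes "a \<in> carrier A" "b \<in> carrier A" "a \<lless> b"
  shows "complement A b \<lless> complement A a"
  using assms contact_sym[of "complement A b" a] by (auto simp: well_inside_def)

end

context normal_contact_algebra
begin

lemma inside_interpolate:
  assumes "a \<in> carrier A" "b \<in> carrier A" "a \<lless> b"
  obtains c where "c \<in> carrier A" "a \<lless> c" "c \<lless> b"
proof -
  obtain c where c: "c \<in> carrier A" "\<not> a \<frown> c" "\<not> complement A b \<frown> complement A c"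
    using contact_interpolate[of a "complement A b"] assms by (auto simp: well_inside_def)
  then have "a \<lless> complement A c" "complement A c \<lless> b"
    using assms contact_sym[of "complement A c" "complement A b"] by (auto simp: well_inside_def)
  with c(1) show thesis
    using that by blast
qed

end

context de_vries_algebra
begin

text \<open>If the join \<open>s\<close> were below \<open>a\<close> and different from it, then the density axiom would put a
  nonzero \<open>b\<close> strongly inside \<open>a \<sqinter> s\<^sup>*\<close>; but such a \<open>b\<close> is one of the joinands, so it
  is below both \<open>s\<close> and its complement.\<close>

lemma sup_inside:
  assumes [simp]: "a \<in> carrier A"
  shows "\<Squnion>{b \<in> carrier A. b \<lless> a} = a"
proof (rule ccontr)
  let ?s = "\<Squnion>{b \<in> carrier A. b \<lless> a}"
  assume ne: "?s \<noteq> a"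
  have [simp]: "?s \<in> carrier A"
    by (rule sup_closed) auto
  have "?s \<sqsubseteq> a"
    by (rule sup_least) (auto intro: inside_le)
  with ne have "\<not> a \<sqsubseteq> ?s"
    by (auto intro: le_antisym)
  then have "a \<sqinter> complement A ?s \<noteq> \<bottom>"
    by (simp add: le_iff_meet_complement)
  then have "complement A (a \<sqinter> complement A ?s) \<noteq> \<top>"
    by (metis complement_complement complement_top complement_closed meet_closed assms \<open>?s \<in> carrier A\<close>)
  then obtain b where b [simp]: "b \<in> carrier A" and "b \<noteq> \<bottom>" "\<not> b \<frown> complement A (a \<sqinter> complement A ?s)"
    using contact_dense[of "complement A (a \<sqinter> complement A ?s)"] by auto
  then have bi: "b \<lless> a \<sqinter> complement A ?s"
    by (simp add: well_inside_def)
  then have "b \<lless> a"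
    by (rule inside_mono[rotated 5]) (auto simp: meet_left)
  then have "b \<sqsubseteq> ?s"
    by (intro sup_upper) auto
  moreover have "b \<sqsubseteq> complement A ?s"
    using inside_le[OF _ _ bi] by (rule le_trans) (auto simp: meet_right)
  ultimately have "b \<sqsubseteq> ?s \<sqinter> complement A ?s"
    by (intro meet_le) auto
  then show False
    using \<open>b \<noteq> \<bottom>\<close> by (simp add: meet_complement le_bottom_iff)
qed

end

section \<open>The category of de Vries algebras\<close>

text \<open>All conditions on a morphism except approximation from below. They are stable under
  pointwise composition, while approximation in general is not.\<close>

definition dv_prehom ::
  "('a, 'm) contact_alg_scheme \<Rightarrow> ('b, 'n) contact_alg_scheme \<Rightarrow> ('a \<Rightarrow> 'b) set" where
  "dv_prehom A B = {f \<in> carrier A \<rightarrow> carrier B.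
     f \<bottom>\<^bsub>A\<^esub> = \<bottom>\<^bsub>B\<^esub> \<and>
     (\<forall>a \<in> carrier A. \<forall>b \<in> carrier A. f (a \<sqinter>\<^bsub>A\<^esub> b) = f a \<sqinter>\<^bsub>B\<^esub> f b) \<and>
     (\<forall>a \<in> carrier A. \<forall>b \<in> carrier A.
        well_inside A (complement A a) b \<longrightarrow> well_inside B (complement B (f a)) (f b))}"

text \<open>The largest function below a monotone \<open>f\<close> that is approximated from below along strong
  inclusion.\<close>

definition dv_regularize ::
  "('a, 'm) contact_alg_scheme \<Rightarrow> ('b, 'n) contact_alg_scheme \<Rightarrow> ('a \<Rightarrow> 'b) \<Rightarrow> 'a \<Rightarrow> 'b" where
  "dv_regularize A B f =
     (\<lambda>a \<in> carrier A. \<Squnion>\<^bsub>B\<^esub> {f b | b. b \<in> carrier A \<and> well_inside A b a})"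

lemma dv_comp_regularize: "dv_comp A C \<psi> \<phi> = dv_regularize A C (\<psi> \<circ> \<phi>)"
  by (simp add: dv_comp_def dv_regularize_def)

text \<open>Morphisms are the fixed points of regularization; extensionality is part of this, because
  a regularization is extensional.\<close>

lemma dv_hom_iff:
  "\<phi> \<in> dv_hom A B \<longleftrightarrow> \<phi> \<in> dv_prehom A B \<and> dv_regularize A B \<phi> = \<phi>"
proof -
  have "dv_regularize A B \<phi> = \<phi> \<longleftrightarrow> \<phi> \<in> extensional (carrier A) \<and>
      (\<forall>a \<in> carrier A. \<phi> a = \<Squnion>\<^bsub>B\<^esub> {\<phi> b | b. b \<in> carrier A \<and> well_inside A b a})"
    by (auto simp: dv_regularize_def fun_eq_iff extensional_def)
  then show ?thesis
    by (auto simp: dv_hom_def dv_prehom_def PiE_def)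
qed

locale de_vries_pair = A: de_vries_algebra A + B: de_vries_algebra B
  for A :: "('a, 'm) contact_alg_scheme" and B :: "('b, 'n) contact_alg_scheme"
begin

lemma prehomD:
  assumes "f \<in> dv_prehom A B"
  shows prehom_closed: "a \<in> carrier A \<Longrightarrow> f a \<in> carrier B"
    and prehom_bottom: "f \<bottom>\<^bsub>A\<^esub> = \<bottom>\<^bsub>B\<^esub>"
    and prehom_meet: "\<lbrakk>a \<in> carrier A; b \<in> carrier A\<rbrakk> \<Longrightarrow> f (a \<sqinter>\<^bsub>A\<^esub> b) = f a \<sqinter>\<^bsub>B\<^esub> f b"
    and prehom_complement: "\<lbrakk>a \<in> carrier A; b \<in> carrier A; well_inside A (complement A a) b\<rbrakk>
      \<Longrightarrow> well_inside B (complement B (f a)) (f b)"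
  using assms by (auto simp: dv_prehom_def)

lemma prehom_mono:
  assumes f: "f \<in> dv_prehom A B" and [simp]: "a \<in> carrier A" "b \<in> carrier A" and "a \<sqsubseteq>\<^bsub>A\<^esub> b"
  shows "f a \<sqsubseteq>\<^bsub>B\<^esub> f b"
proof -
  have "f a = f a \<sqinter>\<^bsub>B\<^esub> f b"
    using assms A.le_iff_join[of a b] prehom_meet[OF f, of a b] by simp
  then show ?thesis
    using prehom_closed[OF f] by (subst B.le_iff_join) auto
qed

text \<open>The third axiom is stated for \<open>a\<^sup>*\<close> so that it also transports complements; since
  \<open>f\<close> sends disjoint elements to disjoint elements, it implies plain preservation of strong
  inclusion.\<close>

lemma prehom_inside:
  assumes f: "f \<in> dv_prehom A B" and [simp]: "a \<in> carrier A" "b \<in> carrier A"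
    and ab: "well_inside A a b"
  shows "well_inside B (f a) (f b)"
proof (rule B.inside_mono)
  show "well_inside B (complement B (f (complement A a))) (f b)"
    using ab by (intro prehom_complement[OF f]) auto
  have "f a \<sqinter>\<^bsub>B\<^esub> f (complement A a) = \<bottom>\<^bsub>B\<^esub>"
    using prehom_meet[OF f, of a "complement A a"]
    by (simp add: A.meet_complement prehom_bottom[OF f])
  then show "f a \<sqsubseteq>\<^bsub>B\<^esub> complement B (f (complement A a))"
    by (simp add: B.meet_eq_bottom_iff prehom_closed[OF f])
qed (auto simp: prehom_closed[OF f])

lemma regularize_closed:
  assumes "f \<in> carrier A \<rightarrow> carrier B" "a \<in> carrier A"
  shows "dv_regularize A B f a \<in> carrier B"
  using assms by (auto simp: dv_regularize_def intro!: B.sup_closed)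

lemma regularize_upper:
  assumes "f \<in> carrier A \<rightarrow> carrier B" "a \<in> carrier A" "b \<in> carrier A" "well_inside A b a"
  shows "f b \<sqsubseteq>\<^bsub>B\<^esub> dv_regularize A B f a"
  using assms by (auto simp: dv_regularize_def intro!: B.sup_upper)

lemma regularize_least:
  assumes "f \<in> carrier A \<rightarrow> carrier B" "a \<in> carrier A" "z \<in> carrier B"
    and "\<And>b. b \<in> carrier A \<Longrightarrow> well_inside A b a \<Longrightarrow> f b \<sqsubseteq>\<^bsub>B\<^esub> z"
  shows "dv_regularize A B f a \<sqsubseteq>\<^bsub>B\<^esub> z"
  using assms by (auto simp: dv_regularize_def intro!: B.sup_least)

lemma regularize_le:
  assumes f: "f \<in> dv_prehom A B" and "a \<in> carrier A"
  shows "dv_regularize A B f a \<sqsubseteq>\<^bsub>B\<^esub> f a"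
  using assms prehom_closed[OF f]
  by (intro regularize_least) (auto intro: prehom_mono[OF f] A.inside_le)

text \<open>Meets are preserved by residuation in the target. For the complement condition interpolate
  twice, \<open>a\<^sup>* \<lless> c \<lless> d \<lless> b\<close>: then \<open>c\<^sup>* \<lless> a\<close> and
  \<open>d \<lless> b\<close>, so \<open>f (c\<^sup>*)\<close> and \<open>f d\<close> lie below the regularized values, where the condition
  for \<open>f\<close> applies. One further interpolation shows that regularizing again changes nothing.\<close>

lemma regularize_hom:
  assumes f: "f \<in> dv_prehom A B"
  shows "dv_regularize A B f \<in> dv_hom A B"
proof -
  let ?g = "dv_regularize A B f"
  have fc: "f \<in> carrier A \<rightarrow> carrier B"
    using f by (auto simp: dv_prehom_def)
  have [simp]: "f a \<in> carrier B" "?g a \<in> carrier B" if "a \<in> carrier A" for a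
    using that fc regularize_closed[OF fc] by auto
  have bot: "?g \<bottom>\<^bsub>A\<^esub> = \<bottom>\<^bsub>B\<^esub>"
    using regularize_le[OF f, of "\<bottom>\<^bsub>A\<^esub>"] by (simp add: prehom_bottom[OF f] B.le_bottom_iff)
  have mono: "?g a \<sqsubseteq>\<^bsub>B\<^esub> ?g b" if [simp]: "a \<in> carrier A" "b \<in> carrier A" and "a \<sqsubseteq>\<^bsub>A\<^esub> b" for a b
    using that by (intro regularize_least[OF fc] regularize_upper[OF fc])
      (auto intro: A.inside_mono[of _ _ a b])
  have meet: "?g (a \<sqinter>\<^bsub>A\<^esub> b) = ?g a \<sqinter>\<^bsub>B\<^esub> ?g b" if [simp]: "a \<in> carrier A" "b \<in> carrier A" for a b
  proof (rule B.le_antisym)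
    show "?g (a \<sqinter>\<^bsub>A\<^esub> b) \<sqsubseteq>\<^bsub>B\<^esub> ?g a \<sqinter>\<^bsub>B\<^esub> ?g b"
      by (intro B.meet_le mono) (auto simp: A.meet_left A.meet_right)
    let ?z = "?g (a \<sqinter>\<^bsub>A\<^esub> b)"
    have step: "f a' \<sqinter>\<^bsub>B\<^esub> f b' \<sqsubseteq>\<^bsub>B\<^esub> ?z" if [simp]: "a' \<in> carrier A" "b' \<in> carrier A"
      and "well_inside A a' a" "well_inside A b' b" for a' b'
      using regularize_upper[OF fc, of "a \<sqinter>\<^bsub>A\<^esub> b" "a' \<sqinter>\<^bsub>A\<^esub> b'"] that
      by (simp add: prehom_meet[OF f] A.inside_meet_mono)
    have "?g b \<sqinter>\<^bsub>B\<^esub> f a' \<sqsubseteq>\<^bsub>B\<^esub> ?z" if [simp]: "a' \<in> carrier A" and "well_inside A a' a" for a'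
      unfolding B.meet_le_iff_le_join[OF \<open>b \<in> carrier A\<close>[THEN regularize_closed[OF fc]]
        that(1)[THEN prehom_closed[OF f]] regularize_closed[OF fc A.meet_closed[OF \<open>a \<in> carrier A\<close> \<open>b \<in> carrier A\<close>]]]
      by (rule regularize_least[OF fc])
        (use step that in \<open>auto simp: B.meet_le_iff_le_join[symmetric] meet_comm[of B _ "f a'"]\<close>)
    then have "?g a \<sqsubseteq>\<^bsub>B\<^esub> complement B (?g b) \<squnion>\<^bsub>B\<^esub> ?z"
      by (intro regularize_least[OF fc])
        (auto simp: B.meet_le_iff_le_join[symmetric] meet_comm[of B _ "?g b"])
    then show "?g a \<sqinter>\<^bsub>B\<^esub> ?g b \<sqsubseteq>\<^bsub>B\<^esub> ?z"
      by (simp add: B.meet_le_iff_le_join)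
  qed auto
  have compl: "well_inside B (complement B (?g a)) (?g b)"
    if [simp]: "a \<in> carrier A" "b \<in> carrier A" and ab: "well_inside A (complement A a) b" for a b
  proof -
    obtain d where [simp]: "d \<in> carrier A" and d: "well_inside A (complement A a) d" "well_inside A d b"
      using A.inside_interpolate[OF _ _ ab] by auto
    obtain c where [simp]: "c \<in> carrier A" and c: "well_inside A (complement A a) c" "well_inside A c d"
      using A.inside_interpolate[OF _ _ d(1)] by auto
    have "well_inside B (complement B (f (complement A c))) (f d)"
      using c(2) by (intro prehom_complement[OF f]) auto
    moreover have "f (complement A c) \<sqsubseteq>\<^bsub>B\<^esub> ?g a"
      using A.inside_complement[OF _ _ c(1)] by (intro regularize_upper[OF fc]) auto
    then have "complement B (?g a) \<sqsubseteq>\<^bsub>B\<^esub> complement B (f (complement A c))"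
      by (simp add: B.complement_le_iff)
    moreover have "f d \<sqsubseteq>\<^bsub>B\<^esub> ?g b"
      using d(2) by (intro regularize_upper[OF fc]) auto
    ultimately show ?thesis
      by (intro B.inside_mono[of "complement B (?g a)" "complement B (f (complement A c))" "f d" "?g b"])
        auto
  qed
  have gc: "?g \<in> carrier A \<rightarrow> carrier B"
    by simp
  have gp: "?g \<in> dv_prehom A B"
    using gc bot meet compl by (simp add: dv_prehom_def)
  have "dv_regularize A B ?g a = ?g a" for a
  proof (cases "a \<in> carrier A")
    case [simp]: True
    have "f b \<sqsubseteq>\<^bsub>B\<^esub> dv_regularize A B ?g a" if [simp]: "b \<in> carrier A" and b: "well_inside A b a" for b
    proof -
      obtain c where [simp]: "c \<in> carrier A" and c: "well_inside A b c" "well_inside A c a"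
        using A.inside_interpolate[OF _ _ b] by auto
      have "f b \<sqsubseteq>\<^bsub>B\<^esub> ?g c" "?g c \<sqsubseteq>\<^bsub>B\<^esub> dv_regularize A B ?g a"
        using c by (simp_all add: regularize_upper[OF fc] regularize_upper[OF gc])
      then show ?thesis
        by (rule B.le_trans) (auto simp: regularize_closed[OF gc])
    qed
    then have "?g a \<sqsubseteq>\<^bsub>B\<^esub> dv_regularize A B ?g a"
      by (intro regularize_least[OF fc]) (auto simp: regularize_closed[OF gc])
    then show ?thesis
      using regularize_le[OF gp] by (intro B.le_antisym) (auto simp: regularize_closed[OF gc])
  qed (simp add: dv_regularize_def)
  then show ?thesis
    using gp by (auto simp: dv_hom_iff)
qed

end

lemma de_vries_pairI:
  "de_vries_algebra A \<Longrightarrow> de_vries_algebra B \<Longrightarrow> de_vries_pair A B"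
  by (simp add: de_vries_pair_def)

lemma dv_hom_prehom: "\<phi> \<in> dv_hom A B \<Longrightarrow> \<phi> \<in> dv_prehom A B"
  by (simp add: dv_hom_iff)

lemma dv_prehom_comp:
  assumes "\<phi> \<in> dv_prehom A B" "\<psi> \<in> dv_prehom B C"
  shows "\<psi> \<circ> \<phi> \<in> dv_prehom A C"
  using assms by (auto simp: dv_prehom_def Pi_iff)

lemma dv_comp_hom:
  assumes "de_vries_algebra A" "de_vries_algebra C" "\<phi> \<in> dv_hom A B" "\<psi> \<in> dv_hom B C"
  shows "dv_comp A C \<psi> \<phi> \<in> dv_hom A C"
  unfolding dv_comp_regularize
  by (rule de_vries_pair.regularize_hom[OF de_vries_pairI[OF assms(1,2)]
        dv_prehom_comp[OF assms(3,4)[THEN dv_hom_prehom]]])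

lemma dv_id_hom:
  assumes "de_vries_algebra A" shows "dv_id A \<in> dv_hom A A"
proof -
  interpret A: de_vries_algebra A by fact
  have "{dv_id A b | b. b \<in> carrier A \<and> well_inside A b a} = {b \<in> carrier A. well_inside A b a}" for a
    by (auto simp: dv_id_def)
  then have "dv_regularize A A (dv_id A) = dv_id A"
    by (auto simp: dv_regularize_def dv_id_def A.sup_inside)
  moreover have "dv_id A \<in> dv_prehom A A"
    by (auto simp: dv_prehom_def dv_id_def)
  ultimately show ?thesis
    by (simp add: dv_hom_iff)
qed

lemma dv_comp_id:
  assumes "\<phi> \<in> dv_hom A B" shows "dv_comp A B \<phi> (dv_id A) = \<phi>"
proof -
  have "{(\<phi> \<circ> dv_id A) b | b. b \<in> carrier A \<and> well_inside A b a}
      = {\<phi> b | b. b \<in> carrier A \<and> well_inside A b a}" for a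
    by (force simp: dv_id_def)
  then have "dv_comp A B \<phi> (dv_id A) = dv_regularize A B \<phi>"
    unfolding dv_comp_regularize dv_regularize_def by simp
  then show ?thesis
    using assms by (simp add: dv_hom_iff)
qed

text \<open>Both composites regularize the threefold pointwise composite; they are compared at
  \<open>b \<lless> a\<close> through an intermediate \<open>c\<close>, which absorbs the extra regularization on either
  side.\<close>

lemma dv_comp_assoc:
  assumes A: "de_vries_algebra A" and B: "de_vries_algebra B" and C: "de_vries_algebra C"
    and D: "de_vries_algebra D"
    and \<phi>: "\<phi> \<in> dv_hom A B" and \<psi>: "\<psi> \<in> dv_hom B C" and \<theta>: "\<theta> \<in> dv_hom C D"
  shows "dv_comp A D (dv_comp B D \<theta> \<psi>) \<phi> = dv_comp A D \<theta> (dv_comp A C \<psi> \<phi>)"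
    (is "?l = ?r")
proof
  fix a
  interpret A: de_vries_algebra A by fact
  interpret D: de_vries_algebra D by fact
  interpret AB: de_vries_pair A B using A B by (rule de_vries_pairI)
  interpret AC: de_vries_pair A C using A C by (rule de_vries_pairI)
  interpret AD: de_vries_pair A D using A D by (rule de_vries_pairI)
  interpret BD: de_vries_pair B D using B D by (rule de_vries_pairI)
  interpret CD: de_vries_pair C D using C D by (rule de_vries_pairI)
  note \<phi>' = dv_hom_prehom[OF \<phi>] and \<psi>' = dv_hom_prehom[OF \<psi>] and \<theta>' = dv_hom_prehom[OF \<theta>]
  let ?\<psi>\<phi> = "dv_comp A C \<psi> \<phi>" and ?\<theta>\<psi> = "dv_comp B D \<theta> \<psi>"
  note p\<psi>\<phi> = dv_hom_prehom[OF dv_comp_hom[OF A C \<phi> \<psi>]] and p\<theta>\<psi> = dv_hom_prehom[OF dv_comp_hom[OF B D \<psi> \<theta>]]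
  note pl = dv_prehom_comp[OF \<phi>' p\<theta>\<psi>] and pr = dv_prehom_comp[OF p\<psi>\<phi> \<theta>']
  note ql = dv_prehom_comp[OF \<phi>' \<psi>'] and qr = dv_prehom_comp[OF \<psi>' \<theta>']
  note cl [simp] = AB.prehom_closed[OF \<phi>'] CD.prehom_closed[OF \<theta>'] AC.prehom_closed[OF p\<psi>\<phi>]
    BD.prehom_closed[OF p\<theta>\<psi>] AC.prehom_closed[OF ql, simplified] BD.prehom_closed[OF qr, simplified]
  have fs: "?\<theta>\<psi> \<circ> \<phi> \<in> carrier A \<rightarrow> carrier D" "\<theta> \<circ> ?\<psi>\<phi> \<in> carrier A \<rightarrow> carrier D"
    "\<psi> \<circ> \<phi> \<in> carrier A \<rightarrow> carrier C" "\<theta> \<circ> \<psi> \<in> carrier B \<rightarrow> carrier D"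
    using pl pr ql qr by (auto simp: dv_prehom_def)
  show "?l a = ?r a"
  proof (cases "a \<in> carrier A")
    case [simp]: True
    have rc: "?l a \<in> carrier D" "?r a \<in> carrier D"
      using fs by (auto simp: dv_comp_regularize[of A D] intro: AD.regularize_closed)
    show ?thesis
    proof (rule D.le_antisym[OF _ _ rc])
      have "?\<theta>\<psi> (\<phi> b) \<sqsubseteq>\<^bsub>D\<^esub> ?r a" if [simp]: "b \<in> carrier A" and b: "well_inside A b a" for b
      proof -
        obtain c where [simp]: "c \<in> carrier A" and c: "well_inside A b c" "well_inside A c a"
          using A.inside_interpolate[OF _ _ b] by auto
        have "?\<theta>\<psi> (\<phi> b) \<sqsubseteq>\<^bsub>D\<^esub> \<theta> (\<psi> (\<phi> b))"
          using BD.regularize_le[OF qr, of "\<phi> b"] by (simp add: dv_comp_regularize)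
        also have "\<psi> (\<phi> b) \<sqsubseteq>\<^bsub>C\<^esub> ?\<psi>\<phi> c"
          using AC.regularize_upper[OF fs(3), of c b] c by (simp add: dv_comp_regularize)
        then have "\<theta> (\<psi> (\<phi> b)) \<sqsubseteq>\<^bsub>D\<^esub> \<theta> (?\<psi>\<phi> c)"
          by (intro CD.prehom_mono[OF \<theta>']) auto
        also have "\<theta> (?\<psi>\<phi> c) \<sqsubseteq>\<^bsub>D\<^esub> ?r a"
          using AD.regularize_upper[OF fs(2), of a c] c by (simp add: dv_comp_regularize[of A D])
        finally show ?thesis
          using rc by simp
      qed
      then show "?l a \<sqsubseteq>\<^bsub>D\<^esub> ?r a"
        unfolding dv_comp_regularize[of A D ?\<theta>\<psi>] using rc by (intro AD.regularize_least fs) auto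
      have "\<theta> (?\<psi>\<phi> b) \<sqsubseteq>\<^bsub>D\<^esub> ?l a" if [simp]: "b \<in> carrier A" and b: "well_inside A b a" for b
      proof -
        obtain c where [simp]: "c \<in> carrier A" and c: "well_inside A b c" "well_inside A c a"
          using A.inside_interpolate[OF _ _ b] by auto
        have "?\<psi>\<phi> b \<sqsubseteq>\<^bsub>C\<^esub> \<psi> (\<phi> b)"
          using AC.regularize_le[OF ql, of b] by (simp add: dv_comp_regularize)
        then have "\<theta> (?\<psi>\<phi> b) \<sqsubseteq>\<^bsub>D\<^esub> \<theta> (\<psi> (\<phi> b))"
          by (intro CD.prehom_mono[OF \<theta>']) auto
        also have "\<theta> (\<psi> (\<phi> b)) \<sqsubseteq>\<^bsub>D\<^esub> ?\<theta>\<psi> (\<phi> c)"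
          using BD.regularize_upper[OF fs(4), of "\<phi> c" "\<phi> b"] AB.prehom_inside[OF \<phi>' _ _ c(1)]
          by (simp add: dv_comp_regularize)
        also have "?\<theta>\<psi> (\<phi> c) \<sqsubseteq>\<^bsub>D\<^esub> ?l a"
          using AD.regularize_upper[OF fs(1), of a c] c by (simp add: dv_comp_regularize[of A D])
        finally show ?thesis
          using rc by simp
      qed
      then show "?r a \<sqsubseteq>\<^bsub>D\<^esub> ?l a"
        unfolding dv_comp_regularize[of A D \<theta>] using rc by (intro AD.regularize_least fs) auto
    qed
  qed (simp add: dv_comp_def)
qed

section \<open>Discrete de Vries algebras\<close>

text \<open>A principal down-set of a complete Boolean algebra, with the operations of the library's
  order structures computed from those of the type class. The two-element algebra is the down-set
  of \<open>True\<close> among the truth values and the powerset of \<open>X\<close> is the down-set of \<open>X\<close>, so both are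
  handled at once.\<close>

locale down_set_order =
  fixes t :: "'b :: complete_boolean_algebra" and M :: "('b, 'm) gorder_scheme" (structure)
  assumes carrier_eq: "carrier M = {..t}"
    and eq_eq: "eq M = (=)"
    and le_eq: "le M = (\<le>)"
begin

lemma partial_order_axiom: "partial_order M"
  by unfold_locales (auto simp: carrier_eq eq_eq le_eq)

lemma least_Sup:
  assumes "S \<subseteq> {..t}" shows "least M (Sup S) (Upper M S)"
  using assms by (auto simp: least_def Upper_def carrier_eq le_eq intro: Sup_least Sup_upper)

lemma greatest_Inf:
  assumes "S \<subseteq> {..t}" shows "greatest M (inf_class.inf t (Inf S)) (Lower M S)"
  using assms
  by (auto simp: greatest_def Lower_def carrier_eq le_eq intro: Inf_greatest Inf_lower le_infI2)

lemma complete_lattice_axiom: "complete_lattice M"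
proof -
  interpret partial_order M by (rule partial_order_axiom)
  show ?thesis
    by (rule complete_latticeI) (use least_Sup greatest_Inf in \<open>auto simp: carrier_eq\<close>)
qed

sublocale complete_lattice M
  by (rule complete_lattice_axiom)

lemma sup_eq:
  assumes "S \<subseteq> {..t}" shows "\<Squnion>S = Sup S"
proof (rule le_antisym)
  have S: "S \<subseteq> carrier M"
    using assms by (simp add: carrier_eq)
  show c: "\<Squnion>S \<in> carrier M" "Sup S \<in> carrier M"
    using assms sup_closed[OF S] by (auto simp: carrier_eq intro: Sup_least)
  show "\<Squnion>S \<sqsubseteq> Sup S"
    using S c by (intro sup_least) (auto simp: le_eq intro: Sup_upper)
  show "Sup S \<sqsubseteq> \<Squnion>S"
    using sup_upper[OF S] by (auto simp: le_eq intro: Sup_least)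
qed

lemma join_eq: "a \<le> t \<Longrightarrow> b \<le> t \<Longrightarrow> a \<squnion> b = sup_class.sup a b"
  by (simp add: join_def sup_eq)

lemma meet_eq:
  assumes "a \<le> t" "b \<le> t" shows "a \<sqinter> b = inf_class.inf a b"
proof (rule le_antisym)
  have c: "a \<in> carrier M" "b \<in> carrier M"
    using assms by (auto simp: carrier_eq)
  show "a \<sqinter> b \<sqsubseteq> inf_class.inf a b"
    using meet_left[OF c] meet_right[OF c] by (simp add: le_eq)
  show "inf_class.inf a b \<in> carrier M" "a \<sqinter> b \<in> carrier M"
    using c assms meet_closed[OF c] by (auto simp: carrier_eq intro: le_infI1)
  then show "inf_class.inf a b \<sqsubseteq> a \<sqinter> b"
    using c by (intro meet_le) (auto simp: le_eq)
qed

lemma bottom_is_bot: "\<bottom> = bot"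
  using bottom_lower[of bot] by (auto simp: carrier_eq le_eq bot_unique)

lemma top_is_bound: "\<top> = t"
  using top_higher[of t] top_closed by (auto simp: carrier_eq le_eq)

lemma boolean_lattice_axiom: "boolean_lattice M"
proof (unfold_locales)
  fix a b c assume "a \<in> carrier M" "b \<in> carrier M" "c \<in> carrier M"
  then have abc: "a \<le> t" "b \<le> t" "c \<le> t"
    by (simp_all add: carrier_eq)
  then show "a \<sqinter> (b \<squnion> c) = (a \<sqinter> b) \<squnion> (a \<sqinter> c)"
    by (simp add: join_eq meet_eq inf_sup_distrib1 le_infI1)
  show "\<exists>b \<in> carrier M. a \<sqinter> b = \<bottom> \<and> a \<squnion> b = \<top>"
  proof (rule bexI[of _ "inf_class.inf t (- a)"])
    show "a \<sqinter> inf_class.inf t (- a) = \<bottom> \<and> a \<squnion> inf_class.inf t (- a) = \<top>"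
      using abc
      by (simp add: join_eq meet_eq bottom_is_bot top_is_bound inf_left_commute sup_inf_distrib1 sup_absorb2)
  qed (simp add: carrier_eq)
qed

sublocale boolean_lattice M
  by (rule boolean_lattice_axiom)

lemma complement_eq:
  assumes "a \<le> t" shows "complement M a = inf_class.inf t (- a)"
  using assms
  by (intro complement_eqI)
    (simp_all add: carrier_eq join_eq meet_eq bottom_is_bot top_is_bound inf_left_commute sup_inf_distrib1 sup_absorb2)

end

definition down_dv :: "'b :: complete_boolean_algebra \<Rightarrow> 'b contact_alg" where
  "down_dv t = discrete \<lparr>carrier = {..t}, eq = (=), le = (\<le>)\<rparr>"

interpretation down_dv: down_set_order t "down_dv t" for t
  by unfold_locales (simp_all add: down_dv_def discrete_def)

lemma contact_down_dv:
  assumes "a \<le> t" "b \<le> t"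
  shows "a \<frown>\<^bsub>down_dv t\<^esub> b \<longleftrightarrow> inf_class.inf a b \<noteq> bot"
proof -
  interpret L: down_set_order t "\<lparr>carrier = {..t}, eq = (=), le = (\<le>)\<rparr>"
    by unfold_locales simp_all
  show ?thesis
    using assms by (simp add: down_dv_def discrete_def L.meet_eq L.bottom_is_bot)
qed

lemma inside_down_dv:
  assumes "a \<le> t" "b \<le> t"
  shows "well_inside (down_dv t) a b \<longleftrightarrow> a \<le> b"
proof -
  have "inf_class.inf a (inf_class.inf t (- b)) = inf_class.inf a (- b)"
    using assms by (simp add: inf.absorb1 inf_assoc[symmetric])
  then show ?thesis
    using assms by (simp add: well_inside_def down_dv.complement_eq contact_down_dv inf_shunt)
qed

text \<open>In a discrete algebra the element itself interpolates, and the complement of \<open>a\<close> witnesses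
  density.\<close>

lemma de_vries_down_dv: "de_vries_algebra (down_dv t)"
proof -
  note eqs = contact_down_dv down_dv.carrier_eq down_dv.bottom_is_bot down_dv.top_is_bound
    down_dv.join_eq down_dv.meet_eq down_dv.complement_eq
  show ?thesis
  proof unfold_locales
    fix a b c assume "a \<in> carrier (down_dv t)" "b \<in> carrier (down_dv t)" "c \<in> carrier (down_dv t)"
    then have abc: "a \<le> t" "b \<le> t" "c \<le> t"
      by (simp_all add: eqs)
    show "a \<frown>\<^bsub>down_dv t\<^esub> a" if "a \<noteq> \<bottom>\<^bsub>down_dv t\<^esub>"
      using abc that by (simp add: eqs)
    show "a \<noteq> \<bottom>\<^bsub>down_dv t\<^esub> \<and> b \<noteq> \<bottom>\<^bsub>down_dv t\<^esub>" if "a \<frown>\<^bsub>down_dv t\<^esub> b"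
      using abc that by (auto simp: eqs)
    show "b \<frown>\<^bsub>down_dv t\<^esub> a" if "a \<frown>\<^bsub>down_dv t\<^esub> b"
      using abc that by (simp add: eqs inf_commute)
    show "a \<frown>\<^bsub>down_dv t\<^esub> (b \<squnion>\<^bsub>down_dv t\<^esub> c) \<longleftrightarrow> a \<frown>\<^bsub>down_dv t\<^esub> b \<or> a \<frown>\<^bsub>down_dv t\<^esub> c"
      using abc by (simp add: eqs inf_sup_distrib1)
    show "\<exists>c \<in> carrier (down_dv t). \<not> a \<frown>\<^bsub>down_dv t\<^esub> c \<and> \<not> b \<frown>\<^bsub>down_dv t\<^esub> complement (down_dv t) c"
      if "\<not> a \<frown>\<^bsub>down_dv t\<^esub> b"
    proof (rule bexI[of _ b])
      have "inf_class.inf b (inf_class.inf t (- b)) = bot"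
        by (simp add: inf_left_commute)
      then show "\<not> a \<frown>\<^bsub>down_dv t\<^esub> b \<and> \<not> b \<frown>\<^bsub>down_dv t\<^esub> complement (down_dv t) b"
        using abc that by (simp add: eqs)
    qed (simp add: eqs abc)
    show "\<exists>b \<in> carrier (down_dv t). b \<noteq> \<bottom>\<^bsub>down_dv t\<^esub> \<and> \<not> b \<frown>\<^bsub>down_dv t\<^esub> a" if "a \<noteq> \<top>\<^bsub>down_dv t\<^esub>"
    proof (rule bexI[of _ "inf_class.inf t (- a)"])
      have "inf_class.inf t (- a) \<noteq> bot"
        using abc that by (auto simp: eqs inf_shunt)
      then show "inf_class.inf t (- a) \<noteq> \<bottom>\<^bsub>down_dv t\<^esub> \<and> \<not> inf_class.inf t (- a) \<frown>\<^bsub>down_dv t\<^esub> a"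
        using abc by (simp add: eqs inf_assoc)
    qed (simp add: eqs)
  qed
qed

lemma two_dv_down: "two_dv = down_dv True"
proof -
  have "{..True} = UNIV"
    by auto
  then show ?thesis
    by (simp add: two_dv_def down_dv_def)
qed

lemma pow_dv_down: "pow_dv X = down_dv X"
proof -
  have "{..X} = Pow X"
    by auto
  then show ?thesis
    by (simp add: pow_dv_def down_dv_def)
qed

lemma de_vries_two: "de_vries_algebra two_dv"
  and de_vries_pow: "de_vries_algebra (pow_dv X)"
  by (simp_all add: two_dv_down pow_dv_down de_vries_down_dv)

lemma two_dv_simps [simp]:
  "carrier two_dv = UNIV" "\<bottom>\<^bsub>two_dv\<^esub> = False" "p \<sqinter>\<^bsub>two_dv\<^esub> q \<longleftrightarrow> p \<and> q"
  "complement two_dv p \<longleftrightarrow> \<not> p" "\<Squnion>\<^bsub>two_dv\<^esub> S \<longleftrightarrow> True \<in> S"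
  "well_inside two_dv p q \<longleftrightarrow> (p \<longrightarrow> q)"
proof -
  have le: "p \<le> True" for p
    by simp
  show "carrier two_dv = UNIV"
    by (auto simp: two_dv_down down_dv.carrier_eq)
  show "\<bottom>\<^bsub>two_dv\<^esub> = False"
    by (simp add: two_dv_down down_dv.bottom_is_bot)
  show "p \<sqinter>\<^bsub>two_dv\<^esub> q \<longleftrightarrow> p \<and> q"
    by (simp add: two_dv_down down_dv.meet_eq)
  show "complement two_dv p \<longleftrightarrow> \<not> p"
    by (simp add: two_dv_down down_dv.complement_eq)
  have "S \<subseteq> {..True}"
    using le by blast
  then show "\<Squnion>\<^bsub>two_dv\<^esub> S \<longleftrightarrow> True \<in> S"
    by (simp add: two_dv_down down_dv.sup_eq)
  show "well_inside two_dv p q \<longleftrightarrow> (p \<longrightarrow> q)"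
    using inside_down_dv[OF le le, of p q] by (simp add: two_dv_down le_bool_def)
qed

lemma pow_dv_simps [simp]:
  "carrier (pow_dv X) = Pow X" "\<bottom>\<^bsub>pow_dv X\<^esub> = {}"
  by (auto simp: pow_dv_down down_dv.carrier_eq down_dv.bottom_is_bot)

lemma pow_dv_ops [simp]:
  assumes "U \<subseteq> X"
  shows "complement (pow_dv X) U = X - U"
    and "V \<subseteq> X \<Longrightarrow> U \<sqinter>\<^bsub>pow_dv X\<^esub> V = U \<inter> V"
    and "V \<subseteq> X \<Longrightarrow> well_inside (pow_dv X) U V \<longleftrightarrow> U \<subseteq> V"
  using assms by (auto simp: pow_dv_down down_dv.complement_eq down_dv.meet_eq inside_down_dv)

lemma pow_dv_Sup [simp]:
  assumes "\<And>U. U \<in> S \<Longrightarrow> U \<subseteq> X" shows "\<Squnion>\<^bsub>pow_dv X\<^esub> S = \<Union>S"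
proof -
  have "S \<subseteq> {..X}"
    using assms by auto
  then show ?thesis
    by (simp add: pow_dv_down down_dv.sup_eq)
qed

lemma dv_hom_PiE: "\<phi> \<in> dv_hom A B \<Longrightarrow> \<phi> \<in> carrier A \<rightarrow>\<^sub>E carrier B"
  by (simp add: dv_hom_def)

lemma dv_hom_closed: "\<phi> \<in> dv_hom A B \<Longrightarrow> a \<in> carrier A \<Longrightarrow> \<phi> a \<in> carrier B"
  by (blast dest: dv_hom_PiE)

section \<open>Morphisms into powersets and into the two-element algebra\<close>

text \<open>Read as subsets of \<open>A\<close>, the morphisms to \<open>2\<close> are the round filters that contain \<open>a\<close> or
  \<open>b\<close> whenever \<open>a\<^sup>* \<lless> b\<close>.\<close>

lemma dv_hom_two_iff:
  "\<phi> \<in> dv_hom A two_dv \<longleftrightarrow> \<phi> \<in> extensional (carrier A) \<and> \<not> \<phi> \<bottom>\<^bsub>A\<^esub> \<and>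
    (\<forall>a \<in> carrier A. \<forall>b \<in> carrier A. \<phi> (a \<sqinter>\<^bsub>A\<^esub> b) \<longleftrightarrow> \<phi> a \<and> \<phi> b) \<and>
    (\<forall>a \<in> carrier A. \<forall>b \<in> carrier A. well_inside A (complement A a) b \<longrightarrow> \<phi> a \<or> \<phi> b) \<and>
    (\<forall>a \<in> carrier A. \<phi> a \<longleftrightarrow> (\<exists>b \<in> carrier A. well_inside A b a \<and> \<phi> b))"
proof -
  have "True \<in> {\<phi> b | b. b \<in> carrier A \<and> well_inside A b a}
      \<longleftrightarrow> (\<exists>b \<in> carrier A. well_inside A b a \<and> \<phi> b)" for a
    by auto
  then show ?thesis
    unfolding dv_hom_def by (auto simp: PiE_def)
qed

lemma dv_hom_twoD:
  assumes "\<phi> \<in> dv_hom A two_dv"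
  shows two_extensional: "\<phi> \<in> extensional (carrier A)"
    and two_bottom: "\<not> \<phi> \<bottom>\<^bsub>A\<^esub>"
    and two_meet: "\<lbrakk>a \<in> carrier A; b \<in> carrier A\<rbrakk> \<Longrightarrow> \<phi> (a \<sqinter>\<^bsub>A\<^esub> b) \<longleftrightarrow> \<phi> a \<and> \<phi> b"
    and two_complement: "\<lbrakk>a \<in> carrier A; b \<in> carrier A; well_inside A (complement A a) b\<rbrakk> \<Longrightarrow> \<phi> a \<or> \<phi> b"
    and two_round: "a \<in> carrier A \<Longrightarrow> \<phi> a \<longleftrightarrow> (\<exists>b \<in> carrier A. well_inside A b a \<and> \<phi> b)"
  using assms unfolding dv_hom_two_iff by blast+

text \<open>The reason for the adjunction: meets, complements and joins in a powerset are
  determined by membership of each point, so each condition on \<open>\<phi>\<close> is a conjunction over the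
  points of the same condition for two-valued functions.\<close>

lemma dv_hom_pow_iff:
  fixes A :: "('a, 'm) contact_alg_scheme" and X :: "'x set"
  assumes "de_vries_algebra A"
  shows "\<phi> \<in> dv_hom A (pow_dv X) \<longleftrightarrow> \<phi> \<in> carrier A \<rightarrow>\<^sub>E Pow X \<and>
    (\<forall>x \<in> X. (\<lambda>a \<in> carrier A. x \<in> \<phi> a) \<in> dv_hom A two_dv)"
proof (cases "\<phi> \<in> carrier A \<rightarrow>\<^sub>E Pow X")
  case True
  interpret A: de_vries_algebra A by fact
  have sub: "\<phi> a \<subseteq> X" if "a \<in> carrier A" for a
    using True that by auto
  have sup: "\<Squnion>\<^bsub>pow_dv X\<^esub> {\<phi> b | b. b \<in> carrier A \<and> well_inside A b a}
      = (\<Union>b \<in> {b \<in> carrier A. well_inside A b a}. \<phi> b)" for a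
    using sub by (subst pow_dv_Sup) auto
  have 1: "\<phi> \<bottom>\<^bsub>A\<^esub> = \<bottom>\<^bsub>pow_dv X\<^esub> \<longleftrightarrow> (\<forall>x \<in> X. x \<notin> \<phi> \<bottom>\<^bsub>A\<^esub>)"
    using sub[OF A.bottom_closed] by auto
  have 2: "\<phi> (a \<sqinter>\<^bsub>A\<^esub> b) = \<phi> a \<sqinter>\<^bsub>pow_dv X\<^esub> \<phi> b \<longleftrightarrow> (\<forall>x \<in> X. x \<in> \<phi> (a \<sqinter>\<^bsub>A\<^esub> b) \<longleftrightarrow> x \<in> \<phi> a \<and> x \<in> \<phi> b)"
    if "a \<in> carrier A" "b \<in> carrier A" for a b
    unfolding pow_dv_ops(2)[OF that[THEN sub]] using sub that sub[OF A.meet_closed[OF that]] by blast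
  have 3: "well_inside (pow_dv X) (complement (pow_dv X) (\<phi> a)) (\<phi> b) \<longleftrightarrow> (\<forall>x \<in> X. x \<in> \<phi> a \<or> x \<in> \<phi> b)"
    if "a \<in> carrier A" "b \<in> carrier A" for a b
    using sub that by auto
  have 4: "\<phi> a = \<Squnion>\<^bsub>pow_dv X\<^esub> {\<phi> b | b. b \<in> carrier A \<and> well_inside A b a} \<longleftrightarrow>
      (\<forall>x \<in> X. x \<in> \<phi> a \<longleftrightarrow> (\<exists>b \<in> carrier A. well_inside A b a \<and> x \<in> \<phi> b))" if "a \<in> carrier A" for a
    unfolding sup using sub that by blast
  have "\<phi> \<in> dv_hom A (pow_dv X) \<longleftrightarrow>
      (\<forall>x \<in> X. x \<notin> \<phi> \<bottom>\<^bsub>A\<^esub>) \<and>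
      (\<forall>a \<in> carrier A. \<forall>b \<in> carrier A. \<forall>x \<in> X. x \<in> \<phi> (a \<sqinter>\<^bsub>A\<^esub> b) \<longleftrightarrow> x \<in> \<phi> a \<and> x \<in> \<phi> b) \<and>
      (\<forall>a \<in> carrier A. \<forall>b \<in> carrier A. well_inside A (complement A a) b \<longrightarrow> (\<forall>x \<in> X. x \<in> \<phi> a \<or> x \<in> \<phi> b)) \<and>
      (\<forall>a \<in> carrier A. \<forall>x \<in> X. x \<in> \<phi> a \<longleftrightarrow> (\<exists>b \<in> carrier A. well_inside A b a \<and> x \<in> \<phi> b))"
    unfolding dv_hom_def mem_Collect_eq pow_dv_simps(1) 1
    using True 2 3 4 by (simp cong: ball_cong)
  also have "\<dots> \<longleftrightarrow> (\<forall>x \<in> X. (\<lambda>a \<in> carrier A. x \<in> \<phi> a) \<in> dv_hom A two_dv)"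
  proof -
    have "(\<lambda>a \<in> carrier A. x \<in> \<phi> a) \<in> dv_hom A two_dv \<longleftrightarrow> x \<notin> \<phi> \<bottom>\<^bsub>A\<^esub> \<and>
      (\<forall>a \<in> carrier A. \<forall>b \<in> carrier A. x \<in> \<phi> (a \<sqinter>\<^bsub>A\<^esub> b) \<longleftrightarrow> x \<in> \<phi> a \<and> x \<in> \<phi> b) \<and>
      (\<forall>a \<in> carrier A. \<forall>b \<in> carrier A. well_inside A (complement A a) b \<longrightarrow> x \<in> \<phi> a \<or> x \<in> \<phi> b) \<and>
      (\<forall>a \<in> carrier A. x \<in> \<phi> a \<longleftrightarrow> (\<exists>b \<in> carrier A. well_inside A b a \<and> x \<in> \<phi> b))" for x
      unfolding dv_hom_two_iff by (simp cong: ball_cong bex_cong)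
    \<comment> \<open>The quantifier over points moves outwards past the quantifiers over \<open>A\<close>.\<close>
    moreover have "(\<forall>x \<in> X. P x) \<and> (\<forall>a \<in> C. \<forall>b \<in> C. \<forall>x \<in> X. Q a b x) \<and>
      (\<forall>a \<in> C. \<forall>b \<in> C. W a b \<longrightarrow> (\<forall>x \<in> X. R a b x)) \<and> (\<forall>a \<in> C. \<forall>x \<in> X. S a x) \<longleftrightarrow>
      (\<forall>x \<in> X. P x \<and> (\<forall>a \<in> C. \<forall>b \<in> C. Q a b x) \<and>
      (\<forall>a \<in> C. \<forall>b \<in> C. W a b \<longrightarrow> R a b x) \<and> (\<forall>a \<in> C. S a x))"
      for P :: "'x \<Rightarrow> bool" and C :: "'a set" and Q W R S
      by blast
    ultimately show ?thesis
      by simp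
  qed
  finally show ?thesis
    using True by blast
qed (auto simp: dv_hom_def)

lemma dv_comp_two:
  "dv_comp A two_dv \<phi> \<alpha> = (\<lambda>a \<in> carrier A. \<exists>b \<in> carrier A. well_inside A b a \<and> \<phi> (\<alpha> b))"
  by (auto simp: dv_comp_def fun_eq_iff)

lemma dv_comp_pow:
  assumes "\<And>b. b \<in> carrier A \<Longrightarrow> \<psi> (\<phi> b) \<subseteq> X"
  shows "dv_comp A (pow_dv X) \<psi> \<phi> = (\<lambda>a \<in> carrier A. \<Union>b \<in> {b \<in> carrier A. well_inside A b a}. \<psi> (\<phi> b))"
proof -
  have "\<Squnion>\<^bsub>pow_dv X\<^esub> {\<psi> (\<phi> b) | b. b \<in> carrier A \<and> well_inside A b a}
      = (\<Union>b \<in> {b \<in> carrier A. well_inside A b a}. \<psi> (\<phi> b))" for a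
    using assms by (subst pow_dv_Sup) auto
  then show ?thesis
    by (simp add: dv_comp_def)
qed

section \<open>The dual adjunction\<close>

lemma set_two_map_hom:
  assumes "f \<in> X \<rightarrow>\<^sub>E Y"
  shows "set_two_map X Y f \<in> dv_hom (pow_dv Y) (pow_dv X)"
  unfolding dv_hom_pow_iff[OF de_vries_pow] dv_hom_two_iff
  using assms by (auto simp: set_two_map_def cong: conj_cong)

lemma dv_two_map_eq:
  assumes "\<phi> \<in> dv_hom B two_dv"
  shows "dv_two_map A B \<alpha> \<phi> = dv_comp A two_dv \<phi> \<alpha>"
  using assms by (simp add: dv_two_map_def)

lemma dv_two_map_closed:
  assumes "de_vries_algebra A" "\<alpha> \<in> dv_hom A B"
  shows "dv_two_map A B \<alpha> \<in> dv_hom B two_dv \<rightarrow>\<^sub>E dv_hom A two_dv"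
  using dv_comp_hom[OF assms(1) de_vries_two assms(2)] by (auto simp: dv_two_map_def)

lemma transpose_dv_closed:
  assumes "de_vries_algebra A" "\<phi> \<in> dv_hom A (pow_dv X)"
  shows "transpose_dv A X \<phi> \<in> X \<rightarrow>\<^sub>E dv_hom A two_dv"
  using assms(2) unfolding dv_hom_pow_iff[OF assms(1)] by (auto simp: transpose_dv_def)

lemma transpose_dv_set:
  assumes "f \<in> X \<rightarrow>\<^sub>E dv_hom A two_dv"
  shows "transpose_dv A X (transpose_set A X f) = f"
proof (rule ext)
  fix x
  show "transpose_dv A X (transpose_set A X f) x = f x"
  proof (cases "x \<in> X")
    case True
    then have "f x \<in> extensional (carrier A)"
      using assms two_extensional by blast
    then have "f x = restrict (f x) (carrier A)"
      by (simp add: extensional_restrict)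
    then show ?thesis
      using True by (simp add: transpose_dv_def transpose_set_def cong: restrict_cong)
  qed (use assms in \<open>auto simp: transpose_dv_def\<close>)
qed

lemma transpose_set_closed:
  assumes "de_vries_algebra A" "f \<in> X \<rightarrow>\<^sub>E dv_hom A two_dv"
  shows "transpose_set A X f \<in> dv_hom A (pow_dv X)"
  unfolding dv_hom_pow_iff[OF assms(1)]
proof (intro conjI ballI)
  fix x assume x: "x \<in> X"
  have "(\<lambda>a \<in> carrier A. x \<in> transpose_set A X f a) = transpose_dv A X (transpose_set A X f) x"
    using x by (simp add: transpose_dv_def)
  then show "(\<lambda>a \<in> carrier A. x \<in> transpose_set A X f a) \<in> dv_hom A two_dv"
    using x assms(2) by (auto simp: transpose_dv_set)
qed (auto simp: transpose_set_def)

lemma transpose_set_dv: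
  assumes "\<phi> \<in> dv_hom A (pow_dv X)"
  shows "transpose_set A X (transpose_dv A X \<phi>) = \<phi>"
proof -
  have \<phi>: "\<phi> \<in> carrier A \<rightarrow>\<^sub>E Pow X"
    using dv_hom_PiE[OF assms] by simp
  have "transpose_set A X (transpose_dv A X \<phi>) a = \<phi> a" for a
  proof (cases "a \<in> carrier A")
    case True
    then have "\<phi> a \<subseteq> X"
      using \<phi> by auto
    then show ?thesis
      using True by (auto simp: transpose_dv_def transpose_set_def)
  next
    case False
    then show ?thesis
      using PiE_arb[OF \<phi>] by (simp add: transpose_set_def)
  qed
  then show ?thesis
    by (rule ext)
qed

lemma transpose_bij:
  assumes "de_vries_algebra A"
  shows "bij_betw (transpose_dv A X) (dv_hom A (pow_dv X)) (X \<rightarrow>\<^sub>E dv_hom A two_dv)"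
proof (rule bij_betw_byWitness[where f' = "transpose_set A X"])
  show "transpose_dv A X ` dv_hom A (pow_dv X) \<subseteq> X \<rightarrow>\<^sub>E dv_hom A two_dv"
    by (rule image_subsetI) (rule transpose_dv_closed[OF assms])
  show "transpose_set A X ` (X \<rightarrow>\<^sub>E dv_hom A two_dv) \<subseteq> dv_hom A (pow_dv X)"
    by (rule image_subsetI) (rule transpose_set_closed[OF assms])
qed (blast intro: transpose_set_dv transpose_dv_set)+

text \<open>Inverse image preserves joins, so composing with it needs no regularization beyond the one
  already present in \<open>\<phi> \<diamondop> \<alpha>\<close>.\<close>

lemma transpose_natural:
  assumes A: "de_vries_algebra A" and B: "de_vries_algebra B"
    and \<alpha>: "\<alpha> \<in> dv_hom A B" and f: "f \<in> X \<rightarrow>\<^sub>E Y" and \<phi>: "\<phi> \<in> dv_hom B (pow_dv Y)"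
  shows "transpose_dv A X (dv_comp A (pow_dv X) (set_two_map X Y f) (dv_comp A (pow_dv Y) \<phi> \<alpha>))
    = compose X (dv_two_map A B \<alpha>) (compose X (transpose_dv B Y \<phi>) f)"
proof (rule ext)
  fix x
  let ?\<gamma> = "dv_comp A (pow_dv Y) \<phi> \<alpha>"
  have \<gamma>: "?\<gamma> \<in> dv_hom A (pow_dv Y)"
    by (rule dv_comp_hom[OF A de_vries_pow \<alpha> \<phi>])
  show "transpose_dv A X (dv_comp A (pow_dv X) (set_two_map X Y f) ?\<gamma>) x
    = compose X (dv_two_map A B \<alpha>) (compose X (transpose_dv B Y \<phi>) f) x"
  proof (cases "x \<in> X")
    case x: True
    then have fx: "f x \<in> Y"
      using f by auto
    have \<alpha>c: "\<alpha> b \<in> carrier B" if "b \<in> carrier A" for b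
      using \<alpha> that by (rule dv_hom_closed)
    have \<phi>c: "\<phi> b \<subseteq> Y" if "b \<in> carrier B" for b
      using dv_hom_closed[OF \<phi> that] by simp
    have \<gamma>c: "?\<gamma> b \<subseteq> Y" if "b \<in> carrier A" for b
      using dv_hom_closed[OF \<gamma> that] by simp
    have t\<phi>: "transpose_dv B Y \<phi> (f x) \<in> dv_hom B two_dv"
      using transpose_dv_closed[OF B \<phi>] fx by blast
    have t\<gamma>: "(\<lambda>a \<in> carrier A. f x \<in> ?\<gamma> a) \<in> dv_hom A two_dv"
      using \<gamma> fx unfolding dv_hom_pow_iff[OF A] by blast
    have "x \<in> dv_comp A (pow_dv X) (set_two_map X Y f) ?\<gamma> a \<longleftrightarrow>
        dv_comp A two_dv (transpose_dv B Y \<phi> (f x)) \<alpha> a" if a: "a \<in> carrier A" for a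
    proof -
      have "x \<in> dv_comp A (pow_dv X) (set_two_map X Y f) ?\<gamma> a \<longleftrightarrow>
          (\<exists>b \<in> carrier A. well_inside A b a \<and> f x \<in> ?\<gamma> b)"
        using a x \<gamma>c by (subst dv_comp_pow) (auto simp: set_two_map_def)
      also have "\<dots> \<longleftrightarrow> f x \<in> ?\<gamma> a"
        using two_round[OF t\<gamma> a] a by (auto cong: conj_cong)
      also have "\<dots> \<longleftrightarrow> (\<exists>b \<in> carrier A. well_inside A b a \<and> f x \<in> \<phi> (\<alpha> b))"
        using a \<alpha>c \<phi>c by (subst dv_comp_pow) auto
      finally show ?thesis
        using a fx \<alpha>c by (auto simp: dv_comp_two transpose_dv_def)
    qed
    then have "(\<lambda>a \<in> carrier A. x \<in> dv_comp A (pow_dv X) (set_two_map X Y f) ?\<gamma> a) =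
        (\<lambda>a \<in> carrier A. dv_comp A two_dv (transpose_dv B Y \<phi> (f x)) \<alpha> a)"
      by (rule restrict_ext)
    also have "\<dots> = dv_comp A two_dv (transpose_dv B Y \<phi> (f x)) \<alpha>"
      by (simp add: dv_comp_def cong: restrict_cong)
    finally show ?thesis
      using x fx t\<phi> by (simp add: transpose_dv_def[of A X] compose_def dv_two_map_eq)
  qed (simp add: compose_def transpose_dv_def)
qed

lemma dv_two_map_id:
  assumes "de_vries_algebra A"
  shows "dv_two_map A A (dv_id A) = (\<lambda>\<phi> \<in> dv_hom A two_dv. \<phi>)"
  by (auto simp: dv_two_map_def dv_comp_id)

lemma dv_two_map_comp:
  assumes "de_vries_algebra A" "de_vries_algebra B" "de_vries_algebra C"
    and "\<alpha> \<in> dv_hom A B" "\<beta> \<in> dv_hom B C"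
  shows "dv_two_map A C (dv_comp A C \<beta> \<alpha>)
    = compose (dv_hom C two_dv) (dv_two_map A B \<alpha>) (dv_two_map B C \<beta>)"
  using dv_comp_assoc[OF assms(1-3) de_vries_two assms(4,5)] dv_comp_hom[OF assms(2) de_vries_two assms(5)]
  by (auto simp: dv_two_map_def compose_def)

section \<open>The monad of the adjunction is the ultrafilter monad\<close>

text \<open>On a powerset, where \<open>\<lless>\<close> is inclusion, roundness reduces to monotonicity and the
  complement condition to the choice between \<open>U\<close> and \<open>X - U\<close>: these are the ultrafilters.\<close>

lemma dvm_iff:
  "\<phi> \<in> dvm X \<longleftrightarrow> \<phi> \<in> extensional (Pow X) \<and> \<not> \<phi> {} \<and>
    (\<forall>U \<in> Pow X. \<forall>V \<in> Pow X. \<phi> (U \<inter> V) \<longleftrightarrow> \<phi> U \<and> \<phi> V) \<and> (\<forall>U \<in> Pow X. \<phi> U \<or> \<phi> (X - U))"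
  (is "?L \<longleftrightarrow> ?R")
proof
  assume L: ?L
  then have h: "\<phi> \<in> dv_hom (pow_dv X) two_dv"
    by (simp add: dvm_def)
  show ?R
  proof (intro conjI ballI)
    show "\<phi> \<in> extensional (Pow X)" "\<not> \<phi> {}"
      using two_extensional[OF h] two_bottom[OF h] by simp_all
    show "\<phi> (U \<inter> V) \<longleftrightarrow> \<phi> U \<and> \<phi> V" if "U \<in> Pow X" "V \<in> Pow X" for U V
      using two_meet[OF h, of U V] that by simp
    show "\<phi> U \<or> \<phi> (X - U)" if "U \<in> Pow X" for U
      using two_complement[OF h, of U "X - U"] that by simp
  qed
next
  assume R: ?R
  have mono: "\<phi> V" if "U \<subseteq> V" "V \<subseteq> X" "\<phi> U" for U V
  proof -
    have "\<phi> (U \<inter> V) \<longleftrightarrow> \<phi> U \<and> \<phi> V" "U \<inter> V = U"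
      using R that by auto
    then show ?thesis
      using that(3) by simp
  qed
  show ?L
    unfolding dvm_def dv_hom_two_iff pow_dv_simps(1,2)
  proof (intro conjI ballI impI)
    show "\<phi> \<in> extensional (Pow X)" "\<not> \<phi> {}"
      using R by blast+
    show "\<phi> (U \<sqinter>\<^bsub>pow_dv X\<^esub> V) \<longleftrightarrow> \<phi> U \<and> \<phi> V" if "U \<in> Pow X" "V \<in> Pow X" for U V
      using R that by simp
    show "\<phi> U \<or> \<phi> V" if UV: "U \<in> Pow X" "V \<in> Pow X" "well_inside (pow_dv X) (complement (pow_dv X) U) V" for U V
    proof -
      have "X - U \<subseteq> V"
        using UV by simp
      moreover have "\<phi> U \<or> \<phi> (X - U)"
        using R UV(1) by blast
      ultimately show ?thesis
        using mono[of "X - U" V] UV(2) by auto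
    qed
    show "\<phi> U \<longleftrightarrow> (\<exists>V \<in> Pow X. well_inside (pow_dv X) V U \<and> \<phi> V)" if U: "U \<in> Pow X" for U
    proof
      assume "\<phi> U"
      then show "\<exists>V \<in> Pow X. well_inside (pow_dv X) V U \<and> \<phi> V"
        using U by (intro bexI[of _ U]) auto
    next
      assume "\<exists>V \<in> Pow X. well_inside (pow_dv X) V U \<and> \<phi> V"
      then show "\<phi> U"
        using U mono[of _ U] by auto
    qed
  qed
qed

lemma dvmD:
  assumes "\<phi> \<in> dvm X"
  shows dvm_empty: "\<not> \<phi> {}"
    and dvm_Int: "U \<subseteq> X \<Longrightarrow> V \<subseteq> X \<Longrightarrow> \<phi> (U \<inter> V) \<longleftrightarrow> \<phi> U \<and> \<phi> V"
    and dvm_ext: "\<phi> \<in> extensional (Pow X)"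
    and dvm_mono: "\<lbrakk>\<phi> U; U \<subseteq> V; V \<subseteq> X\<rbrakk> \<Longrightarrow> \<phi> V"
    and dvm_Diff: "U \<subseteq> X \<Longrightarrow> \<phi> (X - U) \<longleftrightarrow> \<not> \<phi> U"
    and dvm_top: "\<phi> X"
proof -
  have R: "\<phi> \<in> extensional (Pow X)" "\<not> \<phi> {}" "\<And>U. U \<subseteq> X \<Longrightarrow> \<phi> U \<or> \<phi> (X - U)"
    and int: "\<And>U V. U \<subseteq> X \<Longrightarrow> V \<subseteq> X \<Longrightarrow> \<phi> (U \<inter> V) \<longleftrightarrow> \<phi> U \<and> \<phi> V"
    using assms unfolding dvm_iff by simp_all
  show "\<not> \<phi> {}" "\<phi> \<in> extensional (Pow X)" "\<phi> X"
    using R(1,2) R(3)[of "{}"] by simp_all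
  show "\<phi> (U \<inter> V) \<longleftrightarrow> \<phi> U \<and> \<phi> V" if "U \<subseteq> X" "V \<subseteq> X" for U V
    using that by (rule int)
  show "\<phi> V" if "\<phi> U" "U \<subseteq> V" "V \<subseteq> X" for U V
    using int[of U V] that by (simp add: inf.absorb1)
  show "\<phi> (X - U) \<longleftrightarrow> \<not> \<phi> U" if "U \<subseteq> X" for U
    using int[OF that, of "X - U"] R(2) R(3)[OF that] by auto
qed

lemma eventually_dvm_ultra:
  assumes "\<phi> \<in> dvm X"
  shows "eventually P (dvm_ultra X \<phi>) \<longleftrightarrow> \<phi> {x \<in> X. P x}"
proof -
  let ?I = "{U \<in> Pow X. \<phi> U}"
  have "eventually P (INF U \<in> ?I. principal U) \<longleftrightarrow> (\<exists>U \<in> ?I. eventually P (principal U))"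
  proof (rule eventually_INF_base)
    show "?I \<noteq> {}"
      using dvm_top[OF assms] by blast
    fix U V assume "U \<in> ?I" "V \<in> ?I"
    then have "U \<inter> V \<in> ?I"
      using dvm_Int[OF assms] by auto
    then show "\<exists>W \<in> ?I. principal W \<le> inf (principal U) (principal V)"
      by (rule rev_bexI) simp
  qed
  also have "\<dots> \<longleftrightarrow> \<phi> {x \<in> X. P x}"
  proof
    assume "\<exists>U \<in> ?I. eventually P (principal U)"
    then obtain U where "U \<subseteq> X" "\<phi> U" "U \<subseteq> {x \<in> X. P x}"
      by (auto simp: eventually_principal)
    then show "\<phi> {x \<in> X. P x}"
      by - (rule dvm_mono[OF assms, of U], auto)
  next
    assume "\<phi> {x \<in> X. P x}"
    then show "\<exists>U \<in> ?I. eventually P (principal U)"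
      by (intro bexI[of _ "{x \<in> X. P x}"]) (auto simp: eventually_principal)
  qed
  finally show ?thesis
    using assms by (simp add: dvm_ultra_def)
qed

lemma dvm_ultra_closed:
  assumes "\<phi> \<in> dvm X" shows "dvm_ultra X \<phi> \<in> ultrafilters X"
  unfolding ultrafilters_def mem_Collect_eq le_principal trivial_limit_def eventually_dvm_ultra[OF assms]
proof (intro conjI allI)
  show "\<not> \<phi> {x \<in> X. False}" "\<phi> {x \<in> X. x \<in> X}"
    using dvm_empty[OF assms] dvm_top[OF assms] by simp_all
  fix P
  have "{x \<in> X. \<not> P x} = X - {x \<in> X. P x}"
    by auto
  then show "\<phi> {x \<in> X. P x} \<or> \<phi> {x \<in> X. \<not> P x}"
    using dvm_Diff[OF assms, of "{x \<in> X. P x}"] by auto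
qed

text \<open>The characteristic function of an ultrafilter, inverse to \<open>dvm_ultra\<close>.\<close>

definition ultra_dvm :: "'x set \<Rightarrow> 'x filter \<Rightarrow> 'x set \<Rightarrow> bool" where
  "ultra_dvm X F = (\<lambda>U \<in> Pow X. eventually (\<lambda>x. x \<in> U) F)"

lemma ultra_dvm_closed:
  assumes "F \<in> ultrafilters X" shows "ultra_dvm X F \<in> dvm X"
  unfolding dvm_iff
proof (intro conjI ballI)
  show "\<not> ultra_dvm X F {}"
    using ultrafilterD(1)[OF assms] by (simp add: ultra_dvm_def trivial_limit_def)
  show "ultra_dvm X F (U \<inter> V) \<longleftrightarrow> ultra_dvm X F U \<and> ultra_dvm X F V" if "U \<in> Pow X" "V \<in> Pow X" for U V
    using that by (simp add: ultra_dvm_def le_infI1 eventually_conj_iff)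
  show "ultra_dvm X F U \<or> ultra_dvm X F (X - U)" if "U \<in> Pow X" for U
    using that ultrafilterD(3)[OF assms] ultrafilter_not[OF assms, of "\<lambda>x. x \<in> U"]
    by (auto simp: ultra_dvm_def eventually_conj_iff)
qed (simp add: ultra_dvm_def)

lemma dvm_ultra_dvm:
  assumes "F \<in> ultrafilters X" shows "dvm_ultra X (ultra_dvm X F) = F"
  unfolding filter_eq_iff eventually_dvm_ultra[OF ultra_dvm_closed[OF assms]]
  using ultrafilterD(3)[OF assms] by (auto simp: ultra_dvm_def eventually_conj_iff)

lemma ultra_dvm_ultra:
  assumes "\<phi> \<in> dvm X" shows "ultra_dvm X (dvm_ultra X \<phi>) = \<phi>"
proof (rule ext)
  fix U
  have "U \<subseteq> X \<Longrightarrow> {x \<in> X. x \<in> U} = U"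
    by auto
  then show "ultra_dvm X (dvm_ultra X \<phi>) U = \<phi> U"
    using dvm_ext[OF assms] by (simp add: ultra_dvm_def eventually_dvm_ultra[OF assms] extensional_def)
qed

lemma bij_betw_dvm_ultra: "bij_betw (dvm_ultra X) (dvm X) (ultrafilters X)"
  by (rule bij_betw_byWitness[where f' = "ultra_dvm X"])
    (auto simp: ultra_dvm_ultra dvm_ultra_dvm dvm_ultra_closed ultra_dvm_closed)

lemma ball_ultrafilters:
  "(\<forall>F \<in> ultrafilters X. P F) \<longleftrightarrow> (\<forall>\<phi> \<in> dvm X. P (dvm_ultra X \<phi>))"
  unfolding bij_betw_imp_surj_on[OF bij_betw_dvm_ultra, symmetric] by blast

lemma dvm_map_closed:
  assumes "f \<in> X \<rightarrow>\<^sub>E Y" "\<phi> \<in> dvm X"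
  shows "dvm_map X Y f \<phi> \<in> dvm Y"
  using dv_two_map_closed[OF de_vries_pow set_two_map_hom[OF assms(1)]] assms(2)
  unfolding dvm_map_def dvm_def by blast

text \<open>The join in the composition of \<open>deV\<close> is attained, since every element of a discrete algebra
  is strongly inside itself; the same happens for the multiplication below.\<close>

lemma dvm_map_eq:
  assumes f: "f \<in> X \<rightarrow>\<^sub>E Y" and \<phi>: "\<phi> \<in> dvm X"
  shows "dvm_map X Y f \<phi> = (\<lambda>V \<in> Pow Y. \<phi> {x \<in> X. f x \<in> V})"
proof -
  have "(\<exists>W \<in> Pow Y. well_inside (pow_dv Y) W V \<and> \<phi> (set_two_map X Y f W)) \<longleftrightarrow> \<phi> {x \<in> X. f x \<in> V}"
    if V: "V \<in> Pow Y" for V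
  proof
    assume "\<exists>W \<in> Pow Y. well_inside (pow_dv Y) W V \<and> \<phi> (set_two_map X Y f W)"
    then obtain W where "W \<subseteq> V" "\<phi> {x \<in> X. f x \<in> W}"
      using V by (auto simp: set_two_map_def)
    then show "\<phi> {x \<in> X. f x \<in> V}"
      by - (rule dvm_mono[OF \<phi>, of "{x \<in> X. f x \<in> W}"], auto)
  next
    assume "\<phi> {x \<in> X. f x \<in> V}"
    then show "\<exists>W \<in> Pow Y. well_inside (pow_dv Y) W V \<and> \<phi> (set_two_map X Y f W)"
      using V by (intro bexI[of _ V]) (auto simp: set_two_map_def)
  qed
  then have "(\<lambda>V \<in> Pow Y. \<exists>W \<in> Pow Y. well_inside (pow_dv Y) W V \<and> \<phi> (set_two_map X Y f W))
      = (\<lambda>V \<in> Pow Y. \<phi> {x \<in> X. f x \<in> V})"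
    by (rule restrict_ext)
  then show ?thesis
    using \<phi> by (simp add: dvm_map_def dvm_def dv_two_map_eq dv_comp_two)
qed

lemma dvm_unit_eq:
  assumes "x \<in> X" shows "dvm_unit X x = (\<lambda>U \<in> Pow X. x \<in> U)"
  using assms by (simp add: dvm_unit_def transpose_dv_def dv_id_def cong: restrict_cong)

lemma dvm_unit_closed:
  assumes "x \<in> X" shows "dvm_unit X x \<in> dvm X"
  using PiE_mem[OF transpose_dv_closed[OF de_vries_pow dv_id_hom[OF de_vries_pow]] assms]
  by (simp add: dvm_unit_def dvm_def)

text \<open>The counit sends \<open>a\<close> to the set of points that contain \<open>a\<close>, as in Stone duality.\<close>

lemma dv_counit_eq:
  "dv_counit A = (\<lambda>a \<in> carrier A. {\<phi> \<in> dv_hom A two_dv. \<phi> a})"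
  unfolding dv_counit_def transpose_set_def by (intro restrict_ext Collect_cong) auto

lemma dv_counit_hom:
  assumes "de_vries_algebra A"
  shows "dv_counit A \<in> dv_hom A (pow_dv (dv_hom A two_dv))"
  unfolding dv_counit_def by (rule transpose_set_closed[OF assms]) simp

lemma dvm_mult_closed:
  assumes "\<Phi> \<in> dvm (dvm X)" shows "dvm_mult X \<Phi> \<in> dvm X"
  using PiE_mem[OF dv_two_map_closed[OF de_vries_pow dv_counit_hom[OF de_vries_pow, of X]], of \<Phi>] assms
  by (simp add: dvm_mult_def dvm_def)

lemma dvm_mult_eq:
  assumes \<Phi>: "\<Phi> \<in> dvm (dvm X)"
  shows "dvm_mult X \<Phi> = (\<lambda>U \<in> Pow X. \<Phi> {\<phi> \<in> dvm X. \<phi> U})"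
proof -
  have "(\<exists>V \<in> Pow X. well_inside (pow_dv X) V U \<and> \<Phi> (dv_counit (pow_dv X) V)) \<longleftrightarrow> \<Phi> {\<phi> \<in> dvm X. \<phi> U}"
    if U: "U \<in> Pow X" for U
  proof
    assume "\<exists>V \<in> Pow X. well_inside (pow_dv X) V U \<and> \<Phi> (dv_counit (pow_dv X) V)"
    then obtain V where V: "V \<subseteq> U" "\<Phi> {\<phi> \<in> dvm X. \<phi> V}"
      using U by (auto simp: dv_counit_eq dvm_def)
    have "{\<phi> \<in> dvm X. \<phi> V} \<subseteq> {\<phi> \<in> dvm X. \<phi> U}"
      using V(1) U dvm_mono[of _ X V U] by blast
    then show "\<Phi> {\<phi> \<in> dvm X. \<phi> U}"
      using V(2) by - (rule dvm_mono[OF \<Phi>], auto)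
  next
    assume "\<Phi> {\<phi> \<in> dvm X. \<phi> U}"
    then show "\<exists>V \<in> Pow X. well_inside (pow_dv X) V U \<and> \<Phi> (dv_counit (pow_dv X) V)"
      using U by (intro bexI[of _ U]) (auto simp: dv_counit_eq dvm_def)
  qed
  then have "(\<lambda>U \<in> Pow X. \<exists>V \<in> Pow X. well_inside (pow_dv X) V U \<and> \<Phi> (dv_counit (pow_dv X) V))
      = (\<lambda>U \<in> Pow X. \<Phi> {\<phi> \<in> dvm X. \<phi> U})"
    by (rule restrict_ext)
  then show ?thesis
    using \<Phi> by (simp add: dvm_mult_def dvm_def[of "dvm X"] dv_two_map_eq dv_comp_two)
qed

lemma dvm_ultra_map:
  assumes f: "f \<in> X \<rightarrow>\<^sub>E Y" and \<phi>: "\<phi> \<in> dvm X"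
  shows "dvm_ultra Y (dvm_map X Y f \<phi>) = ultra_map X f (dvm_ultra X \<phi>)"
proof -
  have "{x \<in> X. f x \<in> {y \<in> Y. P y}} = {x \<in> X. P (f x)}" for P
    using f by auto
  then have "eventually P (dvm_ultra Y (dvm_map X Y f \<phi>)) \<longleftrightarrow> eventually P (filtermap f (dvm_ultra X \<phi>))" for P
    unfolding eventually_dvm_ultra[OF dvm_map_closed[OF f \<phi>]] eventually_filtermap
      eventually_dvm_ultra[OF \<phi>]
    unfolding dvm_map_eq[OF f \<phi>] by (simp add: Collect_restrict)
  then show ?thesis
    by (simp add: filter_eq_iff ultra_map_def dvm_ultra_closed[OF \<phi>])
qed

lemma dvm_ultra_unit:
  assumes "x \<in> X" shows "dvm_ultra X (dvm_unit X x) = ultra_unit X x"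
  unfolding filter_eq_iff eventually_dvm_ultra[OF dvm_unit_closed[OF assms]]
  using assms by (simp add: dvm_unit_eq ultra_unit_def eventually_principal Collect_restrict)

lemma ultra_map_dvm_ultra_closed:
  assumes "\<Phi> \<in> dvm (dvm X)"
  shows "ultra_map (dvm X) (dvm_ultra X) (dvm_ultra (dvm X) \<Phi>) \<in> ultrafilters (ultrafilters X)"
  using dvm_ultra_closed[OF assms] ultrafilter_filtermap[of _ "dvm X" "dvm_ultra X" "ultrafilters X"]
  by (auto simp: ultra_map_def dvm_ultra_closed)

lemma dvm_ultra_mult:
  assumes \<Phi>: "\<Phi> \<in> dvm (dvm X)"
  shows "dvm_ultra X (dvm_mult X \<Phi>) =
    ultra_mult X (ultra_map (dvm X) (dvm_ultra X) (dvm_ultra (dvm X) \<Phi>))"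
proof -
  have "{\<phi> \<in> dvm X. eventually P (dvm_ultra X \<phi>)} = {\<phi> \<in> dvm X. \<phi> {x \<in> X. P x}}" for P
    by (auto simp: eventually_dvm_ultra)
  then have "eventually P (dvm_ultra X (dvm_mult X \<Phi>)) \<longleftrightarrow>
      eventually P (filter_join (filtermap (dvm_ultra X) (dvm_ultra (dvm X) \<Phi>)))" for P
    unfolding eventually_dvm_ultra[OF dvm_mult_closed[OF \<Phi>]] eventually_filter_join eventually_filtermap
      eventually_dvm_ultra[OF \<Phi>]
    unfolding dvm_mult_eq[OF \<Phi>] by (simp add: Collect_restrict)
  then show ?thesis
    using ultra_map_dvm_ultra_closed[OF \<Phi>] dvm_ultra_closed[OF \<Phi>]
    by (simp add: filter_eq_iff ultra_mult_def ultra_map_def)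
qed

section \<open>Transfer of Eilenberg-Moore algebras\<close>

lemma the_inv_into_dvm_ultra:
  assumes "\<phi> \<in> dvm X"
  shows "the_inv_into (dvm X) (dvm_ultra X) (dvm_ultra X \<phi>) = \<phi>"
  using bij_betw_imp_inj_on[OF bij_betw_dvm_ultra] assms by (rule the_inv_into_f_f)

lemma alg_transfer_dvm_ultra:
  assumes "\<phi> \<in> dvm (fst P)"
  shows "snd (alg_transfer P) (dvm_ultra (fst P) \<phi>) = snd P \<phi>"
  using assms by (simp add: alg_transfer_def the_inv_into_dvm_ultra dvm_ultra_closed)

lemma fst_alg_transfer [simp]: "fst (alg_transfer P) = fst P"
  by (simp add: alg_transfer_def)

text \<open>The comparison of the monads is bijective on twofold applications as well, so the
  associativity laws of the two monads quantify over corresponding elements.\<close>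

lemma ball_ultrafilters_ultrafilters:
  "(\<forall>\<F> \<in> ultrafilters (ultrafilters X). P \<F>) \<longleftrightarrow>
    (\<forall>\<Phi> \<in> dvm (dvm X). P (ultra_map (dvm X) (dvm_ultra X) (dvm_ultra (dvm X) \<Phi>)))"
proof (intro iffI ballI)
  fix \<F> assume P: "\<forall>\<Phi> \<in> dvm (dvm X). P (ultra_map (dvm X) (dvm_ultra X) (dvm_ultra (dvm X) \<Phi>))"
    and F: "\<F> \<in> ultrafilters (ultrafilters X)"
  let ?G = "filtermap (ultra_dvm X) \<F>"
  have G: "?G \<in> ultrafilters (dvm X)"
    using F by (rule ultrafilter_filtermap) (auto intro: ultra_dvm_closed)
  have "filtermap (dvm_ultra X) ?G = filtermap (\<lambda>F. F) \<F>"
    unfolding filtermap_filtermap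
    by (rule filtermap_cong_ultrafilter[OF F]) (rule dvm_ultra_dvm)
  then have "ultra_map (dvm X) (dvm_ultra X) (dvm_ultra (dvm X) (ultra_dvm (dvm X) ?G)) = \<F>"
    using G by (simp add: dvm_ultra_dvm ultra_map_def filtermap_ident)
  then show "P \<F>"
    using P ultra_dvm_closed[OF G] by metis
qed (blast intro: ultra_map_dvm_ultra_closed)

text \<open>Algebras transport along an isomorphism of monads: each instance of a law for \<open>\<zeta>\<close>
  becomes the corresponding instance for \<open>\<xi>\<close>.\<close>

lemma transferred_laws:
  assumes \<xi>: "\<xi> \<in> dvm X \<rightarrow>\<^sub>E X" and \<zeta>: "\<zeta> \<in> ultrafilters X \<rightarrow>\<^sub>E X"
    and eq: "\<And>\<phi>. \<phi> \<in> dvm X \<Longrightarrow> \<zeta> (dvm_ultra X \<phi>) = \<xi> \<phi>"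
  shows "(X, \<zeta>) \<in> ultra_algs \<longleftrightarrow> (X, \<xi>) \<in> dvm_algs"
proof -
  have u: "\<zeta> (ultra_unit X x) = \<xi> (dvm_unit X x)" if "x \<in> X" for x
    using that by (simp add: dvm_ultra_unit[symmetric] eq dvm_unit_closed)
  have m: "\<zeta> (ultra_mult X \<F>) = \<xi> (dvm_mult X \<Phi>)"
    and n: "\<zeta> (ultra_map (ultrafilters X) \<zeta> \<F>) = \<xi> (dvm_map (dvm X) X \<xi> \<Phi>)"
    if \<Phi>: "\<Phi> \<in> dvm (dvm X)" and F: "\<F> = ultra_map (dvm X) (dvm_ultra X) (dvm_ultra (dvm X) \<Phi>)" for \<Phi> \<F>
  proof -
    show "\<zeta> (ultra_mult X \<F>) = \<xi> (dvm_mult X \<Phi>)"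
      unfolding F dvm_ultra_mult[OF \<Phi>, symmetric] by (rule eq) (rule dvm_mult_closed[OF \<Phi>])
    note cl = dvm_ultra_closed[OF \<Phi>]
    have "ultra_map (ultrafilters X) \<zeta> \<F> = filtermap \<zeta> (filtermap (dvm_ultra X) (dvm_ultra (dvm X) \<Phi>))"
      using ultra_map_dvm_ultra_closed[OF \<Phi>] cl by (simp add: F ultra_map_def)
    also have "\<dots> = filtermap \<xi> (dvm_ultra (dvm X) \<Phi>)"
      unfolding filtermap_filtermap
      by (rule filtermap_cong_ultrafilter[OF cl]) (rule eq)
    also have "\<dots> = dvm_ultra X (dvm_map (dvm X) X \<xi> \<Phi>)"
      using cl by (simp add: dvm_ultra_map[OF \<xi> \<Phi>] ultra_map_def)
    finally show "\<zeta> (ultra_map (ultrafilters X) \<zeta> \<F>) = \<xi> (dvm_map (dvm X) X \<xi> \<Phi>)"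
      by (simp add: eq dvm_map_closed[OF \<xi> \<Phi>])
  qed
  show ?thesis
    using \<xi> \<zeta> unfolding ultra_algs_def dvm_algs_def mem_Collect_eq case_prod_conv ball_ultrafilters_ultrafilters
    by (simp only: u m n cong: ball_cong)
qed

lemma alg_transfer_PiE:
  assumes "snd P \<in> dvm (fst P) \<rightarrow>\<^sub>E fst P"
  shows "snd (alg_transfer P) \<in> ultrafilters (fst P) \<rightarrow>\<^sub>E fst P"
proof (rule PiE_I)
  have "\<forall>F \<in> ultrafilters (fst P). snd (alg_transfer P) F \<in> fst P"
    unfolding ball_ultrafilters using assms by (auto simp: alg_transfer_dvm_ultra)
  then show "snd (alg_transfer P) F \<in> fst P" if "F \<in> ultrafilters (fst P)" for F
    using that by blast
qed (simp add: alg_transfer_def)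

lemma alg_transfer_closed:
  assumes "P \<in> dvm_algs" shows "alg_transfer P \<in> ultra_algs"
proof -
  have \<xi>: "snd P \<in> dvm (fst P) \<rightarrow>\<^sub>E fst P"
    using assms by (auto simp: dvm_algs_def)
  have "(fst P, snd (alg_transfer P)) \<in> ultra_algs"
    by (rule transferred_laws[THEN iffD2, OF \<xi> alg_transfer_PiE[OF \<xi>]])
      (simp_all add: assms alg_transfer_dvm_ultra)
  then show ?thesis
    by (metis fst_alg_transfer prod.collapse)
qed

lemma bij_betw_alg_transfer:
  "bij_betw alg_transfer (dvm_algs :: ('x set \<times> _) set) ultra_algs"
proof -
  let ?g = "\<lambda>P :: 'x set \<times> ('x filter \<Rightarrow> 'x). (fst P, \<lambda>\<phi> \<in> dvm (fst P). snd P (dvm_ultra (fst P) \<phi>))"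
  show ?thesis
  proof (rule bij_betw_byWitness[where f' = ?g])
    show "\<forall>P \<in> (dvm_algs :: ('x set \<times> _) set). ?g (alg_transfer P) = P"
    proof
      fix P :: "'x set \<times> (('x set \<Rightarrow> bool) \<Rightarrow> 'x)" assume "P \<in> dvm_algs"
      then have "snd P \<in> extensional (dvm (fst P))"
        by (auto simp: dvm_algs_def PiE_def)
      then have "(\<lambda>\<phi> \<in> dvm (fst P). snd (alg_transfer P) (dvm_ultra (fst P) \<phi>)) = snd P"
        by (simp add: alg_transfer_dvm_ultra extensional_restrict cong: restrict_cong)
      then show "?g (alg_transfer P) = P"
        by simp
    qed
    have ext: "snd (alg_transfer (?g P)) = snd P" and clo: "?g P \<in> dvm_algs"
      if P: "P \<in> ultra_algs" for P :: "'x set \<times> ('x filter \<Rightarrow> 'x)"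
    proof -
      have \<zeta>: "snd P \<in> ultrafilters (fst P) \<rightarrow>\<^sub>E fst P"
        using P by (auto simp: ultra_algs_def)
      then have g: "snd (?g P) \<in> dvm (fst P) \<rightarrow>\<^sub>E fst P"
        by (auto simp: dvm_ultra_closed)
      have eq: "snd P (dvm_ultra (fst P) \<phi>) = snd (?g P) \<phi>" if "\<phi> \<in> dvm (fst P)" for \<phi>
        using that by simp
      have "(fst P, snd (?g P)) \<in> dvm_algs"
        by (rule transferred_laws[THEN iffD1, OF g \<zeta> eq]) (use P in simp_all)
      then show "?g P \<in> dvm_algs"
        by (simp only: snd_conv)
      have "snd (alg_transfer (?g P)) (dvm_ultra (fst P) \<phi>) = snd P (dvm_ultra (fst P) \<phi>)"
        if "\<phi> \<in> dvm (fst P)" for \<phi>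
        using alg_transfer_dvm_ultra[of \<phi> "?g P"] that by simp
      then have on: "\<forall>F \<in> ultrafilters (fst P). snd (alg_transfer (?g P)) F = snd P F"
        by (simp add: ball_ultrafilters)
      show "snd (alg_transfer (?g P)) = snd P"
      proof (rule ext)
        fix F show "snd (alg_transfer (?g P)) F = snd P F"
          using on PiE_arb[OF \<zeta>] by (cases "F \<in> ultrafilters (fst P)") (simp_all add: alg_transfer_def)
      qed
    qed
    show "\<forall>P \<in> (ultra_algs :: ('x set \<times> _) set). alg_transfer (?g P) = P"
      using ext by (auto simp: prod_eq_iff)
    show "?g ` ultra_algs \<subseteq> dvm_algs"
      using clo by blast
    show "alg_transfer ` (dvm_algs :: ('x set \<times> _) set) \<subseteq> ultra_algs"
      by (auto intro: alg_transfer_closed)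
  qed
qed

lemma ultra_hom_alg_transfer:
  assumes P: "P \<in> dvm_algs" and Q: "Q \<in> dvm_algs"
  shows "ultra_hom (alg_transfer P) (alg_transfer Q) = dvm_hom P Q"
proof -
  have "(\<forall>F \<in> ultrafilters (fst P). f (snd (alg_transfer P) F) = snd (alg_transfer Q) (ultra_map (fst P) f F))
      \<longleftrightarrow> (\<forall>\<phi> \<in> dvm (fst P). f (snd P \<phi>) = snd Q (dvm_map (fst P) (fst Q) f \<phi>))"
    if f: "f \<in> fst P \<rightarrow>\<^sub>E fst Q" for f
    unfolding ball_ultrafilters
  proof (rule ball_cong[OF refl])
    fix \<phi> assume \<phi>: "\<phi> \<in> dvm (fst P)"
    show "f (snd (alg_transfer P) (dvm_ultra (fst P) \<phi>)) =
        snd (alg_transfer Q) (ultra_map (fst P) f (dvm_ultra (fst P) \<phi>)) \<longleftrightarrow>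
      f (snd P \<phi>) = snd Q (dvm_map (fst P) (fst Q) f \<phi>)"
      unfolding dvm_ultra_map[OF f \<phi>, symmetric]
      by (simp add: alg_transfer_dvm_ultra \<phi> dvm_map_closed[OF f \<phi>])
  qed
  then show ?thesis
    unfolding ultra_hom_def dvm_hom_def fst_alg_transfer by (intro Collect_cong conj_cong refl)
qed

section \<open>The comparison functor\<close>

text \<open>Strong inclusion composed with itself is strong inclusion: transitivity one way,
  interpolation the other.\<close>

lemma (in normal_contact_algebra) ex_inside_twice:
  assumes a: "a \<in> carrier A"
  shows "(\<exists>b \<in> carrier A. well_inside A b a \<and> (\<exists>c \<in> carrier A. well_inside A c b \<and> P c))
    \<longleftrightarrow> (\<exists>c \<in> carrier A. well_inside A c a \<and> P c)"
proof
  assume "\<exists>b \<in> carrier A. well_inside A b a \<and> (\<exists>c \<in> carrier A. well_inside A c b \<and> P c)"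
  then obtain b c where bc: "b \<in> carrier A" "well_inside A b a" "c \<in> carrier A" "well_inside A c b" "P c"
    by blast
  have "well_inside A c a"
    by (rule inside_mono[OF bc(3) bc(1) a a inside_le[OF bc(3,1,4)] bc(2)]) (simp add: a)
  then show "\<exists>c \<in> carrier A. well_inside A c a \<and> P c"
    using bc by blast
next
  assume "\<exists>c \<in> carrier A. well_inside A c a \<and> P c"
  then obtain c where c: "c \<in> carrier A" "well_inside A c a" "P c"
    by blast
  then obtain b where "b \<in> carrier A" "well_inside A c b" "well_inside A b a"
    using inside_interpolate a by blast
  then show "\<exists>b \<in> carrier A. well_inside A b a \<and> (\<exists>c \<in> carrier A. well_inside A c b \<and> P c)"
    using c by blast
qed

text \<open>At \<open>a\<close> both sides are the set of \<open>\<phi>\<close> that hold at \<open>\<alpha> c\<close> for some \<open>c \<lless> a\<close>; the left side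
  passes through one more strong inclusion.\<close>

lemma dv_counit_natural:
  assumes A: "de_vries_algebra A" and B: "de_vries_algebra B" and \<alpha>: "\<alpha> \<in> dv_hom A B"
  defines "X \<equiv> dv_hom A two_dv" and "Y \<equiv> dv_hom B two_dv"
  shows "dv_comp A (pow_dv Y) (set_two_map Y X (dv_two_map A B \<alpha>)) (dv_counit A)
    = dv_comp A (pow_dv Y) (dv_counit B) \<alpha>"
proof -
  interpret A: de_vries_algebra A by fact
  have f: "dv_two_map A B \<alpha> \<phi> \<in> X" if "\<phi> \<in> Y" for \<phi>
    using PiE_mem[OF dv_two_map_closed[OF A \<alpha>]] that by (simp add: X_def Y_def)
  have app: "dv_two_map A B \<alpha> \<phi> b \<longleftrightarrow> (\<exists>c \<in> carrier A. well_inside A c b \<and> \<phi> (\<alpha> c))"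
    if "\<phi> \<in> Y" "b \<in> carrier A" for \<phi> b
    using that by (simp add: Y_def dv_two_map_eq dv_comp_two)
  have l: "set_two_map Y X (dv_two_map A B \<alpha>) (dv_counit A b)
      = {\<phi> \<in> Y. \<exists>c \<in> carrier A. well_inside A c b \<and> \<phi> (\<alpha> c)}" if "b \<in> carrier A" for b
    using that f app by (auto simp: set_two_map_def dv_counit_eq X_def[symmetric])
  have r: "dv_counit B (\<alpha> b) = {\<phi> \<in> Y. \<phi> (\<alpha> b)}" if "b \<in> carrier A" for b
    using dv_hom_closed[OF \<alpha> that] by (simp add: dv_counit_eq Y_def)
  have un: "(\<Union>b \<in> {b \<in> carrier A. well_inside A b a}. set_two_map Y X (dv_two_map A B \<alpha>) (dv_counit A b))
      = (\<Union>b \<in> {b \<in> carrier A. well_inside A b a}. dv_counit B (\<alpha> b))" if a: "a \<in> carrier A" for a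
  proof (rule Set.set_eqI)
    fix \<phi>
    show "\<phi> \<in> (\<Union>b \<in> {b \<in> carrier A. well_inside A b a}. set_two_map Y X (dv_two_map A B \<alpha>) (dv_counit A b))
      \<longleftrightarrow> \<phi> \<in> (\<Union>b \<in> {b \<in> carrier A. well_inside A b a}. dv_counit B (\<alpha> b))"
      using A.ex_inside_twice[OF a, of "\<lambda>c. \<phi> (\<alpha> c)"] by (simp add: l r) blast
  qed
  have el: "dv_comp A (pow_dv Y) (set_two_map Y X (dv_two_map A B \<alpha>)) (dv_counit A) = (\<lambda>a \<in> carrier A.
      \<Union>b \<in> {b \<in> carrier A. well_inside A b a}. set_two_map Y X (dv_two_map A B \<alpha>) (dv_counit A b))"
    by (rule dv_comp_pow) (simp add: l)
  have er: "dv_comp A (pow_dv Y) (dv_counit B) \<alpha> = (\<lambda>a \<in> carrier A.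
      \<Union>b \<in> {b \<in> carrier A. well_inside A b a}. dv_counit B (\<alpha> b))"
    by (rule dv_comp_pow) (simp add: r)
  show ?thesis
    unfolding el er by (rule restrict_ext) (rule un)
qed

text \<open>Two applications of associativity around naturality of the counit. For \<open>B\<close> the powerset
  of \<open>deV(A,2)\<close> and \<open>\<alpha>\<close> the counit of \<open>A\<close> this is the associativity law of the comparison
  algebra.\<close>

lemma comparison_natural:
  assumes A: "de_vries_algebra A" and B: "de_vries_algebra B" and \<alpha>: "\<alpha> \<in> dv_hom A B"
    and \<Phi>: "\<Phi> \<in> dvm (dv_hom B two_dv)"
  shows "dv_two_map A B \<alpha> (snd (comparison B) \<Phi>) = snd (comparison A)
    (dvm_map (dv_hom B two_dv) (dv_hom A two_dv) (dv_two_map A B \<alpha>) \<Phi>)"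
proof -
  let ?X = "dv_hom A two_dv" and ?Y = "dv_hom B two_dv"
  let ?f = "set_two_map ?Y ?X (dv_two_map A B \<alpha>)"
  note two = de_vries_two
  have \<Phi>h: "\<Phi> \<in> dv_hom (pow_dv ?Y) two_dv"
    using \<Phi> by (simp add: dvm_def)
  have fh: "?f \<in> dv_hom (pow_dv ?X) (pow_dv ?Y)"
    by (rule set_two_map_hom) (rule dv_two_map_closed[OF A \<alpha>])
  have 1: "dv_comp B two_dv \<Phi> (dv_counit B) \<in> dv_hom B two_dv"
    by (rule dv_comp_hom[OF B two dv_counit_hom[OF B] \<Phi>h])
  have 2: "dv_comp (pow_dv ?X) two_dv \<Phi> ?f \<in> dv_hom (pow_dv ?X) two_dv"
    by (rule dv_comp_hom[OF de_vries_pow two fh \<Phi>h])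
  have "dv_two_map A B \<alpha> (snd (comparison B) \<Phi>) = dv_comp A two_dv (dv_comp B two_dv \<Phi> (dv_counit B)) \<alpha>"
    using 1 \<Phi>h by (simp add: comparison_def dv_two_map_eq)
  also have "\<dots> = dv_comp A two_dv \<Phi> (dv_comp A (pow_dv ?Y) (dv_counit B) \<alpha>)"
    by (rule dv_comp_assoc[OF A B de_vries_pow two \<alpha> dv_counit_hom[OF B] \<Phi>h])
  also have "\<dots> = dv_comp A two_dv \<Phi> (dv_comp A (pow_dv ?Y) ?f (dv_counit A))"
    by (simp only: dv_counit_natural[OF A B \<alpha>])
  also have "\<dots> = dv_comp A two_dv (dv_comp (pow_dv ?X) two_dv \<Phi> ?f) (dv_counit A)"
    by (rule dv_comp_assoc[OF A de_vries_pow de_vries_pow two dv_counit_hom[OF A] fh \<Phi>h, symmetric])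
  also have "\<dots> = snd (comparison A) (dvm_map ?Y ?X (dv_two_map A B \<alpha>) \<Phi>)"
    using 2 \<Phi>h by (simp add: comparison_def dvm_map_def dv_two_map_eq)
  finally show ?thesis .
qed

lemma comparison_PiE:
  assumes "de_vries_algebra A"
  shows "snd (comparison A) \<in> dvm (dv_hom A two_dv) \<rightarrow>\<^sub>E dv_hom A two_dv"
  unfolding comparison_def snd_conv dvm_def
  by (rule dv_two_map_closed[OF assms dv_counit_hom[OF assms]])

lemma comparison_apply:
  assumes "\<Phi> \<in> dvm (dv_hom A two_dv)"
  shows "snd (comparison A) \<Phi> = (\<lambda>a \<in> carrier A. \<exists>b \<in> carrier A.
    well_inside A b a \<and> \<Phi> {\<phi> \<in> dv_hom A two_dv. \<phi> b})"
  using assms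
  by (simp add: comparison_def dvm_def dv_two_map_eq dv_comp_two dv_counit_eq cong: bex_cong)

text \<open>The triangle identity, which for points of \<open>A\<close> is roundness.\<close>

lemma comparison_unit:
  assumes "\<phi> \<in> dv_hom A two_dv"
  shows "snd (comparison A) (dvm_unit (dv_hom A two_dv) \<phi>) = \<phi>"
proof (rule ext)
  fix a
  show "snd (comparison A) (dvm_unit (dv_hom A two_dv) \<phi>) a = \<phi> a"
  proof (cases "a \<in> carrier A")
    case True
    have "dvm_unit (dv_hom A two_dv) \<phi> {\<psi> \<in> dv_hom A two_dv. \<psi> b} \<longleftrightarrow> \<phi> b" for b
      unfolding dvm_unit_eq[OF assms] using assms by auto
    then show ?thesis
      using two_round[OF assms True] True by (simp add: comparison_apply[OF dvm_unit_closed[OF assms]])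
  next
    case False
    then show ?thesis
      using two_extensional[OF assms]
      by (simp add: comparison_apply[OF dvm_unit_closed[OF assms]] extensional_def)
  qed
qed

lemma comparison_alg:
  assumes A: "de_vries_algebra A"
  shows "comparison A \<in> dvm_algs"
proof -
  let ?X = "dv_hom A two_dv"
  have "snd (comparison A) (dvm_mult ?X \<Phi>) = snd (comparison A) (dvm_map (dvm ?X) ?X (snd (comparison A)) \<Phi>)"
    if "\<Phi> \<in> dvm (dvm ?X)" for \<Phi>
    using comparison_natural[OF A de_vries_pow dv_counit_hom[OF A], of \<Phi>] that
    by (simp add: dvm_def comparison_def dvm_mult_def)
  then have "(?X, snd (comparison A)) \<in> dvm_algs"
    unfolding dvm_algs_def using comparison_PiE[OF A] comparison_unit by blast
  then show ?thesis
    by (simp add: comparison_def)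
qed

lemma comparison_hom:
  assumes A: "de_vries_algebra A" and B: "de_vries_algebra B" and \<alpha>: "\<alpha> \<in> dv_hom A B"
  shows "dv_two_map A B \<alpha> \<in> dvm_hom (comparison B) (comparison A)"
proof -
  have "fst (comparison A) = dv_hom A two_dv" "fst (comparison B) = dv_hom B two_dv"
    by (simp_all add: comparison_def)
  then show ?thesis
    unfolding dvm_hom_def using dv_two_map_closed[OF A \<alpha>] comparison_natural[OF A B \<alpha>] by simp
qed

lemma comparison_space_khaus:
  assumes "de_vries_algebra A"
  shows "khaus (comparison_space A)"
  unfolding comparison_space_def
  by (intro khaus_manes_space alg_transfer_closed comparison_alg assms)

lemma topspace_comparison_space:
  assumes "de_vries_algebra A"
  shows "topspace (comparison_space A) = dv_hom A two_dv"
  unfolding comparison_space_def topspace_manes_space[OF alg_transfer_closed[OF comparison_alg[OF assms]]]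
  by (simp add: comparison_def)

lemma comparison_space_map:
  assumes A: "de_vries_algebra A" and B: "de_vries_algebra B" and \<alpha>: "\<alpha> \<in> dv_hom A B"
  shows "dv_two_map A B \<alpha> \<in> khaus_hom (comparison_space B) (comparison_space A)"
proof -
  note a = comparison_alg[OF A] and b = comparison_alg[OF B]
  show ?thesis
    unfolding comparison_space_def khaus_hom_manes_space[OF alg_transfer_closed[OF b] alg_transfer_closed[OF a]]
      ultra_hom_alg_transfer[OF b a] by (rule comparison_hom[OF A B \<alpha>])
qed

text \<open>The limit of \<open>\<Phi>\<close> contains \<open>a\<close> iff \<open>\<Phi>\<close> contains the set of points containing \<open>b\<close> for some
  \<open>b \<lless> a\<close>, and that set is included in the set of points containing \<open>a\<close>.\<close>

lemma openin_comparison_space: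
  assumes A: "de_vries_algebra A" and a: "a \<in> carrier A"
  shows "openin (comparison_space A) {\<phi> \<in> dv_hom A two_dv. \<phi> a}"
  unfolding comparison_space_def openin_manes_space fst_alg_transfer ball_ultrafilters
proof (intro conjI ballI impI)
  have X: "fst (comparison A) = dv_hom A two_dv"
    by (simp add: comparison_def)
  show "{\<phi> \<in> dv_hom A two_dv. \<phi> a} \<subseteq> fst (comparison A)"
    by (auto simp: X)
  fix \<Phi> assume \<Phi>: "\<Phi> \<in> dvm (fst (comparison A))"
    and mem: "snd (alg_transfer (comparison A)) (dvm_ultra (fst (comparison A)) \<Phi>) \<in> {\<phi> \<in> dv_hom A two_dv. \<phi> a}"
  interpret A: de_vries_algebra A by fact
  have \<Phi>': "\<Phi> \<in> dvm (dv_hom A two_dv)"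
    using \<Phi> by (simp add: X)
  obtain b where b: "b \<in> carrier A" "well_inside A b a" and \<Phi>b: "\<Phi> {\<phi> \<in> dv_hom A two_dv. \<phi> b}"
    using mem a by (auto simp: alg_transfer_dvm_ultra[OF \<Phi>] comparison_apply[OF \<Phi>'])
  have "{\<phi> \<in> dv_hom A two_dv. \<phi> b} \<subseteq> {\<phi> \<in> dv_hom A two_dv. \<phi> a}"
    using two_round[OF _ a] b by blast
  then have "\<Phi> {\<phi> \<in> dv_hom A two_dv. \<phi> a}"
    by - (rule dvm_mono[OF \<Phi>' \<Phi>b], auto)
  then show "eventually (\<lambda>\<phi>. \<phi> \<in> {\<phi> \<in> dv_hom A two_dv. \<phi> a}) (dvm_ultra (fst (comparison A)) \<Phi>)"
    unfolding eventually_dvm_ultra[OF \<Phi>] by (simp add: X)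
qed

section \<open>Clusters\<close>

text \<open>The inverse of \<open>point_cluster\<close>.\<close>

definition cluster_point :: "('a, 'm) contact_alg_scheme \<Rightarrow> 'a set \<Rightarrow> 'a \<Rightarrow> bool" where
  "cluster_point A \<cc> = (\<lambda>a \<in> carrier A. complement A a \<notin> \<cc>)"

lemma clusterD:
  assumes "\<cc> \<in> clusters A"
  shows cluster_subset: "\<cc> \<subseteq> carrier A"
    and cluster_nonempty: "\<cc> \<noteq> {}"
    and cluster_contact: "a \<in> \<cc> \<Longrightarrow> b \<in> \<cc> \<Longrightarrow> a \<frown>\<^bsub>A\<^esub> b"
    and cluster_prime: "a \<in> carrier A \<Longrightarrow> b \<in> carrier A \<Longrightarrow> a \<squnion>\<^bsub>A\<^esub> b \<in> \<cc> \<Longrightarrow> a \<in> \<cc> \<or> b \<in> \<cc>"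
    and cluster_maximal: "a \<in> carrier A \<Longrightarrow> (\<And>b. b \<in> \<cc> \<Longrightarrow> a \<frown>\<^bsub>A\<^esub> b) \<Longrightarrow> a \<in> \<cc>"
  using assms unfolding clusters_def by blast+

context de_vries_algebra
begin

lemma cluster_upward:
  assumes c: "\<cc> \<in> clusters A" and a: "a \<in> \<cc>" and b: "b \<in> carrier A" and ab: "a \<sqsubseteq> b"
  shows "b \<in> \<cc>"
proof (rule cluster_maximal[OF c b])
  fix d assume d: "d \<in> \<cc>"
  have "a \<in> carrier A" "d \<in> carrier A"
    using cluster_subset[OF c] a d by auto
  then show "b \<frown> d"
    using contact_mono[of a d b d] cluster_contact[OF c a d] b ab by simp
qed

lemma cluster_top:
  assumes c: "\<cc> \<in> clusters A" shows "\<top> \<in> \<cc>"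
proof -
  obtain a where a: "a \<in> \<cc>"
    using cluster_nonempty[OF c] by blast
  then have "a \<in> carrier A"
    using cluster_subset[OF c] by blast
  then show ?thesis
    using cluster_upward[OF c a] by simp
qed

lemma cluster_bottom:
  assumes c: "\<cc> \<in> clusters A" shows "\<bottom> \<notin> \<cc>"
  using cluster_contact[OF c, of \<bottom> \<bottom>] contact_nonzero[of \<bottom> \<bottom>] by auto

lemma cluster_join:
  assumes c: "\<cc> \<in> clusters A" and ab: "a \<in> carrier A" "b \<in> carrier A"
  shows "a \<squnion> b \<in> \<cc> \<longleftrightarrow> a \<in> \<cc> \<or> b \<in> \<cc>"
  using cluster_prime[OF c ab] cluster_upward[OF c, of _ "a \<squnion> b"] join_left[OF ab] join_right[OF ab] ab
  by auto

lemma cluster_complement: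
  assumes c: "\<cc> \<in> clusters A" and a: "a \<in> carrier A"
  shows "a \<in> \<cc> \<or> complement A a \<in> \<cc>"
  using cluster_prime[OF c a complement_closed[OF a]] cluster_top[OF c] by (simp add: join_complement[OF a])

lemma cluster_not_contact:
  assumes c: "\<cc> \<in> clusters A" and "a \<in> carrier A" "a \<notin> \<cc>"
  obtains b where "b \<in> \<cc>" "b \<in> carrier A" "\<not> a \<frown> b"
  using cluster_maximal[OF c] cluster_subset[OF c] assms(2,3) by blast

text \<open>Roundness comes from maximality of clusters: if \<open>a\<^sup>*\<close> is not in the cluster,
  some member \<open>d\<close> is not in contact with it, that is \<open>d \<lless> a\<close>; an interpolant \<open>e\<close> between
  them is strongly inside \<open>a\<close> and its complement is not in contact with \<open>d\<close>.\<close>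

lemma cluster_point_hom:
  assumes c: "\<cc> \<in> clusters A"
  shows "cluster_point A \<cc> \<in> dv_hom A two_dv"
  unfolding dv_hom_two_iff
proof (intro conjI ballI impI)
  show "cluster_point A \<cc> \<in> extensional (carrier A)"
    by (simp add: cluster_point_def)
  show "\<not> cluster_point A \<cc> \<bottom>"
    using cluster_top[OF c] by (simp add: cluster_point_def)
  show "cluster_point A \<cc> (a \<sqinter> b) \<longleftrightarrow> cluster_point A \<cc> a \<and> cluster_point A \<cc> b"
    if "a \<in> carrier A" "b \<in> carrier A" for a b
    using that cluster_join[OF c, of "complement A a" "complement A b"]
    by (simp add: cluster_point_def complement_meet)
  show "cluster_point A \<cc> a \<or> cluster_point A \<cc> b"
    if "a \<in> carrier A" "b \<in> carrier A" "well_inside A (complement A a) b" for a b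
    using that cluster_contact[OF c, of "complement A a" "complement A b"]
    by (auto simp: cluster_point_def well_inside_def)
  show "cluster_point A \<cc> a \<longleftrightarrow> (\<exists>b \<in> carrier A. well_inside A b a \<and> cluster_point A \<cc> b)"
    if a: "a \<in> carrier A" for a
  proof
    assume "cluster_point A \<cc> a"
    then have "complement A a \<notin> \<cc>"
      using a by (simp add: cluster_point_def)
    then obtain d where d: "d \<in> \<cc>" "d \<in> carrier A" "\<not> complement A a \<frown> d"
      by (rule cluster_not_contact[OF c complement_closed[OF a]])
    then have "well_inside A d a"
      using a contact_sym[of d "complement A a"] by (auto simp: well_inside_def)
    then obtain e where e: "e \<in> carrier A" "well_inside A d e" "well_inside A e a"
      using inside_interpolate[OF d(2) a] by blast
    have "complement A e \<notin> \<cc>"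
      using cluster_contact[OF c d(1)] e(2) by (auto simp: well_inside_def)
    then show "\<exists>b \<in> carrier A. well_inside A b a \<and> cluster_point A \<cc> b"
      using e by (auto simp: cluster_point_def)
  next
    assume "\<exists>b \<in> carrier A. well_inside A b a \<and> cluster_point A \<cc> b"
    then obtain b where b: "b \<in> carrier A" "well_inside A b a" "complement A b \<notin> \<cc>"
      by (auto simp: cluster_point_def)
    have "complement A a \<sqsubseteq> complement A b"
      using b a inside_le[of b a] by (simp add: complement_le_iff)
    then have "complement A a \<notin> \<cc>"
      using cluster_upward[OF c, of "complement A a" "complement A b"] b by blast
    then show "cluster_point A \<cc> a"
      using a by (simp add: cluster_point_def)
  qed
qed

text \<open>Dually to the previous lemma, maximality comes from roundness: if \<open>a\<^sup>*\<close>
  belongs to the filter, so does some \<open>b \<lless> a\<^sup>*\<close>, and this \<open>b\<close> is a member of the cluster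
  not in contact with \<open>a\<close>.\<close>

lemma point_cluster_closed:
  assumes \<phi>: "\<phi> \<in> dv_hom A two_dv"
  shows "point_cluster A \<phi> \<in> clusters A"
proof -
  let ?c = "{a \<in> carrier A. \<not> \<phi> (complement A a)}"
  have "?c \<in> clusters A"
    unfolding clusters_def
  proof (rule CollectI, intro conjI ballI impI)
    show "?c \<subseteq> carrier A"
      by blast
    have "\<top> \<in> ?c"
      using two_bottom[OF \<phi>] by simp
    then show "?c \<noteq> {}"
      by blast
    fix a b
    show "a \<frown> b" if "a \<in> ?c" "b \<in> ?c"
      using that two_complement[OF \<phi>, of "complement A a" "complement A b"]
      by (auto simp: well_inside_def)
  next
    fix a b assume "a \<in> carrier A" "b \<in> carrier A" "a \<squnion> b \<in> ?c"
    then show "a \<in> ?c \<or> b \<in> ?c"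
      using two_meet[OF \<phi>, of "complement A a" "complement A b"] by (auto simp: complement_join)
  next
    fix a assume a: "a \<in> carrier A" and con: "\<forall>b \<in> ?c. a \<frown> b"
    have "\<not> \<phi> (complement A a)"
    proof
      assume "\<phi> (complement A a)"
      then obtain b where b: "b \<in> carrier A" "well_inside A b (complement A a)" "\<phi> b"
        using two_round[OF \<phi> complement_closed[OF a]] by blast
      then have "\<not> \<phi> (complement A b)"
        using two_meet[OF \<phi> b(1) complement_closed[OF b(1)]] two_bottom[OF \<phi>]
        by (simp add: meet_complement)
      then have "a \<frown> b"
        using con b(1) by blast
      then show False
        using b(1,2) a contact_sym[of a b] by (simp add: well_inside_def)
    qed
    then show "a \<in> ?c"
      using a by blast
  qed
  then show ?thesis
    using \<phi> by (simp add: point_cluster_def)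
qed

lemma point_cluster_point:
  assumes c: "\<cc> \<in> clusters A"
  shows "point_cluster A (cluster_point A \<cc>) = \<cc>"
  using cluster_point_hom[OF c] cluster_subset[OF c]
  by (auto simp: point_cluster_def cluster_point_def)

lemma cluster_point_cluster:
  assumes \<phi>: "\<phi> \<in> dv_hom A two_dv"
  shows "cluster_point A (point_cluster A \<phi>) = \<phi>"
proof (rule ext)
  fix a show "cluster_point A (point_cluster A \<phi>) a = \<phi> a"
    using two_extensional[OF \<phi>] \<phi> by (simp add: point_cluster_def cluster_point_def extensional_def)
qed

lemma bij_betw_point_cluster:
  "bij_betw (point_cluster A) (dv_hom A two_dv) (clusters A)"
proof (rule bij_betw_byWitness[where f' = "cluster_point A"])
  show "\<forall>\<phi> \<in> dv_hom A two_dv. cluster_point A (point_cluster A \<phi>) = \<phi>"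
    by (intro ballI cluster_point_cluster)
  show "\<forall>\<cc> \<in> clusters A. point_cluster A (cluster_point A \<cc>) = \<cc>"
    by (intro ballI point_cluster_point)
  show "point_cluster A ` dv_hom A two_dv \<subseteq> clusters A"
    by (intro image_subsetI point_cluster_closed)
  show "cluster_point A ` clusters A \<subseteq> dv_hom A two_dv"
    by (intro image_subsetI cluster_point_hom)
qed

text \<open>The complements of the basic closed sets are closed under intersection, because
  \<open>a \<squnion> b\<close> belongs to a cluster iff \<open>a\<close> or \<open>b\<close> does.\<close>

lemma openin_Clust_base:
  "openin (Clust A) = arbitrary union_of (\<lambda>U. \<exists>a \<in> carrier A. U = clusters A - clusters_at A a)"
proof -
  have "istopology (arbitrary union_of (\<lambda>U. \<exists>a \<in> carrier A. U = clusters A - clusters_at A a))"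
  proof (rule istopology_base)
    fix S T assume "\<exists>a \<in> carrier A. S = clusters A - clusters_at A a"
      and "\<exists>a \<in> carrier A. T = clusters A - clusters_at A a"
    then obtain a b where ab: "a \<in> carrier A" "b \<in> carrier A"
      and S: "S = clusters A - clusters_at A a" and T: "T = clusters A - clusters_at A b"
      by blast
    have "S \<inter> T = clusters A - clusters_at A (a \<squnion> b)"
      unfolding S T clusters_at_def using cluster_join[OF _ ab] by blast
    then show "\<exists>a \<in> carrier A. S \<inter> T = clusters A - clusters_at A a"
      using ab by (intro bexI[of _ "a \<squnion> b"]) simp_all
  qed
  then show ?thesis
    by (simp add: Clust_def)
qed

lemma openin_Clust:
  assumes "a \<in> carrier A" shows "openin (Clust A) {\<cc> \<in> clusters A. a \<notin> \<cc>}"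
proof -
  have "{\<cc> \<in> clusters A. a \<notin> \<cc>} = clusters A - clusters_at A a"
    by (auto simp: clusters_at_def)
  then show ?thesis
    unfolding openin_Clust_base using assms by (intro union_of_inc) (auto simp: arbitrary_def)
qed

lemma topspace_Clust: "topspace (Clust A) = clusters A"
proof
  have "{\<cc> \<in> clusters A. \<bottom> \<notin> \<cc>} = clusters A"
    using cluster_bottom by blast
  then have "openin (Clust A) (clusters A)"
    using openin_Clust[of \<bottom>] by simp
  then show "clusters A \<subseteq> topspace (Clust A)"
    by (rule openin_subset)
  have "openin (Clust A) (topspace (Clust A))"
    by simp
  then show "topspace (Clust A) \<subseteq> clusters A"
    unfolding openin_Clust_base union_of_def by blast
qed

text \<open>A member of \<open>\<cc>\<close> outside \<open>\<dd>\<close> is not in contact with some member of \<open>\<dd>\<close>, and the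
  interpolation axiom for this pair provides \<open>e\<close>. No cluster misses both \<open>e\<close> and its
  complement, so the two open sets that they define are disjoint.\<close>

lemma clusters_separated:
  assumes c: "\<cc> \<in> clusters A" and d: "\<dd> \<in> clusters A" and a: "a \<in> \<cc>" "a \<notin> \<dd>"
  obtains e where "e \<in> carrier A" "e \<notin> \<cc>" "complement A e \<notin> \<dd>"
proof -
  have aA: "a \<in> carrier A"
    using cluster_subset[OF c] a by blast
  obtain b where b: "b \<in> \<dd>" "b \<in> carrier A" "\<not> a \<frown> b"
    by (rule cluster_not_contact[OF d aA a(2)])
  obtain e where e: "e \<in> carrier A" "\<not> a \<frown> e" "\<not> b \<frown> complement A e"
    using contact_interpolate[OF aA b(2,3)] by blast
  have "e \<notin> \<cc>" "complement A e \<notin> \<dd>"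
    using cluster_contact[OF c a(1), of e] cluster_contact[OF d b(1), of "complement A e"] e by blast+
  with e(1) show thesis
    by (rule that)
qed

lemma Hausdorff_Clust: "Hausdorff_space (Clust A)"
  unfolding Hausdorff_space_def topspace_Clust
proof (intro allI impI)
  have sep: "\<exists>U V. openin (Clust A) U \<and> openin (Clust A) V \<and> \<cc> \<in> U \<and> \<dd> \<in> V \<and> disjnt U V"
    if c: "\<cc> \<in> clusters A" and d: "\<dd> \<in> clusters A" and a: "a \<in> \<cc>" "a \<notin> \<dd>" for \<cc> \<dd> a
  proof -
    obtain e where e: "e \<in> carrier A" "e \<notin> \<cc>" "complement A e \<notin> \<dd>"
      by (rule clusters_separated[OF c d a])
    let ?U = "{\<cc> \<in> clusters A. e \<notin> \<cc>}" and ?V = "{\<cc> \<in> clusters A. complement A e \<notin> \<cc>}"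
    have "disjnt ?U ?V"
      using cluster_complement[OF _ e(1)] by (auto simp: disjnt_iff)
    then show ?thesis
      using openin_Clust[OF e(1)] openin_Clust[OF complement_closed[OF e(1)]] c d e(2,3) by blast
  qed
  fix \<cc> \<dd> assume cd: "\<cc> \<in> clusters A \<and> \<dd> \<in> clusters A \<and> \<cc> \<noteq> \<dd>"
  then consider a where "a \<in> \<cc>" "a \<notin> \<dd>" | a where "a \<in> \<dd>" "a \<notin> \<cc>"
    by blast
  then show "\<exists>U V. openin (Clust A) U \<and> openin (Clust A) V \<and> \<cc> \<in> U \<and> \<dd> \<in> V \<and> disjnt U V"
  proof cases
    case 1
    then show ?thesis
      using sep cd by blast
  next
    case 2
    then obtain U V where "openin (Clust A) U" "openin (Clust A) V" "\<dd> \<in> U" "\<cc> \<in> V" "disjnt U V"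
      using sep[of \<dd> \<cc> a] cd by blast
    then show ?thesis
      using disjnt_sym by blast
  qed
qed

end

text \<open>A continuous bijection from a compact to a Hausdorff space: the basic open set of
  clusters without \<open>a\<close> pulls back to the open set of points that contain \<open>a\<^sup>*\<close>.\<close>

lemma homeomorphic_point_cluster:
  assumes A: "de_vries_algebra A"
  shows "homeomorphic_map (comparison_space A) (Clust A) (point_cluster A)"
proof (rule continuous_imp_homeomorphic_map)
  interpret A: de_vries_algebra A by fact
  note X = topspace_comparison_space[OF A]
  show "compact_space (comparison_space A)"
    using comparison_space_khaus[OF A] by (simp add: khaus_def)
  show "Hausdorff_space (Clust A)"
    by (rule A.Hausdorff_Clust)
  show "point_cluster A ` topspace (comparison_space A) = topspace (Clust A)"
    "inj_on (point_cluster A) (topspace (comparison_space A))"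
    using A.bij_betw_point_cluster by (simp_all add: X A.topspace_Clust bij_betw_def)
  show "continuous_map (comparison_space A) (Clust A) (point_cluster A)"
  proof (rule continuous_map_into_topology_base[OF A.openin_Clust_base])
    show "point_cluster A \<phi> \<in> topspace (Clust A)" if "\<phi> \<in> topspace (comparison_space A)" for \<phi>
      using that by (simp add: X A.topspace_Clust A.point_cluster_closed)
    fix U assume "\<exists>a \<in> carrier A. U = clusters A - clusters_at A a"
    then obtain a where a: "a \<in> carrier A" and U: "U = clusters A - clusters_at A a"
      by blast
    have "point_cluster A \<phi> \<in> U \<longleftrightarrow> \<phi> (complement A a)" if "\<phi> \<in> dv_hom A two_dv" for \<phi>
      using A.point_cluster_closed[OF that] that a by (simp add: U clusters_at_def point_cluster_def)
    then have "{\<phi> \<in> topspace (comparison_space A). point_cluster A \<phi> \<in> U}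
        = {\<phi> \<in> dv_hom A two_dv. \<phi> (complement A a)}"
      unfolding X by (intro Collect_cong conj_cong refl)
    then show "openin (comparison_space A) {\<phi> \<in> topspace (comparison_space A). point_cluster A \<phi> \<in> U}"
      using openin_comparison_space[OF A A.complement_closed[OF a]] by simp
  qed
qed

lemma khaus_Clust:
  assumes A: "de_vries_algebra A"
  shows "khaus (Clust A)"
proof -
  interpret A: de_vries_algebra A by fact
  have "compact_space (Clust A)"
    using homeomorphic_compact_space[OF homeomorphic_map_imp_homeomorphic_space[OF homeomorphic_point_cluster[OF A]]]
      comparison_space_khaus[OF A] by (simp add: khaus_def)
  then show ?thesis
    by (simp add: khaus_def A.Hausdorff_Clust)
qed

text \<open>After unfolding, both sides consist of the \<open>a\<close> such that \<open>\<phi> (\<alpha> b)\<close> fails for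
  all \<open>b \<lless> a\<^sup>*\<close>.\<close>

lemma point_cluster_natural:
  assumes A: "de_vries_algebra A" and B: "de_vries_algebra B" and \<alpha>: "\<alpha> \<in> dv_hom A B"
    and \<phi>: "\<phi> \<in> dv_hom B two_dv"
  shows "point_cluster A (dv_two_map A B \<alpha> \<phi>) = Clust_map A B \<alpha> (point_cluster B \<phi>)"
proof -
  interpret A: de_vries_algebra A by fact
  interpret B: de_vries_algebra B by fact
  have "dv_two_map A B \<alpha> \<phi> \<in> dv_hom A two_dv"
    by (rule PiE_mem[OF dv_two_map_closed[OF A \<alpha>] \<phi>])
  then have "point_cluster A (dv_two_map A B \<alpha> \<phi>) = {a \<in> carrier A. \<not>
      (\<exists>b \<in> carrier A. well_inside A b (complement A a) \<and> \<phi> (\<alpha> b))}"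
    using \<phi> by (auto simp: point_cluster_def dv_two_map_eq dv_comp_two)
  also have "\<dots> = Clust_map A B \<alpha> (point_cluster B \<phi>)"
    using B.point_cluster_closed[OF \<phi>] \<phi> dv_hom_closed[OF \<alpha>]
    by (auto simp: Clust_map_def point_cluster_def)
  finally show ?thesis .
qed

text \<open>Continuity is inherited from \<open>deV(\<alpha>,2)\<close> along the homeomorphisms \<open>point_cluster\<close>.\<close>

lemma Clust_map_khaus_hom:
  assumes A: "de_vries_algebra A" and B: "de_vries_algebra B" and \<alpha>: "\<alpha> \<in> dv_hom A B"
  shows "Clust_map A B \<alpha> \<in> khaus_hom (Clust B) (Clust A)"
proof -
  interpret A: de_vries_algebra A by fact
  interpret B: de_vries_algebra B by fact
  have "continuous_map (comparison_space B) (comparison_space A) (dv_two_map A B \<alpha>)"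
    using comparison_space_map[OF A B \<alpha>] by (simp add: khaus_hom_def)
  then have "continuous_map (comparison_space B) (Clust A) (point_cluster A \<circ> dv_two_map A B \<alpha>)"
    by (rule continuous_map_compose) (rule homeomorphic_imp_continuous_map[OF homeomorphic_point_cluster[OF A]])
  then have "continuous_map (comparison_space B) (Clust A) (Clust_map A B \<alpha> \<circ> point_cluster B)"
    by (rule continuous_map_eq) (simp add: topspace_comparison_space[OF B] point_cluster_natural[OF A B \<alpha>])
  then have cont: "continuous_map (Clust B) (Clust A) (Clust_map A B \<alpha>)"
    by (rule continuous_compose_quotient_map[OF homeomorphic_point_cluster[OF B, unfolded homeomorphic_map_def, THEN conjunct1]])
  moreover have "Clust_map A B \<alpha> \<in> topspace (Clust B) \<rightarrow>\<^sub>E topspace (Clust A)"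
    using continuous_map_funspace[OF cont] by (simp add: PiE_def B.topspace_Clust Clust_map_def)
  ultimately show ?thesis
    by (simp add: khaus_hom_def)
qed

section \<open>The de Vries dual equivalence as a comparison functor\<close>

theorem theorem6p3:
  shows
    "\<comment> \<open>the adjunction between Set(-,2) and deV(-,2)\<close>
     (de_vries_algebra two_dv) \<and>
     (\<forall>X :: 'x set. de_vries_algebra (pow_dv X)) \<and>
     (\<forall>(X :: 'x set) (Y :: 'y set). \<forall>f \<in> X \<rightarrow>\<^sub>E Y.
        set_two_map X Y f \<in> dv_hom (pow_dv Y) (pow_dv X)) \<and>
     (\<forall>(A :: 'a contact_alg) (B :: 'b contact_alg).
        de_vries_algebra A \<longrightarrow> de_vries_algebra B \<longrightarrow>
        (\<forall>\<alpha> \<in> dv_hom A B. dv_two_map A B \<alpha> \<in> dv_hom B two_dv \<rightarrow>\<^sub>E dv_hom A two_dv)) \<and>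
     (\<forall>(A :: 'a contact_alg) (X :: 'x set). de_vries_algebra A \<longrightarrow>
        bij_betw (transpose_dv A X) (dv_hom A (pow_dv X)) (X \<rightarrow>\<^sub>E dv_hom A two_dv) \<and>
        (\<forall>f \<in> X \<rightarrow>\<^sub>E dv_hom A two_dv. transpose_set A X f \<in> dv_hom A (pow_dv X) \<and>
           transpose_dv A X (transpose_set A X f) = f)) \<and>
     (\<forall>(A :: 'a contact_alg) (B :: 'b contact_alg) (X :: 'x set) (Y :: 'y set).
        de_vries_algebra A \<longrightarrow> de_vries_algebra B \<longrightarrow>
        (\<forall>\<alpha> \<in> dv_hom A B. \<forall>f \<in> X \<rightarrow>\<^sub>E Y. \<forall>\<phi> \<in> dv_hom B (pow_dv Y).
           transpose_dv A X
             (dv_comp A (pow_dv X) (set_two_map X Y f) (dv_comp A (pow_dv Y) \<phi> \<alpha>))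
           = compose X (dv_two_map A B \<alpha>) (compose X (transpose_dv B Y \<phi>) f))) \<and>
     \<comment> \<open>the induced monad is isomorphic to the ultrafilter monad\<close>
     (\<forall>X :: 'x set. bij_betw (dvm_ultra X) (dvm X) (ultrafilters X)) \<and>
     (\<forall>(X :: 'x set) (Y :: 'y set). \<forall>f \<in> X \<rightarrow>\<^sub>E Y. \<forall>\<phi> \<in> dvm X.
        dvm_ultra Y (dvm_map X Y f \<phi>) = ultra_map X f (dvm_ultra X \<phi>)) \<and>
     (\<forall>X :: 'x set. \<forall>x \<in> X. dvm_ultra X (dvm_unit X x) = ultra_unit X x) \<and>
     (\<forall>X :: 'x set. \<forall>\<Phi> \<in> dvm (dvm X).
        dvm_ultra X (dvm_mult X \<Phi>)
        = ultra_mult X (ultra_map (dvm X) (dvm_ultra X) (dvm_ultra (dvm X) \<Phi>))) \<and>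
     \<comment> \<open>so its Eilenberg-Moore category is isomorphic over Set to that of the ultrafilter monad,\<close>
     (bij_betw alg_transfer (dvm_algs :: ('x set \<times> _) set) ultra_algs) \<and>
     (\<forall>(P :: 'x set \<times> _) \<in> dvm_algs. fst (alg_transfer P) = fst P) \<and>
     (\<forall>(P :: 'x set \<times> _) \<in> dvm_algs. \<forall>(Q :: 'y set \<times> _) \<in> dvm_algs.
        ultra_hom (alg_transfer P) (alg_transfer Q) = dvm_hom P Q) \<and>
     \<comment> \<open>which is isomorphic over Set to KHaus, structure maps being convergence of ultrafilters\<close>
     (bij_betw manes_space (ultra_algs :: ('x set \<times> _) set) {T. khaus T}) \<and>
     (\<forall>(P :: 'x set \<times> _) \<in> ultra_algs. topspace (manes_space P) = fst P) \<and>
     (\<forall>(P :: 'x set \<times> _) \<in> ultra_algs. \<forall>(Q :: 'y set \<times> _) \<in> ultra_algs.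
        khaus_hom (manes_space P) (manes_space Q) = ultra_hom P Q) \<and>
     (\<forall>(P :: 'x set \<times> _) \<in> ultra_algs. \<forall>F \<in> ultrafilters (fst P). \<forall>x.
        limitin (manes_space P) (\<lambda>y. y) x F \<longleftrightarrow> x = snd P F) \<and>
     \<comment> \<open>the comparison functor, lifting deV(-,2), first as algebras and then as spaces\<close>
     (\<forall>A :: 'a contact_alg. de_vries_algebra A \<longrightarrow> comparison A \<in> dvm_algs) \<and>
     (\<forall>(A :: 'a contact_alg) (B :: 'b contact_alg).
        de_vries_algebra A \<longrightarrow> de_vries_algebra B \<longrightarrow>
        (\<forall>\<alpha> \<in> dv_hom A B. dv_two_map A B \<alpha> \<in> dvm_hom (comparison B) (comparison A))) \<and>
     (\<forall>A :: 'a contact_alg. de_vries_algebra A \<longrightarrow>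
        dv_id A \<in> dv_hom A A \<and> dv_two_map A A (dv_id A) = (\<lambda>\<phi> \<in> dv_hom A two_dv. \<phi>)) \<and>
     (\<forall>(A :: 'a contact_alg) (B :: 'b contact_alg) (C :: 'c contact_alg).
        de_vries_algebra A \<longrightarrow> de_vries_algebra B \<longrightarrow> de_vries_algebra C \<longrightarrow>
        (\<forall>\<alpha> \<in> dv_hom A B. \<forall>\<beta> \<in> dv_hom B C.
           dv_comp A C \<beta> \<alpha> \<in> dv_hom A C \<and>
           dv_two_map A C (dv_comp A C \<beta> \<alpha>)
           = compose (dv_hom C two_dv) (dv_two_map A B \<alpha>) (dv_two_map B C \<beta>))) \<and>
     (\<forall>A :: 'a contact_alg. de_vries_algebra A \<longrightarrow>
        khaus (comparison_space A) \<and> topspace (comparison_space A) = dv_hom A two_dv) \<and>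
     (\<forall>(A :: 'a contact_alg) (B :: 'b contact_alg).
        de_vries_algebra A \<longrightarrow> de_vries_algebra B \<longrightarrow>
        (\<forall>\<alpha> \<in> dv_hom A B.
           dv_two_map A B \<alpha> \<in> khaus_hom (comparison_space B) (comparison_space A))) \<and>
     \<comment> \<open>the natural isomorphism with Clust\<close>
     (\<forall>A :: 'a contact_alg. de_vries_algebra A \<longrightarrow>
        khaus (Clust A) \<and> topspace (Clust A) = clusters A) \<and>
     (\<forall>(A :: 'a contact_alg) (B :: 'b contact_alg).
        de_vries_algebra A \<longrightarrow> de_vries_algebra B \<longrightarrow>
        (\<forall>\<alpha> \<in> dv_hom A B. Clust_map A B \<alpha> \<in> khaus_hom (Clust B) (Clust A))) \<and>
     (\<forall>A :: 'a contact_alg. de_vries_algebra A \<longrightarrow>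
        homeomorphic_map (comparison_space A) (Clust A) (point_cluster A)) \<and>
     (\<forall>(A :: 'a contact_alg) (B :: 'b contact_alg).
        de_vries_algebra A \<longrightarrow> de_vries_algebra B \<longrightarrow>
        (\<forall>\<alpha> \<in> dv_hom A B. \<forall>\<phi> \<in> dv_hom B two_dv.
           point_cluster A (dv_two_map A B \<alpha> \<phi>) = Clust_map A B \<alpha> (point_cluster B \<phi>)))"
  by (intro conjI allI impI ballI)
    (rule de_vries_two de_vries_pow set_two_map_hom dv_two_map_closed
      transpose_bij transpose_set_closed transpose_dv_set transpose_natural
      bij_betw_dvm_ultra dvm_ultra_map dvm_ultra_unit dvm_ultra_mult
      bij_betw_alg_transfer fst_alg_transfer ultra_hom_alg_transfer
      bij_betw_manes_space topspace_manes_space khaus_hom_manes_space limitin_manes_space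
      comparison_alg comparison_hom dv_id_hom dv_two_map_id dv_comp_hom dv_two_map_comp
      comparison_space_khaus topspace_comparison_space comparison_space_map
      khaus_Clust de_vries_algebra.topspace_Clust Clust_map_khaus_hom
      homeomorphic_point_cluster point_cluster_natural; assumption)+

end
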